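(* Let $(K,\Delta)$ be a differential field of characteristic $0$, $\Delta=\{\delta_1,\dots,\delta_m\}$ commuting derivations, such that $K$ is large as a field, and let $S$ be a differentially finitely generated $K$-algebra. If there is a (not necessarily differential) $K$-algebra homomorphism $S\to L$ for some field extension $L/K$ in which $K$ is existentially closed as a field (no derivations on $L$ are given), then there is a differential $K$-algebra homomorphism $S\to K[[\mathbf t]]$, where $\mathbf t=(t_1,\dots,t_m)$ and $K[[\mathbf t]]$ carries the derivations $\delta_i+\frac{\mathrm d}{\mathrm dt_i}$, $i=1,\dots,m$.
   Context: All rings are commutative and unital. A differential ring is a ring with $m$ commuting derivations. A differentially finitely generated $K$-algebra is a differential $K$-algebra generated as such by finitely many elements. On $K[[\mathbf t]]$, $\delta_i$ denotes the derivation acting coefficientwise (so $\delta_i(t_j)=0$), and the derivations $\delta_i+\frac{\mathrm d}{\mathrm dt_i}$ commute. A field $K$ is existentially closed in a field extension $L$ if every finite system of polynomial equations over $K$ with a solution in $L$ has a solution in $K$. A field $K$ is large if every irreducible affine algebraic variety over $K$ with a smooth $K$-point has a Zariski-dense set of $K$-points (equivalently $K$ is existentially closed in $K((t))$ as a field). *)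

theory Defs
  imports Complex_Main "HOL-Library.Poly_Mapping" "HOL-Library.Function_Algebras"
begin

section \<open>Homomorphisms, derivations and differential algebras\<close>

definition unital_ring_hom :: "('a::comm_ring_1 \<Rightarrow> 'b::comm_ring_1) \<Rightarrow> bool" where
  "unital_ring_hom h \<longleftrightarrow>
     h 1 = 1 \<and> (\<forall>x y. h (x + y) = h x + h y) \<and> (\<forall>x y. h (x * y) = h x * h y)"

text \<open>A \<open>K\<close>-algebra is a ring \<open>S\<close> together with its structure map \<open>\<alpha> : K \<rightarrow> S\<close>.\<close>

definition algebra_hom ::
    "('k::comm_ring_1 \<Rightarrow> 's::comm_ring_1) \<Rightarrow> ('k \<Rightarrow> 'r::comm_ring_1) \<Rightarrow> ('s \<Rightarrow> 'r) \<Rightarrow> bool" where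
  "algebra_hom \<alpha> \<beta> h \<longleftrightarrow> unital_ring_hom h \<and> (\<forall>c. h (\<alpha> c) = \<beta> c)"

definition derivation :: "('a::comm_ring_1 \<Rightarrow> 'a) \<Rightarrow> bool" where
  "derivation d \<longleftrightarrow>
     (\<forall>x y. d (x + y) = d x + d y) \<and> (\<forall>x y. d (x * y) = d x * y + x * d y)"

text \<open>The \<open>m\<close> derivations are \<open>\<delta> 0, \<dots>, \<delta> (m - 1)\<close>; the values \<open>\<delta> i\<close> for
  \<open>i \<ge> m\<close> play no role.\<close>

definition differential_ring :: "nat \<Rightarrow> (nat \<Rightarrow> 'a::comm_ring_1 \<Rightarrow> 'a) \<Rightarrow> bool" where
  "differential_ring m \<delta> \<longleftrightarrow>
     (\<forall>i<m. derivation (\<delta> i)) \<and> (\<forall>i<m. \<forall>j<m. \<forall>x. \<delta> i (\<delta> j x) = \<delta> j (\<delta> i x))"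

definition differential_algebra ::
    "nat \<Rightarrow> (nat \<Rightarrow> 'k::comm_ring_1 \<Rightarrow> 'k) \<Rightarrow> ('k \<Rightarrow> 's::comm_ring_1) \<Rightarrow>
     (nat \<Rightarrow> 's \<Rightarrow> 's) \<Rightarrow> bool" where
  "differential_algebra m \<delta> \<alpha> D \<longleftrightarrow>
     differential_ring m D \<and> unital_ring_hom \<alpha> \<and> (\<forall>i<m. \<forall>c. D i (\<alpha> c) = \<alpha> (\<delta> i c))"

definition differential_algebra_hom ::
    "nat \<Rightarrow> ('k::comm_ring_1 \<Rightarrow> 's::comm_ring_1) \<Rightarrow> (nat \<Rightarrow> 's \<Rightarrow> 's) \<Rightarrow>
     ('k \<Rightarrow> 'r::comm_ring_1) \<Rightarrow> (nat \<Rightarrow> 'r \<Rightarrow> 'r) \<Rightarrow> ('s \<Rightarrow> 'r) \<Rightarrow> bool" where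
  "differential_algebra_hom m \<alpha> D \<beta> D' h \<longleftrightarrow>
     algebra_hom \<alpha> \<beta> h \<and> (\<forall>i<m. \<forall>s. h (D i s) = D' i (h s))"

inductive_set diff_generated ::
    "nat \<Rightarrow> ('k::comm_ring_1 \<Rightarrow> 's::comm_ring_1) \<Rightarrow> (nat \<Rightarrow> 's \<Rightarrow> 's) \<Rightarrow> 's set \<Rightarrow> 's set"
  for m \<alpha> D G where
  scalar: "\<alpha> c \<in> diff_generated m \<alpha> D G"
| gen: "g \<in> G \<Longrightarrow> g \<in> diff_generated m \<alpha> D G"
| add: "x \<in> diff_generated m \<alpha> D G \<Longrightarrow> y \<in> diff_generated m \<alpha> D G \<Longrightarrow>
          x + y \<in> diff_generated m \<alpha> D G"
| mult: "x \<in> diff_generated m \<alpha> D G \<Longrightarrow> y \<in> diff_generated m \<alpha> D G \<Longrightarrow>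
          x * y \<in> diff_generated m \<alpha> D G"
| deriv: "x \<in> diff_generated m \<alpha> D G \<Longrightarrow> i < m \<Longrightarrow> D i x \<in> diff_generated m \<alpha> D G"

definition differentially_finitely_generated ::
    "nat \<Rightarrow> ('k::comm_ring_1 \<Rightarrow> 's::comm_ring_1) \<Rightarrow> (nat \<Rightarrow> 's \<Rightarrow> 's) \<Rightarrow> bool" where
  "differentially_finitely_generated m \<alpha> D \<longleftrightarrow>
     (\<exists>G. finite G \<and> diff_generated m \<alpha> D G = UNIV)"


section \<open>Polynomials and existential closedness\<close>

text \<open>Polynomials in the variables \<open>x\<^sub>0, x\<^sub>1, \<dots>\<close>, as finitely supported functions from
  exponent vectors to coefficients.\<close>

type_synonym 'k mpoly = "(nat \<Rightarrow>\<^sub>0 nat) \<Rightarrow>\<^sub>0 'k"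

text \<open>The value at \<open>x\<close> of the polynomial obtained by applying the ring homomorphism
  \<open>h\<close> to the coefficients of \<open>p\<close>.\<close>

definition mpoly_eval ::
    "('k::comm_ring_1 \<Rightarrow> 'r::comm_ring_1) \<Rightarrow> 'k mpoly \<Rightarrow> (nat \<Rightarrow> 'r) \<Rightarrow> 'r" where
  "mpoly_eval h p x =
     (\<Sum>e\<in>Poly_Mapping.keys p. h (Poly_Mapping.lookup p e) * (\<Prod>i\<in>Poly_Mapping.keys e. x i ^ Poly_Mapping.lookup e i))"

definition existentially_closed :: "('k::field \<Rightarrow> 'l::field) \<Rightarrow> bool" where
  "existentially_closed \<iota> \<longleftrightarrow>
     (\<forall>F::'k mpoly set. finite F \<longrightarrow>
        (\<exists>x::nat \<Rightarrow> 'l. \<forall>f\<in>F. mpoly_eval \<iota> f x = 0) \<longrightarrow>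
        (\<exists>x::nat \<Rightarrow> 'k. \<forall>f\<in>F. mpoly_eval (\<lambda>c. c) f x = 0))"


section \<open>Affine varieties and large fields\<close>

text \<open>The subring \<open>k[x\<^sub>0, \<dots>, x\<^sub>n\<^sub>-\<^sub>1]\<close>.\<close>

definition mpoly_ring :: "nat \<Rightarrow> 'k::comm_ring_1 mpoly set" where
  "mpoly_ring n = {p. \<forall>e\<in>Poly_Mapping.keys p. Poly_Mapping.keys e \<subseteq> {..<n}}"

definition mpoly_const :: "'k::comm_ring_1 \<Rightarrow> 'k mpoly" where
  "mpoly_const c = Poly_Mapping.single 0 c"

definition mpoly_pderiv :: "nat \<Rightarrow> 'k::comm_ring_1 mpoly \<Rightarrow> 'k mpoly" where
  "mpoly_pderiv j p =
     (\<Sum>e\<in>Poly_Mapping.keys p. Poly_Mapping.single (e - Poly_Mapping.single j 1)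
                    (of_nat (Poly_Mapping.lookup e j) * Poly_Mapping.lookup p e))"

text \<open>An irreducible affine variety in affine \<open>n\<close>-space over \<open>k\<close> is represented by its
  vanishing ideal, a prime ideal \<open>P\<close> of \<open>k[x\<^sub>0, \<dots>, x\<^sub>n\<^sub>-\<^sub>1]\<close>; its coordinate ring is
  \<open>k[x\<^sub>0, \<dots>, x\<^sub>n\<^sub>-\<^sub>1] / P\<close>.\<close>

definition irreducible_variety :: "nat \<Rightarrow> 'k::field mpoly set \<Rightarrow> bool" where
  "irreducible_variety n P \<longleftrightarrow>
     P \<subseteq> mpoly_ring n \<and> 0 \<in> P \<and> 1 \<notin> P \<and>
     (\<forall>f\<in>P. \<forall>g\<in>P. f + g \<in> P) \<and>
     (\<forall>f\<in>mpoly_ring n. \<forall>g\<in>P. f * g \<in> P) \<and>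
     (\<forall>f\<in>mpoly_ring n. \<forall>g\<in>mpoly_ring n. f * g \<in> P \<longrightarrow> f \<in> P \<or> g \<in> P)"

text \<open>Points of affine \<open>n\<close>-space are functions on \<open>nat\<close> of which only the first \<open>n\<close>
  values matter.\<close>

definition rational_points :: "'k::field mpoly set \<Rightarrow> (nat \<Rightarrow> 'k) set" where
  "rational_points P = {a. \<forall>f\<in>P. mpoly_eval (\<lambda>c. c) f a = 0}"

text \<open>The dimension is the transcendence degree of the coordinate ring, that is, the largest
  number \<open>d\<close> of elements (the classes of \<open>g 0, \<dots>, g (d - 1)\<close>) that are algebraically
  independent over \<open>k\<close>.\<close>

definition algebraically_independent_mod ::
    "'k::field mpoly set \<Rightarrow> nat \<Rightarrow> (nat \<Rightarrow> 'k mpoly) \<Rightarrow> bool" where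
  "algebraically_independent_mod P d g \<longleftrightarrow>
     (\<forall>q\<in>mpoly_ring d. mpoly_eval mpoly_const q g \<in> P \<longrightarrow> q = 0)"

definition variety_dim :: "nat \<Rightarrow> 'k::field mpoly set \<Rightarrow> nat" where
  "variety_dim n P =
     (GREATEST d. \<exists>g. (\<forall>i<d. g i \<in> mpoly_ring n) \<and> algebraically_independent_mod P d g)"

global_interpretation coord_space: vector_space "\<lambda>(c::'k::field) (v::nat \<Rightarrow> 'k) i. c * v i"
  by unfold_locales (auto simp: fun_eq_iff algebra_simps)

text \<open>Jacobian criterion. The rank of the Jacobian matrix at \<open>a\<close> is computed with all
  \<open>f \<in> P\<close>: at a point of the variety their gradients span the same space as those of any
  generating set of \<open>P\<close>. Entries with \<open>j \<ge> n\<close> vanish.\<close>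

definition jacobian_rank :: "'k::field mpoly set \<Rightarrow> (nat \<Rightarrow> 'k) \<Rightarrow> nat" where
  "jacobian_rank P a =
     coord_space.dim ((\<lambda>f j. mpoly_eval (\<lambda>c. c) (mpoly_pderiv j f) a) ` P)"

definition smooth_point :: "nat \<Rightarrow> 'k::field mpoly set \<Rightarrow> (nat \<Rightarrow> 'k) \<Rightarrow> bool" where
  "smooth_point n P a \<longleftrightarrow>
     a \<in> rational_points P \<and> jacobian_rank P a + variety_dim n P = n"

definition zariski_dense_points :: "nat \<Rightarrow> 'k::field mpoly set \<Rightarrow> bool" where
  "zariski_dense_points n P \<longleftrightarrow>
     (\<forall>g\<in>mpoly_ring n. (\<forall>b\<in>rational_points P. mpoly_eval (\<lambda>c. c) g b = 0) \<longrightarrow> g \<in> P)"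

definition large_field :: "'k::field itself \<Rightarrow> bool" where
  "large_field (_ :: 'k itself) \<longleftrightarrow>
     (\<forall>n (P :: 'k mpoly set). irreducible_variety n P \<longrightarrow> (\<exists>a. smooth_point n P a) \<longrightarrow>
        zariski_dense_points n P)"


section \<open>Multivariate formal power series\<close>

text \<open>Formal power series in the variables \<open>t\<^sub>0, t\<^sub>1, \<dots>\<close>. Series in the first \<open>m\<close> variables
  form the subring \<open>mps_ring m\<close> below.\<close>

typedef 'a mps = "UNIV :: ((nat \<Rightarrow>\<^sub>0 nat) \<Rightarrow> 'a) set"
  morphisms mps_nth Abs_mps
  by simp

lemma mps_nth_Abs [simp]: "mps_nth (Abs_mps f) = f"
  by (simp add: Abs_mps_inverse)

lemma mps_eqI: "(\<And>e. mps_nth f e = mps_nth g e) \<Longrightarrow> f = g"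
  by (metis ext mps_nth_inject)

lemma finite_exponent_splittings:
  fixes e :: "nat \<Rightarrow>\<^sub>0 nat"
  shows "finite {(a, b). a + b = e}"
proof -
  define F where "F = {f :: nat \<Rightarrow> nat.
    \<forall>i. (i \<in> Poly_Mapping.keys e \<longrightarrow> f i \<in> (\<Union>j\<in>Poly_Mapping.keys e. {..Poly_Mapping.lookup e j})) \<and>
        (i \<notin> Poly_Mapping.keys e \<longrightarrow> f i = 0)}"
  have "finite F"
    unfolding F_def by (intro finite_set_of_finite_funs) auto
  have le: "Poly_Mapping.lookup a i \<le> Poly_Mapping.lookup e i" if "a + b = e" for a b i
    using that by (auto simp: Poly_Mapping.lookup_add)
  have "Poly_Mapping.lookup a \<in> F" if "a + b = e" for a b
  proof -
    have "Poly_Mapping.lookup a i = 0" if "i \<notin> Poly_Mapping.keys e" for i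
      using le[OF \<open>a + b = e\<close>, of i] that by (simp add: Poly_Mapping.in_keys_iff)
    then show ?thesis
      unfolding F_def using le[OF that] by blast
  qed
  then have "Poly_Mapping.lookup ` {a. \<exists>b. a + b = e} \<subseteq> F"
    by blast
  then have "finite {a. \<exists>b. a + b = e}"
    using \<open>finite F\<close>
    by (rule inj_on_finite[rotated]) (simp add: inj_on_def poly_mapping.lookup_inject)
  moreover have "{(a, b). a + b = e} \<subseteq> (\<lambda>a. (a, e - a)) ` {a. \<exists>b. a + b = e}"
    by (auto simp: image_iff)
  ultimately show ?thesis
    by (meson finite_imageI finite_subset)
qed

instantiation mps :: (comm_ring_1) comm_ring_1
begin

definition "0 = Abs_mps (\<lambda>_. 0)"
definition "1 = Abs_mps (\<lambda>e. if e = 0 then 1 else 0)"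
definition "f + g = Abs_mps (\<lambda>e. mps_nth f e + mps_nth g e)"
definition "f - g = Abs_mps (\<lambda>e. mps_nth f e - mps_nth g e)"
definition "- f = Abs_mps (\<lambda>e. - mps_nth f e)"
definition "f * g = Abs_mps (\<lambda>e. \<Sum>(a, b)\<in>{(a, b). a + b = e}. mps_nth f a * mps_nth g b)"

instance
proof
  fix f g h :: "'a mps"
  show "f * g * h = f * (g * h)"
  proof (rule mps_eqI)
    fix e
    let ?S = "\<lambda>e. {(a, b). a + b = (e :: nat \<Rightarrow>\<^sub>0 nat)}"
    have "mps_nth (f * g * h) e =
        (\<Sum>p\<in>?S e. \<Sum>q\<in>?S (fst p). mps_nth f (fst q) * mps_nth g (snd q) * mps_nth h (snd p))"
      by (simp add: times_mps_def case_prod_unfold sum_distrib_right)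
    also have "\<dots> = (\<Sum>(p, q)\<in>(SIGMA p:?S e. ?S (fst p)).
        mps_nth f (fst q) * mps_nth g (snd q) * mps_nth h (snd p))"
      by (rule sum.Sigma) (use finite_exponent_splittings in auto)
    also have "\<dots> = (\<Sum>(p, q)\<in>(SIGMA p:?S e. ?S (snd p)).
        mps_nth f (fst p) * (mps_nth g (fst q) * mps_nth h (snd q)))"
      by (rule sum.reindex_bij_witness[where
            i = "\<lambda>((a, r), (b, c)). ((a + b, c), (a, b))" and
            j = "\<lambda>((r, c), (a, b)). ((a, b + c), (b, c))"])
         (auto simp: add.assoc mult.assoc)
    also have "\<dots> = (\<Sum>p\<in>?S e. \<Sum>q\<in>?S (snd p).
        mps_nth f (fst p) * (mps_nth g (fst q) * mps_nth h (snd q)))"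
      by (rule sum.Sigma[symmetric]) (use finite_exponent_splittings in auto)
    also have "\<dots> = mps_nth (f * (g * h)) e"
      by (simp add: times_mps_def case_prod_unfold sum_distrib_left)
    finally show "mps_nth (f * g * h) e = mps_nth (f * (g * h)) e" .
  qed
  show "f * g = g * f"
  proof (rule mps_eqI)
    fix e
    show "mps_nth (f * g) e = mps_nth (g * f) e"
      unfolding times_mps_def mps_nth_Abs
      by (rule sum.reindex_bij_witness[where i = prod.swap and j = prod.swap])
         (auto simp: add.commute mult.commute)
  qed
  show "1 * f = f"
  proof (rule mps_eqI)
    fix e
    have "mps_nth (1 * f) e =
        (\<Sum>p\<in>{(a, b). a + b = e}. if p = (0, e) then mps_nth f e else 0)"
      unfolding times_mps_def one_mps_def mps_nth_Abs by (rule sum.cong) (auto split: if_splits)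
    also have "\<dots> = mps_nth f e"
      by (subst sum.delta) (auto simp: finite_exponent_splittings)
    finally show "mps_nth (1 * f) e = mps_nth f e" .
  qed
  show "(f + g) * h = f * h + g * h"
    by (rule mps_eqI)
       (simp add: times_mps_def plus_mps_def case_prod_unfold distrib_right sum.distrib)
  show "f + g + h = f + (g + h)" "f + g = g + f" "0 + f = f" "- f + f = 0" "f - g = f + - g"
    by (rule mps_eqI; simp add: plus_mps_def zero_mps_def uminus_mps_def minus_mps_def
          algebra_simps)+
  show "(0 :: 'a mps) \<noteq> 1"
  proof
    assume "(0 :: 'a mps) = 1"
    then have "mps_nth (0 :: 'a mps) 0 = mps_nth 1 0"
      by simp
    then show False
      by (simp add: zero_mps_def one_mps_def)
  qed
qed

end

definition mps_ring :: "nat \<Rightarrow> 'a::comm_ring_1 mps set" where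
  "mps_ring m = {f. \<forall>e. mps_nth f e \<noteq> 0 \<longrightarrow> Poly_Mapping.keys e \<subseteq> {..<m}}"

definition mps_const :: "'a::comm_ring_1 \<Rightarrow> 'a mps" where
  "mps_const c = Abs_mps (\<lambda>e. if e = 0 then c else 0)"

definition mps_map :: "('a::comm_ring_1 \<Rightarrow> 'a) \<Rightarrow> 'a mps \<Rightarrow> 'a mps" where
  "mps_map d f = Abs_mps (\<lambda>e. d (mps_nth f e))"

text \<open>The partial derivative \<open>d/dt\<^sub>i\<close>.\<close>

definition mps_pderiv :: "nat \<Rightarrow> 'a::comm_ring_1 mps \<Rightarrow> 'a mps" where
  "mps_pderiv i f =
     Abs_mps (\<lambda>e. of_nat (Poly_Mapping.lookup e i + 1) * mps_nth f (e + Poly_Mapping.single i 1))"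

definition mps_twisted_deriv ::
    "(nat \<Rightarrow> 'a::comm_ring_1 \<Rightarrow> 'a) \<Rightarrow> nat \<Rightarrow> 'a mps \<Rightarrow> 'a mps" where
  "mps_twisted_deriv \<delta> i f = mps_map (\<delta> i) f + mps_pderiv i f"

end

theory Submission
  imports Defs "HOL-Computational_Algebra.Computational_Algebra" "HOL-Algebra.Algebraic_Closure_Type"
begin

text \<open>Twisted Taylor expansion turns a \<open>K\<close>-algebra homomorphism \<open>S \<rightarrow> K\<close> into a differential one
  \<open>S \<rightarrow> K[[t]]\<close>, so it suffices to find a \<open>K\<close>-rational point of \<open>S\<close>. Write \<open>S\<close> as a quotient of the
  differential polynomial ring \<open>R\<close>, let \<open>P\<close> be the kernel of \<open>R \<rightarrow> S \<rightarrow> L\<close>, and let \<open>Q \<subseteq> P\<close> be the largest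
  differential ideal contained in it; it contains the kernel of \<open>R \<rightarrow> S\<close>. As in the theory of
  characteristic sets, differentiating the equation of a leader makes all its proper derivatives
  linear with the separant as coefficient; by Dickson's lemma a rational point of \<open>Q\<close> is therefore
  determined by a solution in \<open>K\<close> of finitely many triangular equations at which finitely many
  initials and separants, all outside \<open>Q\<close>, do not vanish.

  For a generic integer combination \<open>\<theta>\<close> of the derivations, each of these initials and separants
  \<open>h\<close> satisfies \<open>\<theta>\<^sup>k h \<notin> P\<close> for some \<open>k\<close>, whereas all \<open>\<theta>\<^sup>j\<close>-derivatives of the equations lie in \<open>P\<close>. Existential
  closedness provides a homomorphism \<open>R \<rightarrow> K\<close> with finitely many of these properties, whose twisted
  Taylor expansion along \<open>\<theta>\<close> solves the equations in \<open>K[[s]]\<close> up to high order. Newton's method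
  turns it into an exact solution on a curve with a smooth rational point, and largeness moves
  from there to a point where the initials and separants do not vanish.\<close>

subsection \<open>Polynomials in countably many variables\<close>

text \<open>The obstacle is that the given map to L respects no derivation: its kernel P is not a
  differential ideal, and initials and separants, although outside Q, may all vanish at the given
  point. Their nonvanishing cannot be transferred to K as it stands. What can be transferred is that
  some iterated derivative along \<open>\<theta>\<close>, say the k-th, does not vanish, and this
  bounds by k the order of the initial or separant along the formal curve that the Taylor map
  attaches to a point. A single direction keeps the geometry in one variable s: the variety given to
  largeness is a curve, whose dimension can be computed by hand. Existential closedness sees only
  finitely many equations, so the series solve the system only modulo a power of s. Order
  \<open>(r + 1) * (k + 1)\<close> suffices for r triangular equations whose separants have order at
  most k: each variable gets its own level of precision, in steps of k + 1. Characteristic 0 enters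
  through the factorials in the Taylor coefficients, the separants and the integral
  direction.\<close>

lemma unital_ring_homD:
  assumes "unital_ring_hom h"
  shows "h 1 = 1" "h (x + y) = h x + h y" "h (x * y) = h x * h y" "h 0 = 0"
    "h (- x) = - h x" "h (x - y) = h x - h y"
proof -
  show "h 1 = 1" and add: "\<And>x y. h (x + y) = h x + h y" and "h (x * y) = h x * h y"
    using assms by (auto simp: unital_ring_hom_def)
  show 0: "h 0 = 0" using add[of 0 0] by simp
  show m: "h (- x) = - h x" for x using add[of x "- x"] 0 by (simp add: eq_neg_iff_add_eq_0 add.commute)
  show "h (x - y) = h x - h y" using add[of x "- y"] m by simp
qed

lemma unital_ring_hom_power: "unital_ring_hom h \<Longrightarrow> h (x ^ n) = h x ^ n"
  by (induction n) (simp_all add: unital_ring_homD)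

lemma unital_ring_hom_sum: "unital_ring_hom h \<Longrightarrow> h (sum f A) = (\<Sum>a\<in>A. h (f a))"
  by (induction A rule: infinite_finite_induct) (simp_all add: unital_ring_homD)

lemma unital_ring_hom_prod: "unital_ring_hom h \<Longrightarrow> h (prod f A) = (\<Prod>a\<in>A. h (f a))"
  by (induction A rule: infinite_finite_induct) (simp_all add: unital_ring_homD)

lemma unital_ring_hom_of_nat: "unital_ring_hom h \<Longrightarrow> h (of_nat n) = of_nat n"
  by (induction n) (simp_all add: unital_ring_homD)

lemma unital_ring_hom_id: "unital_ring_hom (\<lambda>c. c)"
  by (simp add: unital_ring_hom_def)

lemma derivationD:
  assumes "derivation d"
  shows "d (x + y) = d x + d y" "d (x * y) = d x * y + x * d y" "d 0 = 0" "d 1 = 0"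
    "d (- x) = - d x" "d (x - y) = d x - d y"
proof -
  show add: "\<And>x y. d (x + y) = d x + d y" and mult: "\<And>x y. d (x * y) = d x * y + x * d y"
    using assms by (auto simp: derivation_def)
  show 0: "d 0 = 0" using add[of 0 0] by simp
  show "d 1 = 0" using mult[of 1 1] by simp
  show m: "d (- x) = - d x" for x using add[of x "- x"] 0 by (simp add: eq_neg_iff_add_eq_0 add.commute)
  show "d (x - y) = d x - d y" using add[of x "- y"] m by simp
qed

lemma derivation_sum: "derivation d \<Longrightarrow> d (sum f A) = (\<Sum>a\<in>A. d (f a))"
  by (induction A rule: infinite_finite_induct) (simp_all add: derivationD)

lemma derivation_of_nat: "derivation d \<Longrightarrow> d (of_nat n) = 0"
  by (induction n) (simp_all add: derivationD)

definition mpoly_var :: "nat \<Rightarrow> 'k::comm_ring_1 mpoly" where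
  "mpoly_var v = Poly_Mapping.single (Poly_Mapping.single v 1) 1"

lemma update_eq_plus_single:
  fixes f :: "'a \<Rightarrow>\<^sub>0 'b::monoid_add"
  assumes "a \<notin> Poly_Mapping.keys f"
  shows "Poly_Mapping.update a b f = f + Poly_Mapping.single a b"
  using assms by (intro poly_mapping_eqI) (auto simp: lookup_update lookup_add lookup_single in_keys_iff when_def)

lemma poly_mapping_add_induct [case_names single add]:
  fixes f :: "'a \<Rightarrow>\<^sub>0 'b::monoid_add"
  assumes "\<And>a b. P (Poly_Mapping.single a b)" and "\<And>f g. P f \<Longrightarrow> P g \<Longrightarrow> P (f + g)"
  shows "P f"
proof (induction f rule: update_induct)
  case const
  then show ?case using assms(1)[of undefined 0] by simp
next
  case (update f a b)
  then show ?case using assms by (simp add: update_eq_plus_single)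
qed

lemma single_single_power:
  "Poly_Mapping.single (Poly_Mapping.single v k) (1::'k::comm_ring_1) = mpoly_var v ^ k"
proof (induction k)
  case (Suc k)
  have "mpoly_var v ^ Suc k = mpoly_var v * Poly_Mapping.single (Poly_Mapping.single v k) (1::'k)"
    by (simp only: Suc.IH power_Suc)
  also have "\<dots> = Poly_Mapping.single (Poly_Mapping.single v 1 + Poly_Mapping.single v k) (1::'k)"
    by (simp add: mpoly_var_def mult_single)
  finally have "mpoly_var v ^ Suc k = Poly_Mapping.single (Poly_Mapping.single v 1 + Poly_Mapping.single v k) (1::'k)" .
  then show ?case by (simp add: single_add[symmetric])
qed simp

lemma mpoly_ring_const [simp, intro]: "mpoly_const c \<in> mpoly_ring n"
  by (auto simp: mpoly_ring_def mpoly_const_def)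

lemma mpoly_ring_var [simp, intro]: "v < n \<Longrightarrow> mpoly_var v \<in> mpoly_ring n"
  by (auto simp: mpoly_ring_def mpoly_var_def)

lemma mpoly_const_hom: "unital_ring_hom mpoly_const"
  by (simp add: unital_ring_hom_def mpoly_const_def single_add mult_single)

lemma mpoly_ring_0 [simp, intro]: "0 \<in> mpoly_ring n"
  using mpoly_ring_const[of 0 n] by (simp add: mpoly_const_def)

lemma mpoly_ring_1 [simp, intro]: "1 \<in> mpoly_ring n"
  using mpoly_ring_const[of 1 n] by (simp add: mpoly_const_def)

lemma mpoly_ring_add [intro]: "p \<in> mpoly_ring n \<Longrightarrow> q \<in> mpoly_ring n \<Longrightarrow> p + q \<in> mpoly_ring n"
  using keys_add[of p q] unfolding mpoly_ring_def by blast

lemma mpoly_ring_mult [intro]: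
  assumes "p \<in> mpoly_ring n" "q \<in> mpoly_ring n"
  shows "p * q \<in> mpoly_ring n"
  unfolding mpoly_ring_def
proof safe
  fix e v assume "e \<in> Poly_Mapping.keys (p * q)" and v: "v \<in> Poly_Mapping.keys e"
  then obtain a b where "a \<in> Poly_Mapping.keys p" "b \<in> Poly_Mapping.keys q" "e = a + b"
    using keys_mult[of p q] by blast
  then show "v < n" using assms v keys_add[of a b] unfolding mpoly_ring_def by blast
qed

lemma mpoly_ring_uminus [intro]: "p \<in> mpoly_ring n \<Longrightarrow> - p \<in> mpoly_ring n"
  using mpoly_ring_mult[OF mpoly_ring_const[of "-1"], of p n]
  by (simp add: unital_ring_homD[OF mpoly_const_hom])

lemma mpoly_ring_diff [intro]: "p \<in> mpoly_ring n \<Longrightarrow> q \<in> mpoly_ring n \<Longrightarrow> p - q \<in> mpoly_ring n"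
  using mpoly_ring_add[of p n "- q"] by auto

lemma mpoly_ring_power [intro]: "p \<in> mpoly_ring n \<Longrightarrow> p ^ k \<in> mpoly_ring n"
  by (induction k) auto

lemma mpoly_ring_sum [intro]: "(\<And>a. a \<in> A \<Longrightarrow> f a \<in> mpoly_ring n) \<Longrightarrow> sum f A \<in> mpoly_ring n"
  by (induction A rule: infinite_finite_induct) auto

lemma mpoly_ring_prod [intro]: "(\<And>a. a \<in> A \<Longrightarrow> f a \<in> mpoly_ring n) \<Longrightarrow> prod f A \<in> mpoly_ring n"
  by (induction A rule: infinite_finite_induct) auto

lemma mpoly_ring_mono: "p \<in> mpoly_ring n \<Longrightarrow> n \<le> k \<Longrightarrow> p \<in> mpoly_ring k"
  by (force simp: mpoly_ring_def)

lemma mpoly_ring_exhaust: obtains n where "p \<in> mpoly_ring n"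
proof -
  have "finite (\<Union>e\<in>Poly_Mapping.keys p. Poly_Mapping.keys e)" by simp
  then obtain n where "\<forall>v\<in>(\<Union>e\<in>Poly_Mapping.keys p. Poly_Mapping.keys e). v < n"
    using finite_nat_set_iff_bounded by blast
  then show ?thesis using that[of n] by (auto simp: mpoly_ring_def)
qed

lemma finite_mpoly_ring_bound:
  assumes "finite F"
  obtains n where "n \<ge> k" "F \<subseteq> mpoly_ring n"
proof -
  from assms have "\<exists>n\<ge>k. F \<subseteq> mpoly_ring n"
  proof (induction F)
    case (insert p F)
    then obtain n where n: "n \<ge> k" "F \<subseteq> mpoly_ring n" by blast
    obtain l where "p \<in> mpoly_ring l" by (rule mpoly_ring_exhaust)
    then show ?case using n
      by (intro exI[of _ "max n l"]) (auto intro: mpoly_ring_mono)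
  qed auto
  then show ?thesis using that by blast
qed

lemma mpoly_ring_induct [consumes 1, case_names const var add mult]:
  fixes p :: "'k::comm_ring_1 mpoly"
  assumes p: "p \<in> mpoly_ring n"
    and const: "\<And>c. P (mpoly_const c)"
    and var: "\<And>v. v < n \<Longrightarrow> P (mpoly_var v)"
    and add: "\<And>p q. p \<in> mpoly_ring n \<Longrightarrow> q \<in> mpoly_ring n \<Longrightarrow> P p \<Longrightarrow> P q \<Longrightarrow> P (p + q)"
    and mult: "\<And>p q. p \<in> mpoly_ring n \<Longrightarrow> q \<in> mpoly_ring n \<Longrightarrow> P p \<Longrightarrow> P q \<Longrightarrow> P (p * q)"
  shows "P p"
proof -
  have pow: "P (mpoly_var v ^ k)" if "v < n" for v k
  proof (induction k)
    case 0
    then show ?case using const[of 1] by (simp add: mpoly_const_def)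
  next
    case (Suc k)
    then show ?case using that by (auto intro!: mult var)
  qed
  have single: "P (Poly_Mapping.single e c)" if "Poly_Mapping.keys e \<subseteq> {..<n}" for e c
    using that
  proof (induction e rule: update_induct)
    case const
    then show ?case using assms(2)[of c] by (simp add: mpoly_const_def)
  next
    case (update f a b)
    have sub: "Poly_Mapping.keys f \<subseteq> {..<n}" "a < n"
      using update by (auto simp: keys_update)
    have "Poly_Mapping.single (Poly_Mapping.update a b f) c
        = Poly_Mapping.single f c * mpoly_var a ^ b"
      by (simp add: update_eq_plus_single[OF update(1)] single_single_power[symmetric] mult_single)
    moreover have "Poly_Mapping.single f c \<in> mpoly_ring n" using sub by (auto simp: mpoly_ring_def)
    ultimately show ?case using update(3) sub by (auto intro!: mult pow)
  qed
  show ?thesis using p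
  proof (induction p rule: update_induct)
    case const
    then show ?case using single[of 0 0] by simp
  next
    case (update f a b)
    then have "f \<in> mpoly_ring n" "Poly_Mapping.keys a \<subseteq> {..<n}"
      by (auto simp: mpoly_ring_def keys_update)
    moreover have "Poly_Mapping.single a b \<in> mpoly_ring n"
      using \<open>Poly_Mapping.keys a \<subseteq> {..<n}\<close> by (auto simp: mpoly_ring_def)
    ultimately show ?case using update
      by (auto simp: update_eq_plus_single intro!: add single)
  qed
qed

lemma mpoly_induct [case_names const var add mult]:
  fixes p :: "'k::comm_ring_1 mpoly"
  assumes "\<And>c. P (mpoly_const c)" "\<And>v. P (mpoly_var v)"
    and "\<And>p q. P p \<Longrightarrow> P q \<Longrightarrow> P (p + q)" "\<And>p q. P p \<Longrightarrow> P q \<Longrightarrow> P (p * q)"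
  shows "P p"
  by (rule mpoly_ring_exhaust[of p], erule mpoly_ring_induct) (use assms in auto)

section \<open>Evaluation of polynomials as a ring homomorphism\<close>

definition monomial_eval :: "(nat \<Rightarrow>\<^sub>0 nat) \<Rightarrow> (nat \<Rightarrow> 'r::comm_ring_1) \<Rightarrow> 'r" where
  "monomial_eval e x = (\<Prod>i\<in>Poly_Mapping.keys e. x i ^ Poly_Mapping.lookup e i)"

lemma monomial_eval_superset:
  "finite A \<Longrightarrow> Poly_Mapping.keys e \<subseteq> A \<Longrightarrow> monomial_eval e x = (\<Prod>i\<in>A. x i ^ Poly_Mapping.lookup e i)"
  unfolding monomial_eval_def by (rule prod.mono_neutral_left) (auto simp: in_keys_iff)

lemma monomial_eval_add: "monomial_eval (e + f) x = monomial_eval e x * monomial_eval f x"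
proof -
  let ?A = "Poly_Mapping.keys e \<union> Poly_Mapping.keys f"
  have "monomial_eval (e + f) x = (\<Prod>i\<in>?A. x i ^ Poly_Mapping.lookup (e + f) i)"
    using keys_add[of e f] by (intro monomial_eval_superset) auto
  also have "\<dots> = (\<Prod>i\<in>?A. x i ^ Poly_Mapping.lookup e i) * (\<Prod>i\<in>?A. x i ^ Poly_Mapping.lookup f i)"
    by (simp add: lookup_add power_add prod.distrib)
  also have "\<dots> = monomial_eval e x * monomial_eval f x"
    by (simp add: monomial_eval_superset[of ?A])
  finally show ?thesis .
qed

context
  fixes h :: "'k::comm_ring_1 \<Rightarrow> 'r::comm_ring_1"
  assumes h: "unital_ring_hom h"
begin

lemma mpoly_eval_superset:
  assumes "finite A" "Poly_Mapping.keys p \<subseteq> A"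
  shows "mpoly_eval h p x = (\<Sum>e\<in>A. h (Poly_Mapping.lookup p e) * monomial_eval e x)"
  unfolding mpoly_eval_def monomial_eval_def
  by (rule sum.mono_neutral_left) (use assms in \<open>auto simp: in_keys_iff unital_ring_homD[OF h]\<close>)

lemma mpoly_eval_single: "mpoly_eval h (Poly_Mapping.single e c) x = h c * monomial_eval e x"
  by (subst mpoly_eval_superset[of "{e}"]) auto

lemma mpoly_eval_add: "mpoly_eval h (p + q) x = mpoly_eval h p x + mpoly_eval h q x"
proof -
  let ?A = "Poly_Mapping.keys p \<union> Poly_Mapping.keys q"
  have "mpoly_eval h (p + q) x = (\<Sum>e\<in>?A. h (Poly_Mapping.lookup (p + q) e) * monomial_eval e x)"
    using keys_add[of p q] by (intro mpoly_eval_superset) auto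
  then show ?thesis
    by (simp add: mpoly_eval_superset[of ?A] lookup_add unital_ring_homD[OF h] distrib_right sum.distrib)
qed

lemma mpoly_eval_mult: "mpoly_eval h (p * q) x = mpoly_eval h p x * mpoly_eval h q x"
proof (induction p rule: poly_mapping_add_induct)
  case (single a b)
  show ?case
  proof (induction q rule: poly_mapping_add_induct)
    case (single c d)
    then show ?case
      by (simp add: mult_single mpoly_eval_single monomial_eval_add unital_ring_homD[OF h] mult_ac)
  qed (simp add: distrib_left mpoly_eval_add)
qed (simp add: distrib_right mpoly_eval_add)

lemma mpoly_eval_const [simp]: "mpoly_eval h (mpoly_const c) x = h c"
  by (simp add: mpoly_const_def mpoly_eval_single monomial_eval_def)

lemma mpoly_eval_var [simp]: "mpoly_eval h (mpoly_var v) x = x v"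
  by (simp add: mpoly_var_def mpoly_eval_single monomial_eval_def unital_ring_homD[OF h])

lemma mpoly_eval_hom: "unital_ring_hom (\<lambda>p. mpoly_eval h p x)"
  using mpoly_eval_const[of 1 x]
  by (simp add: unital_ring_hom_def mpoly_eval_add mpoly_eval_mult mpoly_const_def unital_ring_homD[OF h])

lemma mpoly_eval_0 [simp]: "mpoly_eval h 0 x = 0"
  by (rule unital_ring_homD(4)[OF mpoly_eval_hom])

lemma mpoly_eval_1 [simp]: "mpoly_eval h 1 x = 1"
  by (rule unital_ring_homD(1)[OF mpoly_eval_hom])

end

lemma mpoly_eval_cong:
  assumes "p \<in> mpoly_ring n" "\<And>v. v < n \<Longrightarrow> x v = y v"
  shows "mpoly_eval h p x = mpoly_eval h p y"
  unfolding mpoly_eval_def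
  by (intro sum.cong prod.cong arg_cong2[of _ _ _ _ "(*)"] refl)
    (use assms in \<open>auto simp: mpoly_ring_def subset_iff\<close>)

text \<open>With \<open>f\<close> itself an evaluation this is associativity of substitution; with
  \<open>f\<close> the constant coefficient it computes the value of a polynomial at the constant
  terms of a power series point.\<close>

lemma hom_mpoly_eval:
  assumes h: "unital_ring_hom h" and f: "unital_ring_hom f"
  shows "f (mpoly_eval h p x) = mpoly_eval (\<lambda>c. f (h c)) p (\<lambda>v. f (x v))"
proof -
  have fh: "unital_ring_hom (\<lambda>c. f (h c))"
    using h f by (simp add: unital_ring_hom_def)
  show ?thesis
    by (induction p rule: mpoly_induct)
      (simp_all add: h fh mpoly_eval_add mpoly_eval_mult unital_ring_homD[OF f])
qed

text \<open>Universal property of the polynomial ring. Through it the Taylor map is read as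
  evaluation at a point with power series coordinates.\<close>

lemma mpoly_hom_eq_eval:
  assumes f: "unital_ring_hom f"
  shows "f p = mpoly_eval (\<lambda>c. f (mpoly_const c)) p (\<lambda>v. f (mpoly_var v))"
proof -
  have fh: "unital_ring_hom (\<lambda>c. f (mpoly_const c))"
    by (simp add: unital_ring_hom_def unital_ring_homD[OF mpoly_const_hom] unital_ring_homD[OF f])
  show ?thesis
    by (induction p rule: mpoly_induct)
      (simp_all add: fh mpoly_eval_add mpoly_eval_mult unital_ring_homD[OF f])
qed

lemma mpoly_eval_ring:
  assumes "p \<in> mpoly_ring n" "\<And>v. v < n \<Longrightarrow> x v \<in> mpoly_ring k"
  shows "mpoly_eval mpoly_const p x \<in> mpoly_ring k"
  using assms(1)
  by (induction p rule: mpoly_ring_induct)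
    (use assms(2) in \<open>auto simp: mpoly_const_hom mpoly_eval_add mpoly_eval_mult\<close>)

section \<open>Formal partial derivatives and Taylor expansion\<close>

lemma mpoly_pderiv_superset:
  assumes "finite A" "Poly_Mapping.keys p \<subseteq> A"
  shows "mpoly_pderiv j p = (\<Sum>e\<in>A. Poly_Mapping.single (e - Poly_Mapping.single j 1)
                    (of_nat (Poly_Mapping.lookup e j) * Poly_Mapping.lookup p e))"
  unfolding mpoly_pderiv_def
  by (rule sum.mono_neutral_left) (use assms in \<open>auto simp: in_keys_iff\<close>)

lemma mpoly_pderiv_single:
  "mpoly_pderiv j (Poly_Mapping.single e c)
     = Poly_Mapping.single (e - Poly_Mapping.single j 1) (of_nat (Poly_Mapping.lookup e j) * c)"
  by (subst mpoly_pderiv_superset[of "{e}"]) auto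

lemma mpoly_pderiv_add: "mpoly_pderiv j (p + q) = mpoly_pderiv j p + mpoly_pderiv j q"
proof -
  let ?A = "Poly_Mapping.keys p \<union> Poly_Mapping.keys q"
  have "mpoly_pderiv j (p + q) = (\<Sum>e\<in>?A. Poly_Mapping.single (e - Poly_Mapping.single j 1)
                    (of_nat (Poly_Mapping.lookup e j) * Poly_Mapping.lookup (p + q) e))"
    using keys_add[of p q] by (intro mpoly_pderiv_superset) auto
  then show ?thesis
    by (simp add: mpoly_pderiv_superset[of ?A] lookup_add distrib_left single_add sum.distrib)
qed

lemma mpoly_pderiv_mult: "mpoly_pderiv j (p * q) = mpoly_pderiv j p * q + p * mpoly_pderiv j q"
proof (induction p rule: poly_mapping_add_induct)
  case (single a b)
  show ?case
  proof (induction q rule: poly_mapping_add_induct)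
    case (single c d)
    let ?j = "Poly_Mapping.single j 1 :: nat \<Rightarrow>\<^sub>0 nat"
    have shift: "(x - ?j) + y = x + y - ?j" if "Poly_Mapping.lookup x j \<noteq> 0" for x y
      using that by (intro poly_mapping_eqI) (auto simp: lookup_add lookup_minus lookup_single when_def)
    have l: "Poly_Mapping.single (a - ?j + c) (of_nat (Poly_Mapping.lookup a j) * b * d)
        = Poly_Mapping.single (a + c - ?j) (of_nat (Poly_Mapping.lookup a j) * b * d)"
      using shift[of a c] by (cases "Poly_Mapping.lookup a j = 0") auto
    have r: "Poly_Mapping.single (a + (c - ?j)) (b * (of_nat (Poly_Mapping.lookup c j) * d))
        = Poly_Mapping.single (a + c - ?j) (of_nat (Poly_Mapping.lookup c j) * b * d)"
      using shift[of c a] by (cases "Poly_Mapping.lookup c j = 0") (auto simp: add.commute mult_ac)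
    have "mpoly_pderiv j (Poly_Mapping.single a b * Poly_Mapping.single c d)
        = Poly_Mapping.single (a + c - ?j) (of_nat (Poly_Mapping.lookup a j) * b * d)
        + Poly_Mapping.single (a + c - ?j) (of_nat (Poly_Mapping.lookup c j) * b * d)"
      by (simp add: mult_single mpoly_pderiv_single lookup_add algebra_simps flip: single_add)
    then show ?case by (simp only: mpoly_pderiv_single mult_single l r)
  qed (simp add: distrib_left mpoly_pderiv_add)
qed (simp add: distrib_right mpoly_pderiv_add)

lemma mpoly_pderiv_const [simp]: "mpoly_pderiv j (mpoly_const c) = 0"
  by (simp add: mpoly_const_def mpoly_pderiv_single)

lemma mpoly_pderiv_var: "mpoly_pderiv j (mpoly_var v) = (if v = j then 1 else 0)"
  by (simp add: mpoly_var_def mpoly_pderiv_single lookup_single when_def)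

lemma mpoly_pderiv_derivation: "derivation (mpoly_pderiv j)"
  by (simp add: derivation_def mpoly_pderiv_add mpoly_pderiv_mult)

lemma mpoly_pderiv_ring: "p \<in> mpoly_ring n \<Longrightarrow> mpoly_pderiv j p \<in> mpoly_ring n"
  by (induction p rule: mpoly_ring_induct)
    (auto simp: mpoly_pderiv_add mpoly_pderiv_mult mpoly_pderiv_var)

lemma mpoly_pderiv_eq_0: "p \<in> mpoly_ring n \<Longrightarrow> j \<ge> n \<Longrightarrow> mpoly_pderiv j p = 0"
  by (induction p rule: mpoly_ring_induct)
    (auto simp: mpoly_pderiv_add mpoly_pderiv_mult mpoly_pderiv_var)

lemma derivation_chain_rule:
  assumes d: "derivation d" and p: "p \<in> mpoly_ring n" and h: "unital_ring_hom h"
    and "\<And>c. d (h c) = 0"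
  shows "d (mpoly_eval h p x) = (\<Sum>j<n. mpoly_eval h (mpoly_pderiv j p) x * d (x j))"
  using p
proof (induction p rule: mpoly_ring_induct)
  case (const c)
  then show ?case using assms by simp
next
  case (var v)
  have "mpoly_eval h (mpoly_pderiv j (mpoly_var v)) x * d (x j) = (if j = v then d (x v) else 0)" for j
    by (simp add: mpoly_pderiv_var unital_ring_homD[OF mpoly_eval_hom[OF h]])
  then show ?case using var by (simp add: h)
next
  case (add p q)
  then show ?case
    by (simp add: mpoly_eval_add[OF h] mpoly_pderiv_add derivationD[OF d] sum.distrib distrib_right)
next
  case (mult p q)
  then show ?case
    by (simp add: mpoly_eval_add[OF h] mpoly_eval_mult[OF h] mpoly_pderiv_mult derivationD[OF d]
        sum.distrib algebra_simps sum_distrib_left)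
qed

text \<open>Leaving the remainder unspecified avoids all denominators, so the expansion follows by
  induction on the structure of \<open>p\<close> over any commutative ring.\<close>

lemma mpoly_eval_taylor:
  assumes h: "unital_ring_hom h"
  shows "\<exists>c. mpoly_eval h p (x(i := x i + e))
    = mpoly_eval h p x + mpoly_eval h (mpoly_pderiv i p) x * e + e ^ 2 * c"
proof (induction p rule: mpoly_induct)
  case (const c)
  then show ?case by (intro exI[of _ 0]) (simp add: h)
next
  case (var v)
  then show ?case
    by (intro exI[of _ 0]) (simp add: h mpoly_pderiv_var unital_ring_homD[OF mpoly_eval_hom[OF h]])
next
  case (add p q)
  then obtain c d where cd:
    "mpoly_eval h p (x(i := x i + e)) = mpoly_eval h p x + mpoly_eval h (mpoly_pderiv i p) x * e + e ^ 2 * c"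
    "mpoly_eval h q (x(i := x i + e)) = mpoly_eval h q x + mpoly_eval h (mpoly_pderiv i q) x * e + e ^ 2 * d"
    by blast
  show ?case
    by (intro exI[of _ "c + d"]) (simp only: mpoly_eval_add[OF h] mpoly_pderiv_add cd, simp add: algebra_simps)
next
  case (mult p q)
  then obtain c d where cd:
    "mpoly_eval h p (x(i := x i + e)) = mpoly_eval h p x + mpoly_eval h (mpoly_pderiv i p) x * e + e ^ 2 * c"
    "mpoly_eval h q (x(i := x i + e)) = mpoly_eval h q x + mpoly_eval h (mpoly_pderiv i q) x * e + e ^ 2 * d"
    by blast
  define a a' b b' where "a = mpoly_eval h p x" "a' = mpoly_eval h (mpoly_pderiv i p) x"
    "b = mpoly_eval h q x" "b' = mpoly_eval h (mpoly_pderiv i q) x"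
  \<comment> \<open>The witness collects the terms in the product of the two expansions that carry
    at least two factors \<open>e\<close>.\<close>
  show ?case
    by (intro exI[of _ "a * d + a' * b' + a' * e * d + c * (b + b' * e + e ^ 2 * d)"])
      (simp only: mpoly_eval_mult[OF h] mpoly_eval_add[OF h] mpoly_pderiv_mult cd,
        simp add: a_a'_b_b'_def algebra_simps power2_eq_square)
qed

text \<open>Polynomial maps preserve congruences. Taken modulo powers of the series variable, this
  is the Lipschitz estimate behind the precision arguments below.\<close>

lemma mpoly_eval_dvd_diff:
  assumes h: "unital_ring_hom h" and p: "p \<in> mpoly_ring n"
    and xy: "\<And>v. v < n \<Longrightarrow> d dvd x v - y v"
  shows "d dvd mpoly_eval h p x - mpoly_eval h p y"
  using p
proof (induction p rule: mpoly_ring_induct)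
  case (add p q)
  then have "d dvd (mpoly_eval h p x - mpoly_eval h p y) + (mpoly_eval h q x - mpoly_eval h q y)"
    by simp
  then show ?case by (simp add: h mpoly_eval_add algebra_simps)
next
  case (mult p q)
  then have "d dvd (mpoly_eval h p x - mpoly_eval h p y) * mpoly_eval h q x
      + mpoly_eval h p y * (mpoly_eval h q x - mpoly_eval h q y)"
    by simp
  then show ?case by (simp add: h mpoly_eval_mult algebra_simps)
qed (use xy h in auto)

section \<open>Derivations of the polynomial ring extending one of the coefficients\<close>

lemma finite_mpoly_pderiv_support: "finite {v. mpoly_pderiv v p \<noteq> 0}"
proof (rule mpoly_ring_exhaust[of p])
  fix n assume "p \<in> mpoly_ring n"
  then have "{v. mpoly_pderiv v p \<noteq> 0} \<subseteq> {..<n}"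
    using mpoly_pderiv_eq_0[of p n] by (auto simp: not_le[symmetric])
  then show ?thesis using finite_subset by blast
qed

text \<open>For a derivation \<open>\<delta>\<close> this is its extension to polynomials that sends
  variable number \<open>v\<close> to \<open>e v\<close>. Summing over the nonzero partial
  derivatives keeps the sum finite with no bound on the variables of \<open>p\<close>.\<close>

definition mpoly_deriv :: "('k::comm_ring_1 \<Rightarrow> 'k) \<Rightarrow> (nat \<Rightarrow> 'k mpoly) \<Rightarrow> 'k mpoly \<Rightarrow> 'k mpoly" where
  "mpoly_deriv \<delta> e p = Poly_Mapping.map \<delta> p + (\<Sum>v | mpoly_pderiv v p \<noteq> 0. mpoly_pderiv v p * e v)"

lemma mpoly_deriv_superset:
  assumes "finite A" "{v. mpoly_pderiv v p \<noteq> 0} \<subseteq> A"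
  shows "mpoly_deriv \<delta> e p = Poly_Mapping.map \<delta> p + (\<Sum>v\<in>A. mpoly_pderiv v p * e v)"
proof -
  have "(\<Sum>v | mpoly_pderiv v p \<noteq> 0. mpoly_pderiv v p * e v) = (\<Sum>v\<in>A. mpoly_pderiv v p * e v)"
    by (rule sum.mono_neutral_left) (use assms in auto)
  then show ?thesis by (simp add: mpoly_deriv_def)
qed

lemma map_derivation:
  fixes \<delta> :: "'k::comm_ring_1 \<Rightarrow> 'k"
  assumes d: "derivation \<delta>"
  shows "derivation (Poly_Mapping.map \<delta> :: 'k mpoly \<Rightarrow> _)"
proof -
  have look: "Poly_Mapping.lookup (Poly_Mapping.map \<delta> p) e = \<delta> (Poly_Mapping.lookup p e)" for p :: "'k mpoly" and e
    by (simp add: Poly_Mapping.map.rep_eq when_def derivationD[OF d])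
  have add: "Poly_Mapping.map \<delta> (p + q) = Poly_Mapping.map \<delta> p + Poly_Mapping.map \<delta> q" for p q :: "'k mpoly"
    by (rule poly_mapping_eqI) (simp add: look lookup_add derivationD[OF d])
  have single: "Poly_Mapping.map \<delta> (Poly_Mapping.single e c) = Poly_Mapping.single e (\<delta> c)"
    for e :: "nat \<Rightarrow>\<^sub>0 nat" and c
    by (rule poly_mapping_eqI) (simp add: look lookup_single when_def derivationD[OF d])
  have "Poly_Mapping.map \<delta> (p * q) = Poly_Mapping.map \<delta> p * q + p * Poly_Mapping.map \<delta> q" for p q :: "'k mpoly"
  proof (induction p rule: poly_mapping_add_induct)
    case (single a b)
    show ?case
    proof (induction q rule: poly_mapping_add_induct)
      case (single x y)
      then show ?case by (simp add: mult_single \<open>\<And>e c. Poly_Mapping.map \<delta> (Poly_Mapping.single e c) = _\<close> derivationD[OF d] single_add)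
    qed (simp add: distrib_left add)
  qed (simp add: distrib_right add)
  then show ?thesis using add by (simp add: derivation_def)
qed

lemma mpoly_deriv_derivation:
  assumes d: "derivation \<delta>"
  shows "derivation (mpoly_deriv \<delta> e)"
proof -
  let ?S = "\<lambda>p. {v. mpoly_pderiv v p \<noteq> (0 :: 'a mpoly)}"
  have "mpoly_deriv \<delta> e (p + q) = mpoly_deriv \<delta> e p + mpoly_deriv \<delta> e q
      \<and> mpoly_deriv \<delta> e (p * q) = mpoly_deriv \<delta> e p * q + p * mpoly_deriv \<delta> e q" for p q
  proof -
    let ?A = "?S p \<union> ?S q \<union> ?S (p + q) \<union> ?S (p * q)"
    have f: "finite ?A" by (simp add: finite_mpoly_pderiv_support)
    show ?thesis
      by (subst (1 2 3 4 5 6) mpoly_deriv_superset[OF f])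
        (auto simp: derivationD[OF map_derivation[OF d]] mpoly_pderiv_add mpoly_pderiv_mult
          algebra_simps sum.distrib sum_distrib_left sum_distrib_right)
  qed
  then show ?thesis by (simp add: derivation_def)
qed

lemma mpoly_deriv_const:
  assumes d: "derivation \<delta>"
  shows "mpoly_deriv \<delta> e (mpoly_const c) = mpoly_const (\<delta> c)"
  by (rule poly_mapping_eqI)
    (simp add: mpoly_deriv_def mpoly_const_def mpoly_pderiv_single Poly_Mapping.map.rep_eq
      lookup_single when_def derivationD[OF d])

lemma mpoly_deriv_var:
  assumes d: "derivation \<delta>"
  shows "mpoly_deriv \<delta> e (mpoly_var v) = e v"
proof -
  have "Poly_Mapping.map \<delta> (mpoly_var v) = (0 :: 'a mpoly)"
    by (rule poly_mapping_eqI)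
      (simp add: mpoly_var_def Poly_Mapping.map.rep_eq lookup_single when_def derivationD[OF d])
  then show ?thesis
    by (simp add: mpoly_deriv_superset[of "{v}"] mpoly_pderiv_var)
qed

lemma mpoly_deriv_map_ring: "p \<in> mpoly_ring n \<Longrightarrow> Poly_Mapping.map \<delta> p \<in> mpoly_ring n"
  by (auto simp: mpoly_ring_def Poly_Mapping.map.rep_eq in_keys_iff when_def split: if_splits)

lemma mpoly_deriv_eq:
  assumes "p \<in> mpoly_ring n"
  shows "mpoly_deriv \<delta> e p = Poly_Mapping.map \<delta> p + (\<Sum>v<n. mpoly_pderiv v p * e v)"
  by (rule mpoly_deriv_superset) (use mpoly_pderiv_eq_0[OF assms] in \<open>auto simp: not_le[symmetric]\<close>)

subsection \<open>The twisted Taylor morphism in one variable\<close>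

lemma derivation_divide_fact:
  fixes d :: "'k::field_char_0 \<Rightarrow> 'k"
  assumes "derivation d"
  shows "d (x / fact n) = d x / fact n"
proof -
  have "d (fact n * (x / fact n)) = fact n * d (x / fact n)"
    using derivationD(2)[OF assms, of "of_nat (fact n)" "x / fact n"] derivation_of_nat[OF assms, of "fact n"]
    by simp
  then show ?thesis by (simp add: field_simps)
qed

definition fps_map :: "('k::field \<Rightarrow> 'k) \<Rightarrow> 'k fps \<Rightarrow> 'k fps" where
  "fps_map d f = Abs_fps (\<lambda>n. d (fps_nth f n))"

lemma fps_map_nth [simp]: "fps_nth (fps_map d f) n = d (fps_nth f n)"
  by (simp add: fps_map_def)

lemma fps_map_derivation: "derivation d \<Longrightarrow> derivation (fps_map d)"
  unfolding derivation_def[of "fps_map d"]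
  by (auto intro!: fps_ext simp: fps_mult_nth derivationD derivation_sum sum.distrib)

text \<open>Compatibility of \<open>\<psi>\<close> with the derivations is not assumed; the series
  variable absorbs the defect.\<close>

locale fps_taylor =
  fixes \<delta> :: "'k::field_char_0 \<Rightarrow> 'k" and \<theta> :: "'a::comm_ring_1 \<Rightarrow> 'a" and \<psi> :: "'a \<Rightarrow> 'k"
  assumes \<delta>: "derivation \<delta>" and \<theta>: "derivation \<theta>" and \<psi>: "unital_ring_hom \<psi>"
begin

text \<open>The iterated operator measures how far \<open>\<chi>\<close> is from commuting with the
  derivations. Comparing coefficients in \<open>T (\<theta> a) = (\<delta> + d/ds) (T a)\<close>,
  with constant term \<open>\<psi> a\<close>, leaves its iterates divided by factorials as the only
  choice.\<close>

definition coeffs_fun :: "nat \<Rightarrow> 'a \<Rightarrow> 'k" where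
  "coeffs_fun n = ((\<lambda>\<chi> a. \<chi> (\<theta> a) - \<delta> (\<chi> a)) ^^ n) \<psi>"

definition T :: "'a \<Rightarrow> 'k fps" where
  "T a = Abs_fps (\<lambda>n. coeffs_fun n a / fact n)"

lemma T_0 [simp]: "fps_nth (T a) 0 = \<psi> a"
  by (simp add: T_def coeffs_fun_def)

lemma T_Suc: "of_nat (Suc n) * fps_nth (T a) (Suc n) = fps_nth (T (\<theta> a)) n - \<delta> (fps_nth (T a) n)"
proof -
  have "coeffs_fun (Suc n) a = coeffs_fun n (\<theta> a) - \<delta> (coeffs_fun n a)"
    by (simp add: coeffs_fun_def)
  then show ?thesis
    by (simp add: T_def derivation_divide_fact[OF \<delta>] field_simps del: of_nat_Suc)
qed

lemma fps_deriv_T: "fps_deriv (T a) = T (\<theta> a) - fps_map \<delta> (T a)"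
  by (rule fps_ext) (use T_Suc in simp)

text \<open>In characteristic 0 the recursion determines the next coefficient. Sums, products and
  constants are handled by checking that the expected value obeys the same recursion, for all
  arguments at once.\<close>

lemma T_nth_SucI:
  assumes "of_nat (Suc n) * x = fps_nth (T (\<theta> a)) n - \<delta> (fps_nth (T a) n)"
  shows "fps_nth (T a) (Suc n) = x"
proof -
  have "of_nat (Suc n) * fps_nth (T a) (Suc n) = of_nat (Suc n) * x"
    using assms T_Suc by simp
  then show ?thesis by (simp del: of_nat_Suc)
qed

lemma T_add: "T (a + b) = T a + T b"
proof (rule fps_ext)
  show "fps_nth (T (a + b)) n = fps_nth (T a + T b) n" for n
  proof (induction n arbitrary: a b)
    case 0
    then show ?case by (simp add: unital_ring_homD[OF \<psi>])
  next
    case (Suc n)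
    show ?case
      by (rule T_nth_SucI)
        (simp add: Suc derivationD[OF \<theta>] derivationD[OF \<delta>] distrib_left T_Suc del: of_nat_Suc)
  qed
qed

lemma T_mult: "T (a * b) = T a * T b"
proof (rule fps_ext)
  show "fps_nth (T (a * b)) n = fps_nth (T a * T b) n" for n
  proof (induction n arbitrary: a b)
    case 0
    then show ?case by (simp add: unital_ring_homD[OF \<psi>])
  next
    case (Suc n)
    have "of_nat (Suc n) * fps_nth (T a * T b) (Suc n) = fps_nth (fps_deriv (T a * T b)) n"
      by (simp only: fps_deriv_nth Suc_eq_plus1)
    also have "fps_deriv (T a * T b) = T (\<theta> a) * T b + T a * T (\<theta> b) - fps_map \<delta> (T a * T b)"
      by (simp add: fps_deriv_T derivationD(2)[OF fps_map_derivation[OF \<delta>]] algebra_simps)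
    also have "fps_nth \<dots> n = fps_nth (T (\<theta> (a * b))) n - \<delta> (fps_nth (T (a * b)) n)"
      by (simp add: Suc derivationD[OF \<theta>] T_add)
    finally show ?case by (rule T_nth_SucI)
  qed
qed

lemma T_const:
  assumes \<kappa>: "\<And>c. \<theta> (\<kappa> c) = \<kappa> (\<delta> c)" "\<And>c. \<psi> (\<kappa> c) = c"
  shows "T (\<kappa> c) = fps_const c"
proof (rule fps_ext)
  show "fps_nth (T (\<kappa> c)) n = fps_nth (fps_const c) n" for n
  proof (induction n arbitrary: c)
    case (Suc n)
    show ?case by (rule T_nth_SucI) (simp add: Suc \<kappa> derivationD[OF \<delta>])
  qed (simp add: \<kappa>)
qed

lemma T_hom:
  assumes "\<And>c. \<theta> (\<kappa> c) = \<kappa> (\<delta> c)" "\<And>c. \<psi> (\<kappa> c) = c" "\<kappa> 1 = 1"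
  shows "unital_ring_hom T"
  using T_const[of \<kappa> 1] assms by (simp add: unital_ring_hom_def T_add T_mult)

text \<open>Coefficient \<open>n\<close> of \<open>T a\<close> is built additively from iterates of
  \<open>\<delta>\<close> applied to the values \<open>\<psi> ((\<theta> ^^ j) a)\<close> with
  \<open>j \<le> n\<close>. Vanishing of these values thus becomes vanishing to high order.\<close>

lemma T_nth_eq_0:
  assumes "\<And>j. j < N \<Longrightarrow> \<psi> ((\<theta> ^^ j) a) = 0" and "n < N"
  shows "fps_nth (T a) n = 0"
proof -
  have "fps_nth (T ((\<theta> ^^ j) a)) n = 0" if "n + j < N" for j
    using that
  proof (induction n arbitrary: j)
    case (Suc n)
    then have "fps_nth (T ((\<theta> ^^ Suc j) a)) n = 0" "fps_nth (T ((\<theta> ^^ j) a)) n = 0"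
      by (simp_all del: funpow.simps)
    then show ?case by (intro T_nth_SucI) (simp add: derivationD[OF \<delta>])
  qed (use assms in auto)
  from this[of 0] show ?thesis using assms(2) by simp
qed

text \<open>Conversely, \<open>\<psi> ((\<theta> ^^ k) a)\<close> can be recovered from the
  coefficients up to \<open>k\<close>, so a nonzero value bounds the order of the series.\<close>

lemma T_nth_neq_0:
  assumes "\<psi> ((\<theta> ^^ k) a) \<noteq> 0"
  obtains n where "n \<le> k" "fps_nth (T a) n \<noteq> 0"
proof -
  have "\<psi> ((\<theta> ^^ k) a) = 0" if "\<And>n. n \<le> k \<Longrightarrow> fps_nth (T a) n = 0"
    using that
  proof (induction k arbitrary: a)
    case 0
    then show ?case using T_0[of a] by simp
  next
    case (Suc k)
    have "fps_nth (T (\<theta> a)) n = 0" if "n \<le> k" for n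
      using T_Suc[of n a] Suc.prems[of "Suc n"] Suc.prems[of n] that by (simp add: derivationD[OF \<delta>])
    then show ?case using Suc.IH[of "\<theta> a"] by (simp add: funpow_swap1)
  qed
  then show ?thesis using assms that by blast
qed

end

subsection \<open>Algebraic dependence\<close>

text \<open>Fields are represented by subsets of one ambient type, since the towers needed for the
  dimension of the curve all lie in a single field of Laurent series.\<close>

definition alg_over :: "'f::field set \<Rightarrow> 'f \<Rightarrow> bool" where
  "alg_over F y \<longleftrightarrow> (\<exists>p. p \<noteq> 0 \<and> (\<forall>i. coeff p i \<in> F) \<and> poly p y = 0)"

definition is_subfield :: "'f::field set \<Rightarrow> bool" where
  "is_subfield F \<longleftrightarrow> 1 \<in> F \<and> (\<forall>x\<in>F. \<forall>y\<in>F. x + y \<in> F \<and> x * y \<in> F) \<and>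
     (\<forall>x\<in>F. - x \<in> F) \<and> (\<forall>x\<in>F. inverse x \<in> F)"

context
begin

text \<open>The whole type seen as a field record, so that the theory of finite extensions for
  records applies to its subfields.\<close>

private abbreviation (input) Om :: "'f::field ring" where "Om \<equiv> ring_of_type_algebra"

interpretation Om: field "Om :: 'f::field ring" by (rule field_from_type_algebra)

private lemma Om_simps [simp]:
  "carrier (Om :: 'f::field ring) = UNIV" "\<one>\<^bsub>Om\<^esub> = (1::'f)" "\<zero>\<^bsub>Om\<^esub> = (0::'f)"
  "x \<otimes>\<^bsub>Om\<^esub> y = (x * y :: 'f)" "x \<oplus>\<^bsub>Om\<^esub> y = (x + y :: 'f)"
  by (simp_all add: ring_of_type_algebra_def)

private lemma Om_uminus [simp]: "\<ominus>\<^bsub>Om\<^esub> x = - (x::'f::field)"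
  by (rule Om.minus_equality) auto

private lemma Om_inv: "x \<noteq> 0 \<Longrightarrow> inv\<^bsub>Om\<^esub> x = inverse (x::'f::field)"
  by (rule Om.comm_inv_char) auto

private lemma Om_pow [simp]: "x [^]\<^bsub>Om\<^esub> (n::nat) = (x::'f::field) ^ n"
  by (induction n) (simp_all add: mult.commute)

text \<open>Coefficient lists of the record theory start with the leading coefficient, those of
  \<open>Poly\<close> with the constant one; hence \<open>rev\<close>.\<close>

private lemma Om_eval: "Om.eval ps x = poly (Poly (rev ps)) (x::'f::field)"
  by (induction ps) (simp_all add: Poly_snoc poly_monom add.commute)

private lemma Om_subfield: "subfield F Om \<longleftrightarrow> is_subfield (F::'f::field set)"
proof
  assume "subfield F Om"
  note s = subringE[OF subfieldE(1)[OF this]] Om.subfield_m_inv(1)[OF this]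
  have "inverse x \<in> F" if "x \<in> F" for x
  proof (cases "x = 0")
    case False
    then show ?thesis using s(8)[of x] that by (simp add: Om_inv)
  qed (use s in auto)
  then show "is_subfield F" using s by (auto simp: is_subfield_def)
next
  assume F: "is_subfield F"
  show "subfield F Om"
    by (rule Om.subfieldI', rule Om.subringI) (use F in \<open>auto simp: is_subfield_def Om_inv\<close>)
qed

private lemma Om_algebraic:
  assumes F: "is_subfield (F::'f::field set)"
  shows "Om.algebraic F y \<longleftrightarrow> alg_over F y"
proof
  assume "Om.algebraic F y"
  then obtain ps where ps: "ps \<in> carrier (F [X]\<^bsub>Om\<^esub>)" "ps \<noteq> []" "Om.eval ps y = \<zero>\<^bsub>Om\<^esub>"
    using Om.algebraicE[of F y] F subfieldE(1) unfolding over_def Om_subfield[symmetric] by (metis Om_simps(1) UNIV_I)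
  then have lc: "set ps \<subseteq> F" "hd ps \<noteq> 0"
    unfolding univ_poly_carrier[symmetric] by (auto simp: polynomial_def)
  have 0: "0 \<in> F" using F by (auto simp: is_subfield_def) (metis add.right_inverse)
  have "coeff (Poly (rev ps)) (length ps - 1) \<noteq> 0"
    using lc(2) ps(2) by (simp add: nth_default_def rev_nth hd_conv_nth)
  then have "Poly (rev ps) \<noteq> 0" by (metis coeff_0)
  moreover have "coeff (Poly (rev ps)) i \<in> F" for i
    using lc(1) 0 by (auto simp: nth_default_def) (metis length_rev nth_mem set_rev subsetD)
  ultimately show "alg_over F y"
    using ps(3) by (auto simp: alg_over_def Om_eval intro!: exI[of _ "Poly (rev ps)"])
next
  assume "alg_over F y"
  then obtain p where p: "p \<noteq> 0" "\<And>i. coeff p i \<in> F" "poly p y = 0"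
    by (auto simp: alg_over_def)
  have "set (coeffs p) \<subseteq> F" using p(2) by (auto simp: coeffs_def)
  then have "rev (coeffs p) \<in> carrier (F [X]\<^bsub>Om\<^esub>)"
    unfolding univ_poly_carrier[symmetric]
    using p(1) by (auto simp: polynomial_def hd_rev last_coeffs_eq_coeff_degree)
  then show "Om.algebraic F y"
    using Om.algebraicI[of "rev (coeffs p)" F y] p by (simp add: Om_eval over_def)
qed

lemma is_subfield_alg_over:
  assumes "is_subfield F"
  shows "is_subfield {y. alg_over F y}"
  using Om.subfield_of_algebraics[of F] assms
  by (simp add: Om_subfield Om_algebraic over_def)

text \<open>The coefficients of the equation for \<open>x\<close> generate a finite extension
  \<open>E\<close> of \<open>F\<close>. By the tower law E(x) is finite over \<open>F\<close>, and
  elements of finite extensions are algebraic.\<close>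

lemma alg_over_trans:
  fixes F :: "'f::field set"
  assumes F: "is_subfield F" and "alg_over {y. alg_over F y} x"
  shows "alg_over F x"
proof -
  from assms obtain p where p: "p \<noteq> 0" "\<And>i. alg_over F (coeff p i)" "poly p x = 0"
    by (auto simp: alg_over_def[of _ x])
  define E where "E = Om.finite_extension F (coeffs p)"
  have F': "subfield F Om" using F by (simp add: Om_subfield)
  have alg: "y \<in> set (coeffs p) \<Longrightarrow> (Om.algebraic over F) y" for y
    using p(1,2) by (auto simp: over_def Om_algebraic[OF F] coeffs_def)
  have E: "subfield E Om" unfolding E_def
    by (rule Om.finite_extension_is_subfield[OF F']) (use alg in auto)
  have dimE: "Om.finite_dimension F E" unfolding E_def
    by (rule Om.finite_extension_finite_dimension(1)[OF F']) (use alg in auto)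
  have mem: "set (coeffs p) \<subseteq> E" unfolding E_def
    by (rule Om.finite_extension_mem[OF subfieldE(1)[OF F']]) auto
  have "0 \<in> E" using subringE(2)[OF subfieldE(1)[OF E]] by simp
  then have "coeff p i \<in> E" for i
    using mem by (cases "i < Suc (degree p)") (auto simp: coeffs_def coeff_eq_0 p(1) image_subset_iff less_Suc_eq)
  then have "alg_over E x" using p by (auto simp: alg_over_def)
  then have x: "(Om.algebraic over E) x"
    using Om_algebraic[of E x] E by (simp add: Om_subfield over_def)
  have "Om.finite_dimension E (Om.simple_extension E x)"
    using Om.finite_dimension_simple_extension[OF E _] x by simp
  then have "Om.finite_dimension F (Om.simple_extension E x)"
    using Om.telescopic_base_dim(1)[OF F' E dimE] by blast
  moreover have "subring (Om.simple_extension E x) Om"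
    using Om.simple_extension_is_subring[OF subfieldE(1)[OF E]] by simp
  moreover have "x \<in> Om.simple_extension E x"
    using Om.simple_extension_mem[OF subfieldE(1)[OF E]] by simp
  ultimately have "(Om.algebraic over F) x"
    using Om.finite_dimension_imp_algebraic[OF F'] by blast
  then show ?thesis by (simp add: over_def Om_algebraic[OF F])
qed

end

lemma alg_over_mono: "F \<subseteq> G \<Longrightarrow> alg_over F y \<Longrightarrow> alg_over G y"
  by (auto simp: alg_over_def)

lemma is_subfield_closed:
  assumes "is_subfield F"
  shows "1 \<in> F" "0 \<in> F" "x \<in> F \<Longrightarrow> y \<in> F \<Longrightarrow> x + y \<in> F" "x \<in> F \<Longrightarrow> y \<in> F \<Longrightarrow> x * y \<in> F"
    "x \<in> F \<Longrightarrow> - x \<in> F" "x \<in> F \<Longrightarrow> inverse x \<in> F" "x \<in> F \<Longrightarrow> x ^ n \<in> F"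
proof -
  show 1: "1 \<in> F" "x \<in> F \<Longrightarrow> y \<in> F \<Longrightarrow> x + y \<in> F" and m: "x \<in> F \<Longrightarrow> y \<in> F \<Longrightarrow> x * y \<in> F"
    and u: "x \<in> F \<Longrightarrow> - x \<in> F" and "x \<in> F \<Longrightarrow> inverse x \<in> F" for x y
    using assms by (auto simp: is_subfield_def)
  show "0 \<in> F" using 1 u by (metis add.right_inverse)
  show "x \<in> F \<Longrightarrow> x ^ n \<in> F" by (induction n) (auto simp: 1 m)
qed

lemma alg_over_self: "is_subfield F \<Longrightarrow> x \<in> F \<Longrightarrow> alg_over F x"
  unfolding alg_over_def
  by (rule exI[of _ "[:- x, 1:]"])
    (auto simp: coeff_pCons is_subfield_closed split: nat.splits)

context
  fixes \<kappa> :: "'k::field \<Rightarrow> 'f::field"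
  assumes \<kappa>: "unital_ring_hom \<kappa>"
begin

lemma inj_field_hom: "\<kappa> c = 0 \<longleftrightarrow> c = 0"
proof -
  have "c \<noteq> 0 \<Longrightarrow> \<kappa> c * \<kappa> (inverse c) = 1"
    using unital_ring_homD[OF \<kappa>] by (metis right_inverse)
  then show ?thesis using unital_ring_homD(4)[OF \<kappa>] by (metis mult_zero_left zero_neq_one)
qed

lemma eval_map_poly: "poly (map_poly \<kappa> p) x = (\<Sum>i\<le>degree p. \<kappa> (coeff p i) * x ^ i)"
proof -
  have c: "coeff (map_poly \<kappa> p) i = \<kappa> (coeff p i)" for i
    by (simp add: coeff_map_poly unital_ring_homD[OF \<kappa>])
  have "degree (map_poly \<kappa> p) \<le> degree p"
    by (rule degree_le) (simp add: c coeff_eq_0 unital_ring_homD[OF \<kappa>])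
  then have "poly (map_poly \<kappa> p) x = (\<Sum>i\<le>degree p. coeff (map_poly \<kappa> p) i * x ^ i)"
    unfolding poly_altdef by (intro sum.mono_neutral_left) (auto simp: coeff_eq_0)
  then show ?thesis by (simp add: c)
qed

lemma map_poly_hom_add: "map_poly \<kappa> (p + q) = map_poly \<kappa> p + map_poly \<kappa> q"
  by (rule poly_eqI) (simp add: coeff_map_poly unital_ring_homD[OF \<kappa>])

lemma map_poly_hom_mult: "map_poly \<kappa> (p * q) = map_poly \<kappa> p * map_poly \<kappa> q"
  by (rule poly_eqI)
    (simp add: coeff_map_poly coeff_mult unital_ring_homD[OF \<kappa>] unital_ring_hom_sum[OF \<kappa>])

lemma map_poly_hom_uminus: "map_poly \<kappa> (- p) = - map_poly \<kappa> p"
  by (rule poly_eqI) (simp add: coeff_map_poly unital_ring_homD[OF \<kappa>])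

lemma map_poly_hom_1: "map_poly \<kappa> 1 = 1"
  by (rule poly_eqI) (simp add: coeff_map_poly unital_ring_homD[OF \<kappa>])

text \<open>The subfield \<open>K(x)\<close>; since \<open>inverse 0 = 0\<close>, vanishing denominators are harmless.\<close>

definition adjoin :: "'f \<Rightarrow> 'f set" where
  "adjoin x = {poly (map_poly \<kappa> p) x * inverse (poly (map_poly \<kappa> q) x) | p q. True}"

lemma adjoinI: "z = poly (map_poly \<kappa> p) x * inverse (poly (map_poly \<kappa> q) x) \<Longrightarrow> z \<in> adjoin x"
  by (auto simp: adjoin_def)

lemma adjoin_poly: "poly (map_poly \<kappa> p) x \<in> adjoin x"
  by (rule adjoinI[of _ p _ 1]) (simp add: map_poly_hom_1)

lemma adjoin_const: "\<kappa> c \<in> adjoin x"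
  using adjoin_poly[of "[:c:]" x] by (simp add: map_poly_pCons unital_ring_homD[OF \<kappa>])

lemma adjoin_self: "x \<in> adjoin x"
  using adjoin_poly[of "[:0, 1:]" x] by (simp add: map_poly_pCons unital_ring_homD[OF \<kappa>])

lemma adjoinE:
  assumes "z \<in> adjoin x"
  obtains p q where "poly (map_poly \<kappa> q) x \<noteq> 0" "z * poly (map_poly \<kappa> q) x = poly (map_poly \<kappa> p) x"
proof -
  from assms obtain p q where z: "z = poly (map_poly \<kappa> p) x * inverse (poly (map_poly \<kappa> q) x)"
    by (auto simp: adjoin_def)
  show ?thesis
  proof (cases "poly (map_poly \<kappa> q) x = 0")
    case True
    then show ?thesis using z by (intro that[of 1 0]) (auto simp: map_poly_hom_1)
  next
    case False
    then show ?thesis using z by (intro that[of q p]) auto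
  qed
qed

lemma is_subfield_adjoin: "is_subfield (adjoin x)"
  unfolding is_subfield_def
proof (intro conjI ballI)
  show "1 \<in> adjoin x" by (rule adjoinI[of _ 1 _ 1]) (simp add: map_poly_hom_1)
next
  fix y z assume "y \<in> adjoin x" "z \<in> adjoin x"
  then obtain p q r s where d: "poly (map_poly \<kappa> q) x \<noteq> 0" "y * poly (map_poly \<kappa> q) x = poly (map_poly \<kappa> p) x"
    "poly (map_poly \<kappa> s) x \<noteq> 0" "z * poly (map_poly \<kappa> s) x = poly (map_poly \<kappa> r) x"
    by (metis adjoinE)
  have y: "y = poly (map_poly \<kappa> p) x / poly (map_poly \<kappa> q) x"
    and z: "z = poly (map_poly \<kappa> r) x / poly (map_poly \<kappa> s) x"
    using d by (simp_all add: field_simps)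
  show "y + z \<in> adjoin x"
    by (rule adjoinI[of _ "p * s + r * q" _ "q * s"])
      (use d in \<open>simp add: y z map_poly_hom_mult map_poly_hom_add field_simps\<close>)
  show "y * z \<in> adjoin x"
    by (rule adjoinI[of _ "p * r" _ "q * s"])
      (use d in \<open>simp add: y z map_poly_hom_mult field_simps\<close>)
next
  fix y assume "y \<in> adjoin x"
  then obtain p q where d: "poly (map_poly \<kappa> q) x \<noteq> 0" "y * poly (map_poly \<kappa> q) x = poly (map_poly \<kappa> p) x"
    by (metis adjoinE)
  have y: "y = poly (map_poly \<kappa> p) x / poly (map_poly \<kappa> q) x"
    using d by (simp_all add: field_simps)
  show "- y \<in> adjoin x"
    by (rule adjoinI[of _ "- p" _ "q"])
      (use d in \<open>simp add: y map_poly_hom_uminus field_simps\<close>)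
  show "inverse y \<in> adjoin x"
    by (rule adjoinI[of _ q _ p])
      (use d in \<open>simp add: y field_simps\<close>)
qed

text \<open>A nonzero polynomial, of degree at most \<open>d\<close> in each of two variables,
  vanishes at the pair. The square array of coefficients makes the relation symmetric, as the
  exchange argument needs.\<close>

definition dependent_pair :: "'f \<Rightarrow> 'f \<Rightarrow> bool" where
  "dependent_pair x y \<longleftrightarrow> (\<exists>c d. (\<exists>i\<le>d. \<exists>j\<le>d. c i j \<noteq> 0) \<and>
     (\<Sum>i\<le>d. \<Sum>j\<le>(d::nat). \<kappa> (c i j) * x ^ i * y ^ j) = 0)"

lemma dependent_pair_sym: "dependent_pair x y \<Longrightarrow> dependent_pair y x"
proof -
  assume "dependent_pair x y"
  then obtain c d where cd: "\<exists>i\<le>d. \<exists>j\<le>d. c i j \<noteq> 0"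
    "(\<Sum>i\<le>d. \<Sum>j\<le>d. \<kappa> (c i j) * x ^ i * y ^ j) = 0" unfolding dependent_pair_def by blast
  have "(\<Sum>i\<le>d. \<Sum>j\<le>d. \<kappa> (c j i) * y ^ i * x ^ j) = (\<Sum>i\<le>d. \<Sum>j\<le>d. \<kappa> (c i j) * x ^ i * y ^ j)"
    by (subst sum.swap) (simp add: mult_ac)
  then show ?thesis unfolding dependent_pair_def using cd
    by (intro exI[of _ "\<lambda>i j. c j i"] exI[of _ d]) auto
qed

lemma dependent_pair_algebraic:
  assumes "p \<noteq> 0" "poly (map_poly \<kappa> p) x = 0"
  shows "dependent_pair x y"
  unfolding dependent_pair_def
proof (rule exI[of _ "\<lambda>i j. if j = 0 then coeff p i else 0"], rule exI[of _ "degree p"], rule conjI)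
  show "\<exists>i\<le>degree p. \<exists>j\<le>degree p. (if j = 0 then coeff p i else 0) \<noteq> 0"
    by (rule exI[of _ "degree p"]) (use assms in auto)
  have "(\<Sum>i\<le>degree p. \<Sum>j\<le>degree p. \<kappa> (if j = 0 then coeff p i else 0) * x ^ i * y ^ j)
      = (\<Sum>i\<le>degree p. \<Sum>j\<le>degree p. if j = 0 then \<kappa> (coeff p i) * x ^ i else 0)"
    by (intro sum.cong) (auto simp: unital_ring_homD[OF \<kappa>])
  also have "\<dots> = 0" using assms(2) by (simp add: eval_map_poly)
  finally show "(\<Sum>i\<le>degree p. \<Sum>j\<le>degree p. \<kappa> (if j = 0 then coeff p i else 0) * x ^ i * y ^ j) = 0" .
qed

text \<open>An equation of \<open>y\<close> over K(x) is multiplied by the product \<open>B\<close>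
  of the denominators of its coefficients, which turns them into polynomials \<open>c j\<close> in
  \<open>x\<close>. The relation stays nontrivial because \<open>B\<close> does not vanish at
  \<open>x\<close>.\<close>

lemma alg_over_adjoin_imp_dependent_pair:
  assumes "alg_over (adjoin x) y"
  shows "dependent_pair x y"
proof -
  from assms obtain p where p: "p \<noteq> 0" "\<And>i. coeff p i \<in> adjoin x" "poly p y = 0"
    by (auto simp: alg_over_def)
  have "\<exists>a b. poly (map_poly \<kappa> b) x \<noteq> 0 \<and> coeff p i * poly (map_poly \<kappa> b) x = poly (map_poly \<kappa> a) x" for i
    using p(2)[of i] by (metis adjoinE)
  then obtain a b where ab: "\<And>i. poly (map_poly \<kappa> (b i)) x \<noteq> 0"
    "\<And>i. coeff p i * poly (map_poly \<kappa> (b i)) x = poly (map_poly \<kappa> (a i)) x"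
    by metis
  let ?n = "degree p"
  define B where "B = (\<Prod>i\<le>?n. b i)"
  have hom: "unital_ring_hom (\<lambda>p. poly (map_poly \<kappa> p) x)"
    by (simp add: unital_ring_hom_def map_poly_hom_add map_poly_hom_mult map_poly_hom_1)
  have B: "poly (map_poly \<kappa> B) x \<noteq> 0"
    using ab(1) by (simp add: B_def unital_ring_hom_prod[OF hom])
  define c where "c j = a j * (\<Prod>i\<in>{..?n} - {j}. b i)" for j
  have c: "poly (map_poly \<kappa> (c j)) x = coeff p j * poly (map_poly \<kappa> B) x" if "j \<le> ?n" for j
  proof -
    have "B = b j * (\<Prod>i\<in>{..?n} - {j}. b i)"
      unfolding B_def using that by (intro prod.remove) auto
    then show ?thesis using ab(2)[of j, symmetric] by (simp add: c_def map_poly_hom_mult mult_ac)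
  qed
  define d where "d = max ?n (Max ((\<lambda>j. degree (c j)) ` {..?n}))"
  have d: "degree (c j) \<le> d" if "j \<le> ?n" for j
    using that by (auto simp: d_def le_max_iff_disj)
  have inner: "(\<Sum>i\<le>d. \<kappa> (coeff (c j) i) * x ^ i) = poly (map_poly \<kappa> (c j)) x" if "j \<le> ?n" for j
    unfolding eval_map_poly using d[OF that]
    by (intro sum.mono_neutral_right) (auto simp: coeff_eq_0 unital_ring_homD[OF \<kappa>])
  define C where "C i j = (if j \<le> ?n then coeff (c j) i else 0)" for i j
  have "c ?n \<noteq> 0" using c[of ?n] B p(1) by auto
  then have "C (degree (c ?n)) ?n \<noteq> 0" by (simp add: C_def)
  then have nz: "\<exists>i\<le>d. \<exists>j\<le>d. C i j \<noteq> 0"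
    using d[of ?n] by (intro exI[of _ "degree (c ?n)"] exI[of _ ?n] conjI) (auto simp: d_def)
  have "(\<Sum>i\<le>d. \<Sum>j\<le>d. \<kappa> (C i j) * x ^ i * y ^ j) = (\<Sum>j\<le>d. (\<Sum>i\<le>d. \<kappa> (C i j) * x ^ i) * y ^ j)"
    by (subst sum.swap) (simp add: sum_distrib_right)
  also have "\<dots> = (\<Sum>j\<le>?n. (\<Sum>i\<le>d. \<kappa> (C i j) * x ^ i) * y ^ j)"
    by (rule sum.mono_neutral_right) (auto simp: C_def d_def unital_ring_homD[OF \<kappa>])
  also have "\<dots> = (\<Sum>j\<le>?n. (coeff p j * y ^ j) * poly (map_poly \<kappa> B) x)"
    by (intro sum.cong refl) (use inner c in \<open>simp add: C_def\<close>)
  also have "\<dots> = (\<Sum>j\<le>?n. coeff p j * y ^ j) * poly (map_poly \<kappa> B) x"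
    by (simp only: sum_distrib_right)
  also have "\<dots> = 0" using p(3) by (simp add: poly_altdef)
  finally show ?thesis unfolding dependent_pair_def using nz by blast
qed

text \<open>Grouping the relation by powers of \<open>y\<close> gives coefficients in K[x];
  transcendence of \<open>x\<close> keeps one of them from vanishing.\<close>

lemma dependent_pair_imp_alg_over_adjoin:
  assumes x: "\<And>p. p \<noteq> 0 \<Longrightarrow> poly (map_poly \<kappa> p) x \<noteq> 0" and "dependent_pair x y"
  shows "alg_over (adjoin x) y"
proof -
  obtain c d i0 j0 where cd: "i0 \<le> d" "j0 \<le> d" "c i0 j0 \<noteq> 0"
    "(\<Sum>i\<le>d. \<Sum>j\<le>d. \<kappa> (c i j) * x ^ i * y ^ j) = 0" using assms(2) unfolding dependent_pair_def by blast
  define r where "r j = (\<Sum>i\<le>d. monom (c i j) i)" for j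
  have cr: "coeff (r j) i = (if i \<le> d then c i j else 0)" for i j
    by (simp add: r_def coeff_sum)
  have "r j0 \<noteq> 0" using cd cr[of j0 i0] by auto
  define p where "p = (\<Sum>j\<le>d. monom (poly (map_poly \<kappa> (r j)) x) j)"
  have cp: "coeff p j = (if j \<le> d then poly (map_poly \<kappa> (r j)) x else 0)" for j
    by (simp add: p_def coeff_sum)
  have "p \<noteq> 0" using cp[of j0] x[OF \<open>r j0 \<noteq> 0\<close>] cd(2) by auto
  moreover have "coeff p j \<in> adjoin x" for j
    by (auto simp: cp adjoin_poly is_subfield_closed[OF is_subfield_adjoin])
  moreover have "poly p y = 0"
  proof -
    have e: "poly (map_poly \<kappa> (r j)) x = (\<Sum>i\<le>d. \<kappa> (c i j) * x ^ i)" for j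
    proof -
      have "degree (r j) \<le> d" by (rule degree_le) (simp add: cr)
      then have "poly (map_poly \<kappa> (r j)) x = (\<Sum>i\<le>d. \<kappa> (coeff (r j) i) * x ^ i)"
        unfolding eval_map_poly
        by (intro sum.mono_neutral_left) (auto simp: coeff_eq_0 unital_ring_homD[OF \<kappa>])
      then show ?thesis by (simp add: cr)
    qed
    have "poly p y = (\<Sum>j\<le>d. \<Sum>i\<le>d. \<kappa> (c i j) * x ^ i * y ^ j)"
      by (simp add: p_def poly_sum poly_monom e sum_distrib_right)
    also have "\<dots> = 0" by (subst sum.swap) (rule cd(4))
    finally show ?thesis .
  qed
  ultimately show ?thesis by (auto simp: alg_over_def)
qed

text \<open>The tower \<open>K(s)(y\<^sub>1)\<dots>(y\<^sub>r)\<close> has transcendence degree at most one over \<open>K\<close>.\<close>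

lemma dependent_pair_tower:
  fixes Y :: "nat \<Rightarrow> 'f"
  assumes step: "\<And>v. 0 < v \<Longrightarrow> v < n \<Longrightarrow> alg_over ((\<lambda>p. mpoly_eval \<kappa> p Y) ` mpoly_ring v) (Y v)"
    and "n > 0"
    and p: "p \<in> mpoly_ring n" and q: "q \<in> mpoly_ring n"
  shows "dependent_pair (mpoly_eval \<kappa> p Y) (mpoly_eval \<kappa> q Y)"
proof -
  \<comment> \<open>Algebraicity climbs the tower from any field \<open>F\<close> containing K over
    which the bottom element \<open>Y 0\<close> is algebraic. It is used with K(s) and then with
    K(a) as base.\<close>
  have tower: "alg_over F (mpoly_eval \<kappa> p Y)"
    if F: "is_subfield F" "\<And>c. \<kappa> c \<in> F" "alg_over F (Y 0)" and p: "p \<in> mpoly_ring n" for F p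
  proof -
    note cl = is_subfield_closed[OF is_subfield_alg_over[OF F(1)], simplified]
    have val: "alg_over F (mpoly_eval \<kappa> p Y)"
      if "p \<in> mpoly_ring k" "\<And>v. v < k \<Longrightarrow> alg_over F (Y v)" for p k
      using that(1) by (induction p rule: mpoly_ring_induct)
        (auto simp: \<kappa> mpoly_eval_add mpoly_eval_mult that(2) cl intro: alg_over_self F)
    have "alg_over F (Y v)" if "v < n" for v
      using that
    proof (induction v rule: less_induct)
      case (less v)
      show ?case
      proof (cases "v = 0")
        case False
        have "alg_over ((\<lambda>p. mpoly_eval \<kappa> p Y) ` mpoly_ring v) (Y v)"
          using step False less.prems by simp
        then have "alg_over {y. alg_over F y} (Y v)"
          by (rule alg_over_mono[rotated]) (use less val[of _ v] in auto)
        then show ?thesis by (rule alg_over_trans[OF F(1)])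
      qed (use F in simp)
    qed
    then show ?thesis using val p by blast
  qed
  let ?a = "mpoly_eval \<kappa> p Y" and ?b = "mpoly_eval \<kappa> q Y" and ?s = "Y 0"
  show ?thesis
  proof (cases "\<exists>r. r \<noteq> 0 \<and> poly (map_poly \<kappa> r) ?a = 0")
    case True
    then show ?thesis using dependent_pair_algebraic by blast
  next
    case False
    have s: "dependent_pair ?s ?a"
    proof (rule alg_over_adjoin_imp_dependent_pair, rule tower)
      show "alg_over (adjoin ?s) ?s" by (rule alg_over_self[OF is_subfield_adjoin adjoin_self])
    qed (auto simp: is_subfield_adjoin adjoin_const p)
    \<comment> \<open>Exchange: \<open>?a\<close> is transcendental here, so its dependence on
      \<open>?s\<close> makes \<open>?s\<close> algebraic over K(a), and K(a) can replace K(s) as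
      the base of the tower.\<close>
    have "alg_over (adjoin ?a) ?s"
      by (rule dependent_pair_imp_alg_over_adjoin[OF _ dependent_pair_sym[OF s]]) (use False in auto)
    then have "alg_over (adjoin ?a) ?b"
      by (intro tower) (auto simp: is_subfield_adjoin adjoin_const q)
    then show ?thesis by (rule alg_over_adjoin_imp_dependent_pair)
  qed
qed

lemma dependent_pair_mpoly:
  assumes "dependent_pair (g 0) (g 1)"
  obtains q where "q \<in> mpoly_ring 2" "q \<noteq> 0" "mpoly_eval \<kappa> q g = 0"
proof -
  obtain c d i0 j0 where cd: "i0 \<le> d" "j0 \<le> d" "c i0 j0 \<noteq> 0"
    "(\<Sum>i\<le>d. \<Sum>j\<le>d. \<kappa> (c i j) * g 0 ^ i * g 1 ^ j) = 0" using assms unfolding dependent_pair_def by blast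
  define q where "q = (\<Sum>i\<le>d. \<Sum>j\<le>d. mpoly_const (c i j) * mpoly_var 0 ^ i * mpoly_var 1 ^ j)"
  have "q \<in> mpoly_ring 2" unfolding q_def by (auto intro!: mpoly_ring_sum mpoly_ring_mult mpoly_ring_power)
  moreover have "mpoly_eval \<kappa> q g = 0"
    using cd(4) by (simp add: q_def unital_ring_hom_sum[OF mpoly_eval_hom[OF \<kappa>]] mpoly_eval_mult[OF \<kappa>]
        unital_ring_hom_power[OF mpoly_eval_hom[OF \<kappa>]] \<kappa>)
  moreover have "q \<noteq> 0"
  proof
    let ?e = "\<lambda>i j. Poly_Mapping.single 0 i + Poly_Mapping.single 1 j :: nat \<Rightarrow>\<^sub>0 nat"
    have inj: "?e i j = ?e k l \<longleftrightarrow> i = k \<and> j = l" for i j k l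
    proof
      assume *: "?e i j = ?e k l"
      show "i = k \<and> j = l"
        using arg_cong[OF *, of "\<lambda>f. Poly_Mapping.lookup f 0"] arg_cong[OF *, of "\<lambda>f. Poly_Mapping.lookup f 1"]
        by (simp add: lookup_add lookup_single)
    qed simp
    assume "q = 0"
    have "q = (\<Sum>i\<le>d. \<Sum>j\<le>d. Poly_Mapping.single (?e i j) (c i j))"
      by (simp add: q_def single_single_power[symmetric] mpoly_const_def mult_single)
    then have "Poly_Mapping.lookup q (?e i0 j0)
        = (\<Sum>i\<le>d. \<Sum>j\<le>d. if i = i0 \<and> j = j0 then c i j else 0)"
      by (simp only: lookup_sum lookup_single inj when_def)
    also have "\<dots> = (\<Sum>i\<le>d. if i = i0 then c i j0 else 0)"
      using cd(2) by (intro sum.cong) auto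
    also have "\<dots> = c i0 j0" using cd(1) by simp
    finally show False using cd(3) \<open>q = 0\<close> by simp
  qed
  ultimately show ?thesis using that by blast
qed

end

subsection \<open>Polynomials in the last variable\<close>

context
  fixes \<kappa> :: "'k::comm_ring_1 \<Rightarrow> 'r::comm_ring_1" and Y :: "nat \<Rightarrow> 'r" and k :: nat
  assumes \<kappa>: "unital_ring_hom \<kappa>"
begin

text \<open>On \<open>mpoly_ring (Suc k)\<close> exactly variable number \<open>k\<close> becomes
  the indeterminate. With \<open>Y\<close> in a field this exhibits an equation for
  \<open>Y k\<close> over the earlier values; with \<open>Y = mpoly_var\<close> it writes a
  polynomial as univariate in its last variable.\<close>

definition poly_in_var :: "'k mpoly \<Rightarrow> 'r poly" where
  "poly_in_var p = mpoly_eval (\<lambda>c. [:\<kappa> c:]) p (\<lambda>v. if v < k then [:Y v:] else [:0, 1:])"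

lemma pCons_hom: "unital_ring_hom (\<lambda>c. [:\<kappa> c:])"
  by (simp add: unital_ring_hom_def unital_ring_homD[OF \<kappa>])

lemma poly_in_var_add: "poly_in_var (p + q) = poly_in_var p + poly_in_var q"
  and poly_in_var_mult: "poly_in_var (p * q) = poly_in_var p * poly_in_var q"
  and poly_in_var_const: "poly_in_var (mpoly_const c) = [:\<kappa> c:]"
  and poly_in_var_var: "poly_in_var (mpoly_var v) = (if v < k then [:Y v:] else [:0, 1:])"
  by (simp_all add: poly_in_var_def mpoly_eval_add[OF pCons_hom] mpoly_eval_mult[OF pCons_hom]
      mpoly_eval_const[OF pCons_hom] mpoly_eval_var[OF pCons_hom])

lemma poly_in_var_0: "poly_in_var 0 = 0" and poly_in_var_1: "poly_in_var 1 = 1"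
  by (simp_all add: poly_in_var_def mpoly_eval_0[OF pCons_hom] mpoly_eval_1[OF pCons_hom])

lemma coeff_poly_in_var:
  "coeff (poly_in_var p) i \<in> (\<lambda>p. mpoly_eval \<kappa> p Y) ` mpoly_ring k"
proof -
  let ?R = "(\<lambda>p. mpoly_eval \<kappa> p Y) ` mpoly_ring k"
  have R: "\<kappa> c \<in> ?R" "v < k \<Longrightarrow> Y v \<in> ?R" "a \<in> ?R \<Longrightarrow> b \<in> ?R \<Longrightarrow> a + b \<in> ?R"
    "a \<in> ?R \<Longrightarrow> b \<in> ?R \<Longrightarrow> a * b \<in> ?R" for a b c v
  proof -
    show "\<kappa> c \<in> ?R" by (rule image_eqI[of _ _ "mpoly_const c"]) (auto simp: \<kappa>)
    show "v < k \<Longrightarrow> Y v \<in> ?R" by (rule image_eqI[of _ _ "mpoly_var v"]) (auto simp: \<kappa>)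
    show "a \<in> ?R \<Longrightarrow> b \<in> ?R \<Longrightarrow> a + b \<in> ?R" by (force simp flip: mpoly_eval_add[OF \<kappa>])
    show "a \<in> ?R \<Longrightarrow> b \<in> ?R \<Longrightarrow> a * b \<in> ?R" by (force simp flip: mpoly_eval_mult[OF \<kappa>])
  qed
  have 01: "0 \<in> ?R" "1 \<in> ?R" using R(1)[of 0] R(1)[of 1] by (simp_all add: unital_ring_homD[OF \<kappa>])
  have sum: "(\<And>x. x \<in> A \<Longrightarrow> f x \<in> ?R) \<Longrightarrow> sum f A \<in> ?R" for f and A :: "nat set"
    by (induction A rule: infinite_finite_induct) (auto intro: R(3) 01)
  show ?thesis
  proof (induction p arbitrary: i rule: mpoly_induct)
    case (const c)
    then show ?case using R 01 by (auto simp: poly_in_var_const coeff_pCons split: nat.splits)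
  next
    case (var v)
    then show ?case using R 01 by (auto simp: poly_in_var_var coeff_pCons split: nat.splits)
  next
    case (add p q)
    then show ?case using R by (simp add: poly_in_var_add)
  next
    case (mult p q)
    then show ?case using R by (auto simp: poly_in_var_mult coeff_mult intro!: sum)
  qed
qed

lemma poly_poly_in_var:
  assumes "p \<in> mpoly_ring (Suc k)"
  shows "poly (poly_in_var p) (Y k) = mpoly_eval \<kappa> p Y"
  using assms
  by (induction p rule: mpoly_ring_induct)
    (auto simp: poly_in_var_add poly_in_var_mult poly_in_var_const poly_in_var_var \<kappa>
      mpoly_eval_add mpoly_eval_mult less_Suc_eq)

end

text \<open>Through this identity, a partial derivative that does not vanish at \<open>Y\<close>
  shows that the univariate polynomial is nonzero.\<close>

lemma pderiv_poly_in_var: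
  fixes \<kappa> :: "'k::comm_ring_1 \<Rightarrow> 'r::idom"
  assumes \<kappa>: "unital_ring_hom \<kappa>" and "p \<in> mpoly_ring (Suc k)"
  shows "pderiv (poly_in_var \<kappa> Y k p) = poly_in_var \<kappa> Y k (mpoly_pderiv k p)"
  using assms(2)
proof (induction p rule: mpoly_ring_induct)
  case (const c)
  then show ?case
    by (simp add: poly_in_var_const[OF \<kappa>] pderiv_pCons poly_in_var_0[OF \<kappa>])
next
  case (var v)
  then show ?case
    by (auto simp: poly_in_var_var[OF \<kappa>] pderiv_pCons mpoly_pderiv_var
        poly_in_var_0[OF \<kappa>] poly_in_var_1[OF \<kappa>])
next
  case (add p q)
  then show ?case by (simp add: poly_in_var_add[OF \<kappa>] pderiv_add mpoly_pderiv_add)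
next
  case (mult p q)
  then show ?case by (simp add: poly_in_var_mult[OF \<kappa>] poly_in_var_add[OF \<kappa>] pderiv_mult mpoly_pderiv_mult)
qed

subsection \<open>Rational points on curves with a rational branch\<close>

lemma fps_X_power_dvd_iff: "fps_X ^ n dvd f \<longleftrightarrow> (\<forall>j<n. fps_nth f j = 0)"
proof
  assume "fps_X ^ n dvd f"
  then show "\<forall>j<n. fps_nth f j = 0" by (auto simp: dvd_def fps_X_power_mult_nth)
next
  assume "\<forall>j<n. fps_nth f j = 0"
  then have "f = fps_X ^ n * fps_shift n f"
    by (intro fps_ext) (auto simp: fps_X_power_mult_nth)
  then show "fps_X ^ n dvd f" by (rule dvdI)
qed

lemma fps_const_hom: "unital_ring_hom (fps_const :: 'k::comm_ring_1 \<Rightarrow> _)"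
  by (simp add: unital_ring_hom_def)

lemma fps_nth_0_hom: "unital_ring_hom (\<lambda>f. fps_nth (f :: 'k::comm_ring_1 fps) 0)"
  by (simp add: unital_ring_hom_def)

lemma keys_mpoly_ring_1:
  assumes "p \<in> mpoly_ring 1" "e \<in> Poly_Mapping.keys p"
  shows "e = Poly_Mapping.single 0 (Poly_Mapping.lookup e 0)"
proof (rule poly_mapping_eqI)
  fix v
  show "Poly_Mapping.lookup e v = Poly_Mapping.lookup (Poly_Mapping.single 0 (Poly_Mapping.lookup e 0)) v"
  proof (cases "v = 0")
    case False
    then have "v \<notin> Poly_Mapping.keys e" using assms by (auto simp: mpoly_ring_def)
    then show ?thesis using False by (simp add: lookup_single in_keys_iff)
  qed simp
qed

text \<open>Polynomials in one variable embed in power series without change of coefficients, so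
  orders of vanishing can be read on either side.\<close>

lemma fps_nth_eval_X:
  fixes p :: "'k::comm_ring_1 mpoly"
  assumes p: "p \<in> mpoly_ring 1"
  shows "fps_nth (mpoly_eval fps_const p (\<lambda>_. fps_X)) n = Poly_Mapping.lookup p (Poly_Mapping.single 0 n)"
proof -
  have mon: "monomial_eval e (\<lambda>_. fps_X :: 'k fps) = fps_X ^ Poly_Mapping.lookup e 0"
    if "e \<in> Poly_Mapping.keys p" for e
  proof -
    have "Poly_Mapping.keys e \<subseteq> {0}" using that p by (auto simp: mpoly_ring_def)
    then show ?thesis by (simp add: monomial_eval_superset[of "{0}"])
  qed
  have "fps_nth (mpoly_eval fps_const p (\<lambda>_. fps_X)) n
      = (\<Sum>e\<in>Poly_Mapping.keys p. if e = Poly_Mapping.single 0 n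
          then Poly_Mapping.lookup p (Poly_Mapping.single 0 n) else 0)"
    unfolding mpoly_eval_superset[OF fps_const_hom finite_keys order_refl] fps_sum_nth
  proof (rule sum.cong[OF refl])
    fix e assume e: "e \<in> Poly_Mapping.keys p"
    have "e = Poly_Mapping.single 0 n \<longleftrightarrow> Poly_Mapping.lookup e 0 = n"
      using keys_mpoly_ring_1[OF p e] by (metis lookup_single_eq)
    then show "fps_nth (fps_const (Poly_Mapping.lookup p e) * monomial_eval e (\<lambda>_. fps_X)) n
        = (if e = Poly_Mapping.single 0 n then Poly_Mapping.lookup p (Poly_Mapping.single 0 n) else 0)"
      by (auto simp: mon[OF e])
  qed
  then show ?thesis by (simp add: in_keys_iff)
qed

text \<open>Solved for its linear term, equation \<open>i\<close> says that \<open>\<zeta> i\<close>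
  equals \<open>- s / u i\<close> times the value of \<open>w i\<close> at s and
  \<open>\<zeta>\<close>. The factor s makes the right side a contraction in the s-adic metric, and
  its fixed point is the solution.\<close>

lemma hensel_diagonal:
  fixes u :: "nat \<Rightarrow> 'k::field" and w :: "nat \<Rightarrow> 'k mpoly"
  assumes u: "\<And>i. i < r \<Longrightarrow> u i \<noteq> 0"
  obtains \<zeta> :: "nat \<Rightarrow> 'k fps" where "\<And>i. fps_nth (\<zeta> i) 0 = 0"
    "\<And>i. i < r \<Longrightarrow> mpoly_eval fps_const
        (mpoly_const (u i) * mpoly_var (Suc i) + mpoly_var 0 * w i) (case_nat fps_X \<zeta>) = 0"
proof -
  \<comment> \<open>Coordinates from \<open>r\<close> on are set to 0, which gives a value to every
    variable that may occur in \<open>w i\<close>.\<close>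
  define \<Phi> where "\<Phi> z i = (if i < r then
      - fps_const (1 / u i) * (fps_X * mpoly_eval fps_const (w i) (case_nat fps_X z)) else 0)"
    for z :: "nat \<Rightarrow> 'k fps" and i
  have \<Phi>: "fps_X ^ Suc n dvd \<Phi> z i - \<Phi> z' i" if "\<And>i. fps_X ^ n dvd z i - z' i" for n z z' i
  proof (cases "i < r")
    case True
    obtain N where "w i \<in> mpoly_ring N" by (rule mpoly_ring_exhaust)
    then have "fps_X ^ n dvd mpoly_eval fps_const (w i) (case_nat fps_X z)
        - mpoly_eval fps_const (w i) (case_nat fps_X z')"
      by (rule mpoly_eval_dvd_diff[OF fps_const_hom]) (use that in \<open>auto split: nat.splits\<close>)
    then have "fps_X * fps_X ^ n dvd fps_X * (mpoly_eval fps_const (w i) (case_nat fps_X z)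
        - mpoly_eval fps_const (w i) (case_nat fps_X z'))" by (rule mult_dvd_mono[OF dvd_refl])
    then have "fps_X ^ Suc n dvd - fps_const (1 / u i) * (fps_X * (mpoly_eval fps_const (w i) (case_nat fps_X z)
        - mpoly_eval fps_const (w i) (case_nat fps_X z')))" by (metis dvd_mult power_Suc)
    then show ?thesis using True by (simp add: \<Phi>_def algebra_simps)
  qed (simp add: \<Phi>_def)
  define Z where "Z n = (\<Phi> ^^ n) (\<lambda>_. 0)" for n
  have Z_Suc: "Z (Suc n) = \<Phi> (Z n)" for n by (simp add: Z_def)
  have step: "fps_X ^ n dvd Z (Suc n) i - Z n i" for n i
    by (induction n arbitrary: i) (simp_all only: power_0 one_dvd Z_Suc \<Phi>)
  have nth: "fps_nth (Z m i) j = fps_nth (Z (Suc j) i) j" if "m \<ge> Suc j" for m i j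
    using that
  proof (induction m rule: dec_induct)
    case (step m)
    have "fps_nth (Z (Suc m) i - Z m i) j = 0"
      using \<open>\<And>n i. fps_X ^ n dvd Z (Suc n) i - Z n i\<close>[of m i] step(1) unfolding fps_X_power_dvd_iff by simp
    then show ?case using step by simp
  qed simp
  \<comment> \<open>The diagonal of the iteration is its limit: coefficient \<open>j\<close> no
    longer changes from \<open>Z (Suc j)\<close> on.\<close>
  define \<zeta> where "\<zeta> i = Abs_fps (\<lambda>j. fps_nth (Z (Suc j) i) j)" for i
  have \<zeta>: "fps_X ^ n dvd \<zeta> i - Z n i" for n i
    unfolding fps_X_power_dvd_iff \<zeta>_def by (auto simp: nth[of _ n])
  have fixp: "\<Phi> \<zeta> i = \<zeta> i" for i
  proof (rule fps_ext)
    fix j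
    have "fps_X ^ Suc j dvd (\<Phi> \<zeta> i - \<Phi> (Z j) i) - (\<zeta> i - Z (Suc j) i)"
      by (rule dvd_diff[OF \<Phi> \<zeta>]) (rule \<zeta>)
    then have "fps_X ^ Suc j dvd \<Phi> \<zeta> i - \<zeta> i" by (simp add: Z_Suc del: power_Suc)
    then show "fps_nth (\<Phi> \<zeta> i) j = fps_nth (\<zeta> i) j"
      unfolding fps_X_power_dvd_iff by simp
  qed
  show ?thesis
  proof (rule that)
    have "fps_nth (\<Phi> \<zeta> i) 0 = 0" for i by (simp add: \<Phi>_def)
    then show "fps_nth (\<zeta> i) 0 = 0" for i by (simp add: fixp)
    show "mpoly_eval fps_const (mpoly_const (u i) * mpoly_var (Suc i) + mpoly_var 0 * w i)
        (case_nat fps_X \<zeta>) = 0" if "i < r" for i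
    proof -
      have "fps_const (u i) * \<zeta> i = fps_const (u i) * \<Phi> \<zeta> i" by (simp add: fixp)
      also have "\<dots> = - (fps_const (u i) * fps_const (1 / u i)) * (fps_X * mpoly_eval fps_const (w i) (case_nat fps_X \<zeta>))"
        using that by (simp only: \<Phi>_def if_True mult_minus_left mult_minus_right mult.assoc)
      also have "fps_const (u i) * fps_const (1 / u i) = 1" using u[OF that] by simp
      finally show ?thesis
        by (simp add: mpoly_eval_add mpoly_eval_mult fps_const_hom)
    qed
  qed
qed

text \<open>The values of a power series solution form a smooth branch of a curve through the origin;
  the variety to which largeness is applied is the Zariski closure of this branch.\<close>

lemma large_field_curve_points:
  fixes u :: "nat \<Rightarrow> 'k::field" and g w :: "nat \<Rightarrow> 'k mpoly"
  assumes large: "large_field TYPE('k)"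
    and u: "\<And>i. i < r \<Longrightarrow> u i \<noteq> 0"
    and g: "\<And>i. i < r \<Longrightarrow> g i = mpoly_const (u i) * mpoly_var (Suc i) + mpoly_var 0 * w i"
    and g_ring: "\<And>i. i < r \<Longrightarrow> g i \<in> mpoly_ring (Suc (Suc i))"
  obtains \<zeta> :: "nat \<Rightarrow> 'k fps" where
    "\<And>p. p \<in> mpoly_ring (Suc r) \<Longrightarrow> mpoly_eval fps_const p (case_nat fps_X \<zeta>) \<noteq> 0 \<Longrightarrow>
       \<exists>b. (\<forall>i<r. mpoly_eval (\<lambda>c. c) (g i) b = 0) \<and> mpoly_eval (\<lambda>c. c) p b \<noteq> 0"
proof -
  obtain \<zeta> :: "nat \<Rightarrow> 'k fps" where \<zeta>0: "\<And>i. fps_nth (\<zeta> i) 0 = 0"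
    and "\<And>i. i < r \<Longrightarrow> mpoly_eval fps_const
        (mpoly_const (u i) * mpoly_var (Suc i) + mpoly_var 0 * w i) (case_nat fps_X \<zeta>) = 0"
    using hensel_diagonal[of r u w] u by blast
  then have \<zeta>: "mpoly_eval fps_const (g i) (case_nat fps_X \<zeta>) = 0" if "i < r" for i
    using that g by simp
  define y where "y = case_nat fps_X \<zeta>"
  have y0: "fps_nth (y v) 0 = 0" for v by (simp add: y_def \<zeta>0 split: nat.split)
  let ?n = "Suc r"
  define ev where "ev p = mpoly_eval fps_const p y" for p
  have ev_hom: "unital_ring_hom ev" unfolding ev_def by (rule mpoly_eval_hom[OF fps_const_hom])
  note evs = unital_ring_homD[OF ev_hom]
  \<comment> \<open>Kernel of evaluation on the branch, hence prime because power series over a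
    field form a domain.\<close>
  define P where "P = {p \<in> mpoly_ring ?n. ev p = 0}"
  have gP: "g i \<in> P" if "i < r" for i
    using g_ring[OF that] \<zeta>[OF that] that by (auto simp: P_def ev_def y_def intro: mpoly_ring_mono)
  have irr: "irreducible_variety ?n P"
    unfolding irreducible_variety_def P_def by (auto simp: evs)
  let ?o = "\<lambda>_::nat. 0 :: 'k"
  have ev0: "fps_nth (mpoly_eval fps_const p y) 0 = mpoly_eval (\<lambda>c. c) p ?o" for p
    by (subst hom_mpoly_eval[OF fps_const_hom fps_nth_0_hom]) (simp add: y0)
  have rat: "?o \<in> rational_points P"
    by (auto simp: rational_points_def P_def ev_def simp flip: ev0)
  define G where "G p j = mpoly_eval (\<lambda>c. c) (mpoly_pderiv j p) ?o" for p j
  define t where "t v = fps_nth (y v) 1" for v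
  have t0: "t 0 = 1" by (simp add: t_def y_def)
  \<comment> \<open>Derivative at s = 0 of the identity that \<open>p\<close> vanishes on the
    branch: gradients on \<open>P\<close> are orthogonal to the tangent vector \<open>t\<close>,
    whose coordinate 0 is 1. Coordinate 0 of a gradient is therefore determined by the
    others.\<close>
  have tangent: "G p 0 = - (\<Sum>i<r. G p (Suc i) * t (Suc i))" if "p \<in> P" for p
  proof -
    have "0 = fps_nth (fps_deriv (mpoly_eval fps_const p y)) 0"
      using that by (simp add: P_def ev_def)
    also have "\<dots> = fps_nth (\<Sum>j<?n. mpoly_eval fps_const (mpoly_pderiv j p) y * fps_deriv (y j)) 0"
      by (subst derivation_chain_rule[of fps_deriv p ?n])
        (use that in \<open>auto simp: P_def derivation_def fps_const_hom\<close>)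
    also have "\<dots> = (\<Sum>j<?n. G p j * t j)"
      by (simp add: fps_sum_nth ev0 G_def t_def)
    also have "\<dots> = G p 0 + (\<Sum>i<r. G p (Suc i) * t (Suc i))"
      by (simp only: sum.lessThan_Suc_shift t0 mult_1_right)
    finally show ?thesis by (simp add: eq_neg_iff_add_eq_0)
  qed
  have Gg: "G (g i) (Suc j) = (if j = i then u i else 0)" if "i < r" for i j
    by (simp add: G_def g[OF that] mpoly_pderiv_add mpoly_pderiv_mult mpoly_pderiv_var
        mpoly_eval_add mpoly_eval_mult unital_ring_hom_id)
  have Gg0: "G (g i) 0 = - (u i * t (Suc i))" if "i < r" for i
  proof -
    have "(\<Sum>j<r. G (g i) (Suc j) * t (Suc j)) = (\<Sum>j<r. if j = i then u i * t (Suc i) else 0)"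
      by (intro sum.cong) (auto simp: Gg[OF that])
    then show ?thesis using tangent[OF gP[OF that]] that by simp
  qed
  have scale_sum: "(\<Sum>i\<in>A. (\<lambda>j. c i * v i j)) j = (\<Sum>i\<in>A. c i * v i j)"
    for A :: "'z set" and c :: "'z \<Rightarrow> 'k" and v :: "'z \<Rightarrow> nat \<Rightarrow> 'k" and j
    by (induction A rule: infinite_finite_induct) auto
  let ?B = "(\<lambda>i. G (g i)) ` {..<r}"
  have inj: "inj_on (\<lambda>i. G (g i)) {..<r}"
  proof (rule inj_onI)
    fix i j assume *: "i \<in> {..<r}" "j \<in> {..<r}" "G (g i) = G (g j)"
    have "G (g i) (Suc i) = u i" "G (g j) (Suc i) = (if i = j then u j else 0)"
      using *(1,2) Gg by auto
    moreover have "u i \<noteq> 0" using *(1) u by simp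
    ultimately show "i = j" using fun_cong[OF *(3), of "Suc i"] by metis
  qed
  \<comment> \<open>Away from coordinate 0 the gradients of the \<open>g i\<close> form a diagonal
    matrix with entries \<open>u i\<close>, so these \<open>r\<close> vectors span all
    gradients.\<close>
  have expand: "G p = (\<Sum>i<r. (\<lambda>j. (G p (Suc i) / u i) * G (g i) j))" if p: "p \<in> P" for p
  proof
    fix j
    show "G p j = (\<Sum>i<r. (\<lambda>j. (G p (Suc i) / u i) * G (g i) j)) j"
    proof (cases j)
      case 0
      have "(\<Sum>i<r. (\<lambda>j. (G p (Suc i) / u i) * G (g i) j)) 0 = (\<Sum>i<r. - (G p (Suc i) * t (Suc i)))"
        unfolding scale_sum by (intro sum.cong) (auto simp: Gg0 u)
      then show ?thesis using tangent[OF p] 0 by (simp add: sum_negf)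
    next
      case (Suc l)
      have "(\<Sum>i<r. (\<lambda>j. (G p (Suc i) / u i) * G (g i) j)) j = (\<Sum>i<r. if i = l then G p (Suc l) else 0)"
        unfolding scale_sum Suc by (intro sum.cong) (auto simp: Gg u)
      also have "\<dots> = G p j"
      proof (cases "l < r")
        case False
        then have "mpoly_pderiv j p = 0"
          using p Suc by (intro mpoly_pderiv_eq_0[of p ?n]) (auto simp: P_def)
        then show ?thesis using False by (simp add: G_def unital_ring_hom_id)
      qed (simp add: Suc)
      finally show ?thesis by simp
    qed
  qed
  have "jacobian_rank P ?o = r"
    unfolding jacobian_rank_def
  proof (rule coord_space.dim_unique)
    show "?B \<subseteq> (\<lambda>f j. mpoly_eval (\<lambda>c. c) (mpoly_pderiv j f) ?o) ` P"
      using gP by (auto simp: G_def[abs_def])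
    show "(\<lambda>f j. mpoly_eval (\<lambda>c. c) (mpoly_pderiv j f) ?o) ` P \<subseteq> coord_space.span ?B"
    proof clarify
      fix p assume "p \<in> P"
      have "G p \<in> coord_space.span ?B"
        by (subst expand[OF \<open>p \<in> P\<close>], intro coord_space.span_sum coord_space.span_scale coord_space.span_base) auto
      then show "(\<lambda>j. mpoly_eval (\<lambda>c. c) (mpoly_pderiv j p) ?o) \<in> coord_space.span ?B"
        by (simp add: G_def[abs_def])
    qed
    show "coord_space.independent ?B"
    proof (rule coord_space.independent_if_scalars_zero)
      fix f x assume s: "(\<Sum>x\<in>?B. (\<lambda>i. f x * x i)) = (0 :: nat \<Rightarrow> 'k)" and "x \<in> ?B"
      then obtain i where i: "i < r" "x = G (g i)" by auto
      have "0 = (\<Sum>x\<in>?B. (\<lambda>i. f x * x i)) (Suc i)" using s by simp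
      also have "\<dots> = (\<Sum>x\<in>?B. f x * x (Suc i))" by (rule scale_sum)
      also have "\<dots> = (\<Sum>l<r. f (G (g l)) * G (g l) (Suc i))" by (simp add: sum.reindex[OF inj])
      also have "\<dots> = (\<Sum>l<r. if l = i then f x * u i else 0)"
        using i by (intro sum.cong) (auto simp: Gg)
      finally show "f x = 0" using i u by auto
    qed simp
    show "card ?B = r" by (simp add: card_image[OF inj])
  qed
  moreover have "variety_dim ?n P = 1"
    unfolding variety_dim_def
  proof (rule Greatest_equality)
    \<comment> \<open>Lower bound for the dimension: variable 0 takes the value s on the branch,
      which satisfies no polynomial equation over K.\<close>
    have "algebraically_independent_mod P 1 (\<lambda>_. mpoly_var 0)"
      unfolding algebraically_independent_mod_def
    proof safe
      fix q :: "'k mpoly" assume q: "q \<in> mpoly_ring 1" "mpoly_eval mpoly_const q (\<lambda>_. mpoly_var 0) \<in> P"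
      have "0 = ev (mpoly_eval mpoly_const q (\<lambda>_. mpoly_var 0))" using q(2) by (simp add: P_def)
      also have "\<dots> = mpoly_eval fps_const q (\<lambda>_. fps_X)"
        by (subst hom_mpoly_eval[OF mpoly_const_hom ev_hom]) (simp add: ev_def fps_const_hom y_def)
      finally have 0: "mpoly_eval fps_const q (\<lambda>_. fps_X) = 0" by simp
      have "Poly_Mapping.lookup q e = 0" for e
      proof (rule ccontr)
        assume e: "Poly_Mapping.lookup q e \<noteq> 0"
        then show False
          using fps_nth_eval_X[OF q(1), of "Poly_Mapping.lookup e 0"] 0
            keys_mpoly_ring_1[OF q(1), of e] by (simp add: in_keys_iff)
      qed
      then show "q = 0" by (intro poly_mapping_eqI) simp
    qed
    then show "\<exists>g. (\<forall>i<1. g i \<in> mpoly_ring ?n) \<and> algebraically_independent_mod P 1 g"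
      by (intro exI[of _ "\<lambda>_. mpoly_var 0"]) auto
  next
    fix d assume "\<exists>g. (\<forall>i<d. g i \<in> mpoly_ring ?n) \<and> algebraically_independent_mod P d g"
    then obtain f where f: "\<And>i. i < d \<Longrightarrow> f i \<in> mpoly_ring ?n" "algebraically_independent_mod P d f" by blast
    show "d \<le> 1"
    proof (rule ccontr)
      assume "\<not> d \<le> 1"
      then have d: "2 \<le> d" by simp
      \<comment> \<open>Upper bound: Laurent series provide a field in which the coordinates of the
        branch form an algebraic tower over K(s).\<close>
      define \<kappa> where "\<kappa> c = fps_to_fls (fps_const c)" for c :: 'k
      have fls: "unital_ring_hom (fps_to_fls :: 'k fps \<Rightarrow> _)"
        by (simp add: unital_ring_hom_def fls_times_fps_to_fls)
      have \<kappa>: "unital_ring_hom \<kappa>"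
        unfolding unital_ring_hom_def \<kappa>_def
        by (simp only: unital_ring_homD[OF fps_const_hom] unital_ring_homD[OF fls] simp_thms)
      define Y where "Y v = fps_to_fls (y v)" for v
      have evY: "mpoly_eval \<kappa> p Y = fps_to_fls (ev p)" for p
        unfolding ev_def hom_mpoly_eval[OF fps_const_hom fls] by (simp add: \<kappa>_def[abs_def] Y_def[abs_def])
      \<comment> \<open>Equation \<open>g i\<close> is nontrivial in its last variable because its
        partial derivative there has constant term \<open>u i\<close> on the branch.\<close>
      have step: "alg_over ((\<lambda>p. mpoly_eval \<kappa> p Y) ` mpoly_ring v) (Y v)" if "0 < v" "v < ?n" for v
      proof -
        from that obtain i where v: "v = Suc i" "i < r" by (cases v) auto
        have gi: "g i \<in> mpoly_ring (Suc v)" using g_ring v by simp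
        let ?p = "poly_in_var \<kappa> Y v (g i)"
        have "mpoly_pderiv v (g i) = mpoly_const (u i) + mpoly_var 0 * mpoly_pderiv v (w i)"
          unfolding g[OF v(2)] v(1) by (simp add: mpoly_pderiv_add mpoly_pderiv_mult mpoly_pderiv_var)
        then have "fps_nth (ev (mpoly_pderiv v (g i))) 0 = u i"
          by (simp add: evs ev_def mpoly_eval_add mpoly_eval_mult fps_const_hom y0)
        then have "ev (mpoly_pderiv v (g i)) \<noteq> 0" using u[OF v(2)] by auto
        then have "poly (pderiv ?p) (Y v) \<noteq> 0"
          by (simp add: pderiv_poly_in_var[OF \<kappa> gi] poly_poly_in_var[OF \<kappa>] mpoly_pderiv_ring[OF gi] evY)
        then have "?p \<noteq> 0" by auto
        moreover have "poly ?p (Y v) = 0"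
          using gP[OF v(2)] by (simp add: poly_poly_in_var[OF \<kappa> gi] evY P_def)
        ultimately show ?thesis using coeff_poly_in_var[OF \<kappa>, of Y v "g i"] by (auto simp: alg_over_def)
      qed
      have "dependent_pair \<kappa> (mpoly_eval \<kappa> (f 0) Y) (mpoly_eval \<kappa> (f 1) Y)"
        by (rule dependent_pair_tower[OF \<kappa>, of ?n]) (use step f(1) d in auto)
      then obtain q where q: "q \<in> mpoly_ring 2" "q \<noteq> 0" "mpoly_eval \<kappa> q (\<lambda>v. mpoly_eval \<kappa> (f v) Y) = 0"
        using dependent_pair_mpoly[OF \<kappa>, of "\<lambda>v. mpoly_eval \<kappa> (f v) Y"] by auto
      have "mpoly_eval mpoly_const q f \<in> mpoly_ring ?n"
        by (rule mpoly_eval_ring[OF q(1)]) (use f(1) d in auto)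
      moreover have "fps_to_fls (ev (mpoly_eval mpoly_const q f)) = 0"
        using q(3) unfolding evY[symmetric] hom_mpoly_eval[OF mpoly_const_hom mpoly_eval_hom[OF \<kappa>]]
        by (simp add: \<kappa>)
      ultimately have "mpoly_eval mpoly_const q f \<in> P" by (simp add: P_def)
      moreover have "q \<in> mpoly_ring d" using q(1) d by (rule mpoly_ring_mono)
      ultimately show False using f(2) q(2) by (auto simp: algebraically_independent_mod_def)
    qed
  qed
  ultimately have "smooth_point ?n P ?o" using rat by (simp add: smooth_point_def)
  then have dense: "zariski_dense_points ?n P"
    using large irr by (auto simp: large_field_def)
  show ?thesis
  proof (rule that)
    fix p :: "'k mpoly" assume p: "p \<in> mpoly_ring ?n" "mpoly_eval fps_const p (case_nat fps_X \<zeta>) \<noteq> 0"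
    then have "p \<notin> P" by (simp add: P_def ev_def y_def)
    then obtain b where "b \<in> rational_points P" "mpoly_eval (\<lambda>c. c) p b \<noteq> 0"
      using dense p(1) by (auto simp: zariski_dense_points_def)
    then show "\<exists>b. (\<forall>i<r. mpoly_eval (\<lambda>c. c) (g i) b = 0) \<and> mpoly_eval (\<lambda>c. c) p b \<noteq> 0"
      using gP by (auto simp: rational_points_def)
  qed
qed

subsection \<open>From approximate power series solutions to rational points\<close>

lemma lookup_single_mult:
  fixes p :: "'k::comm_ring_1 mpoly"
  shows "Poly_Mapping.lookup (Poly_Mapping.single a 1 * p) (a + e) = Poly_Mapping.lookup p e"
proof (induction p rule: poly_mapping_add_induct)
  case (single b c)
  then show ?case by (simp add: mult_single lookup_single when_def)
qed (simp add: distrib_left lookup_add)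

text \<open>Multiplying by a monomial shifts exponents without cancellation and cannot hide a
  variable of \<open>p\<close>. This keeps the system triangular after division by a power of
  s.\<close>

lemma mpoly_ring_var_power_cancel:
  fixes p :: "'k::comm_ring_1 mpoly"
  assumes "mpoly_var v ^ n * p \<in> mpoly_ring k"
  shows "p \<in> mpoly_ring k"
  unfolding mpoly_ring_def
proof safe
  fix e i assume e: "e \<in> Poly_Mapping.keys p" and i: "i \<in> Poly_Mapping.keys e"
  have "Poly_Mapping.single v n + e \<in> Poly_Mapping.keys (mpoly_var v ^ n * p)"
    using e by (simp add: in_keys_iff single_single_power[symmetric] lookup_single_mult)
  then have "Poly_Mapping.keys (Poly_Mapping.single v n + e) \<subseteq> {..<k}"
    using assms by (auto simp: mpoly_ring_def)
  moreover have "i \<in> Poly_Mapping.keys (Poly_Mapping.single v n + e)"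
    using i by (simp add: in_keys_iff lookup_add)
  ultimately show "i < k" by auto
qed

lemma mpoly_ring_1_factor:
  fixes p :: "'k::comm_ring_1 mpoly"
  assumes p: "p \<in> mpoly_ring 1" and dvd: "fps_X ^ n dvd mpoly_eval fps_const p (\<lambda>_. fps_X)"
  obtains c where "c \<in> mpoly_ring 1" "p = mpoly_var 0 ^ n * c"
proof -
  let ?n = "Poly_Mapping.single 0 n :: nat \<Rightarrow>\<^sub>0 nat"
  define c where "c = (\<Sum>e\<in>Poly_Mapping.keys p. Poly_Mapping.single (e - ?n) (Poly_Mapping.lookup p e))"
  have ge: "?n + (e - ?n) = e" if "e \<in> Poly_Mapping.keys p" for e
  proof -
    have "Poly_Mapping.lookup p (Poly_Mapping.single 0 (Poly_Mapping.lookup e 0)) \<noteq> 0"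
      using that keys_mpoly_ring_1[OF p that] by (simp add: in_keys_iff)
    then have "n \<le> Poly_Mapping.lookup e 0"
      using dvd by (auto simp: fps_X_power_dvd_iff fps_nth_eval_X[OF p] not_le[symmetric])
    then show ?thesis
      by (intro poly_mapping_eqI) (auto simp: lookup_add lookup_minus lookup_single when_def)
  qed
  have "mpoly_var 0 ^ n * c = (\<Sum>e\<in>Poly_Mapping.keys p. Poly_Mapping.single e (Poly_Mapping.lookup p e))"
    unfolding c_def sum_distrib_left single_single_power[symmetric]
    by (intro sum.cong refl) (simp add: mult_single ge)
  also have "\<dots> = p"
    by (rule poly_mapping_eqI) (simp add: lookup_sum lookup_single when_def in_keys_iff)
  finally have c: "p = mpoly_var 0 ^ n * c" ..
  then have "c \<in> mpoly_ring 1" using p mpoly_ring_var_power_cancel by metis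
  then show ?thesis using that c by blast
qed

text \<open>The approximate solution \<open>\<eta>\<close> is truncated and the correction is blown up: substituting
  \<open>y\<^sub>v + s ^ ((r - v) * (k + 1)) * z\<^sub>v\<close> into the triangular system and dividing by the right power
  of \<open>s\<close> gives a system whose linear part at \<open>s = 0\<close> is diagonal.\<close>

lemma approximate_solution_imp_rational_point:
  fixes F :: "nat \<Rightarrow> 'k::field mpoly" and \<eta> :: "nat \<Rightarrow> 'k fps"
  assumes large: "large_field TYPE('k)"
    and F: "\<And>i. i \<in> \<Lambda> \<Longrightarrow> i < r \<Longrightarrow> F i \<in> mpoly_ring (Suc i)"
    and F_\<eta>: "\<And>i. i \<in> \<Lambda> \<Longrightarrow> i < r \<Longrightarrow> fps_X ^ (Suc r * Suc k) dvd mpoly_eval fps_const (F i) \<eta>"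
    and sep: "\<And>i. i \<in> \<Lambda> \<Longrightarrow> i < r \<Longrightarrow>
      \<exists>n\<le>k. fps_nth (mpoly_eval fps_const (mpoly_pderiv i (F i)) \<eta>) n \<noteq> 0"
    and H: "finite H" "H \<subseteq> mpoly_ring r"
      "\<And>h. h \<in> H \<Longrightarrow> \<exists>n\<le>k. fps_nth (mpoly_eval fps_const h \<eta>) n \<noteq> 0"
  obtains a where "\<And>i. i \<in> \<Lambda> \<Longrightarrow> i < r \<Longrightarrow> mpoly_eval (\<lambda>c. c) (F i) a = 0"
    "\<And>h. h \<in> H \<Longrightarrow> mpoly_eval (\<lambda>c. c) h a \<noteq> 0"
proof -
  \<comment> \<open>Let e be the order of the separant of equation \<open>i\<close>, so e is at most
    \<open>k\<close>. The linear term in the own correction starts at order \<open>E i + e\<close>.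
    Corrections of earlier variables start at \<open>E i + k + 1\<close> or later, own quadratic
    terms at \<open>2 * E i\<close>, which is no less, and the truncation error at \<open>N\<close>,
    which exceeds \<open>E i + k\<close>. After division by the power \<open>E i + e\<close> only
    the linear term survives at s = 0.\<close>
  define N where "N = Suc r * Suc k"
  define E where "E v = (r - v) * Suc k" for v
  let ?x = "mpoly_var 0 :: 'k mpoly"
  let ?ev1 = "\<lambda>p :: 'k mpoly. mpoly_eval fps_const p (\<lambda>_. fps_X)"
  \<comment> \<open>Variable 0 stands for s and variable \<open>Suc v\<close> for the correction of
    coordinate \<open>v\<close>; \<open>y v\<close> is \<open>\<eta> v\<close> truncated below order
    \<open>N\<close>.\<close>
  define y where "y v = (\<Sum>j<N. mpoly_const (fps_nth (\<eta> v) j) * ?x ^ j)" for v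
  define Y where "Y v = y v + ?x ^ E v * mpoly_var (Suc v)" for v
  have E_ge: "Suc k \<le> E v" if "v < r" for v
    using mult_le_mono1[of 1 "r - v" "Suc k"] that by (simp add: E_def)
  have arith: "(Suc a + b) * Suc k = a * Suc k + Suc k + b * Suc k" for a b
    by (simp add: algebra_simps)
  note chom = mpoly_const_hom
  note fhom = mpoly_eval_hom[OF fps_const_hom]
  have y_ring: "y v \<in> mpoly_ring 1" for v
    unfolding y_def by (auto intro!: mpoly_ring_sum mpoly_ring_mult mpoly_ring_power)
  have Y_ring: "Y v \<in> mpoly_ring l" if "Suc v < l" for v l
    unfolding Y_def using that
    by (auto intro!: mpoly_ring_add mpoly_ring_mult mpoly_ring_power mpoly_ring_mono[OF y_ring])
  have ev_y: "fps_X ^ N dvd ?ev1 (y v) - \<eta> v" for v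
  proof -
    have "fps_nth (?ev1 (y v)) n = (if n < N then fps_nth (\<eta> v) n else 0)" for n
      by (simp add: y_def unital_ring_hom_sum[OF fhom] mpoly_eval_mult[OF fps_const_hom] fps_const_hom
          unital_ring_hom_power[OF fhom] fps_sum_nth if_distrib cong: if_cong)
    then show ?thesis by (simp add: fps_X_power_dvd_iff)
  qed
  have comp: "mpoly_eval fps_const (mpoly_eval mpoly_const p z) x = mpoly_eval fps_const p (\<lambda>v. mpoly_eval fps_const (z v) x)"
    for p :: "'k mpoly" and z x
    by (subst hom_mpoly_eval[OF chom fhom]) (simp add: fps_const_hom)
  have ev1: "fps_X ^ N dvd ?ev1 (mpoly_eval mpoly_const p y) - mpoly_eval fps_const p \<eta>" for p
    unfolding comp by (rule mpoly_ring_exhaust[of p], rule mpoly_eval_dvd_diff[OF fps_const_hom _ ev_y])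
  have ex: "\<exists>u w e. u \<noteq> 0 \<and> mpoly_const u * mpoly_var (Suc i) + ?x * w \<in> mpoly_ring (Suc (Suc i))
      \<and> (i \<in> \<Lambda> \<longrightarrow> mpoly_eval mpoly_const (F i) Y = ?x ^ e * (mpoly_const u * mpoly_var (Suc i) + ?x * w))"
    if i: "i < r" for i
  proof (cases "i \<in> \<Lambda>")
    case False
    \<comment> \<open>An index without equation receives the dummy equation that its correction is
      0, so that each of the \<open>r\<close> corrections has an equation of its own.\<close>
    then show ?thesis by (intro exI[of _ 1] exI[of _ 0]) auto
  next
    case True
    note Ei = E_ge[OF i]
    define G where "G = mpoly_eval mpoly_const (F i) Y"
    define s where "s = mpoly_eval mpoly_const (mpoly_pderiv i (F i)) y"
    define d where "d = ?x ^ E i * mpoly_var (Suc i)"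
    have r1: "mpoly_eval mpoly_const p y \<in> mpoly_ring 1" for p
      by (rule mpoly_ring_exhaust[of p], rule mpoly_eval_ring[OF _ y_ring])
    have "fps_X ^ N dvd ?ev1 (mpoly_eval mpoly_const (F i) y) - mpoly_eval fps_const (F i) \<eta>"
      by (rule ev1)
    then have "fps_X ^ N dvd ?ev1 (mpoly_eval mpoly_const (F i) y)"
      using F_\<eta>[OF True i] unfolding N_def by (metis dvd_add diff_add_cancel)
    then obtain c1 where c1: "mpoly_eval mpoly_const (F i) y = ?x ^ N * c1"
      using mpoly_ring_1_factor[OF r1] by metis
    obtain n where n: "n \<le> k" "fps_nth (mpoly_eval fps_const (mpoly_pderiv i (F i)) \<eta>) n \<noteq> 0"
      using sep[OF True i] by blast
    have "n < N" using n(1) by (simp add: N_def)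
    then have sn: "fps_nth (?ev1 s) n \<noteq> 0"
      using ev1[of "mpoly_pderiv i (F i)"] n(2) by (auto simp: fps_X_power_dvd_iff s_def)
    define e where "e = subdegree (?ev1 s)"
    have e: "e \<le> k" using subdegree_leI[OF sn] n(1) by (simp add: e_def)
    have "fps_X ^ e dvd ?ev1 s" by (auto simp: fps_X_power_dvd_iff e_def)
    then obtain c where c: "c \<in> mpoly_ring 1" "s = ?x ^ e * c"
      using mpoly_ring_1_factor[of s] r1 by (metis s_def)
    define u where "u = fps_nth (?ev1 c) 0"
    have "?ev1 s = fps_X ^ e * ?ev1 c"
      by (simp add: c(2) mpoly_eval_mult[OF fps_const_hom] unital_ring_hom_power[OF fhom] fps_const_hom)
    then have "fps_nth (?ev1 s) e = u" by (simp add: u_def fps_X_power_mult_nth)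
    then have u: "u \<noteq> 0" using sn by (auto simp: e_def)
    have "fps_X ^ 1 dvd ?ev1 (c - mpoly_const u)"
      unfolding fps_X_power_dvd_iff by (simp add: unital_ring_homD[OF fhom] fps_const_hom u_def)
    then obtain b where "c - mpoly_const u = ?x ^ 1 * b"
      using mpoly_ring_1_factor[of "c - mpoly_const u" 1] c(1) by (metis mpoly_ring_diff mpoly_ring_const)
    then have b: "c = mpoly_const u + ?x * b" by (simp add: algebra_simps)
    \<comment> \<open>Resetting the coordinates below \<open>i\<close> to their truncations changes
      only terms of this order, because their levels are higher by at least
      \<open>k + 1\<close>.\<close>
    have "?x ^ (E i + Suc k) dvd G - mpoly_eval mpoly_const (F i) (y(i := y i + d))"
      unfolding G_def
    proof (rule mpoly_eval_dvd_diff[OF chom F[OF True i]])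
      fix v assume v: "v < Suc i"
      show "?x ^ (E i + Suc k) dvd Y v - (y(i := y i + d)) v"
      proof (cases "v = i")
        case False
        have rv: "r - v = Suc (r - i) + (i - Suc v)" using v False i by simp
        have "E v = E i + Suc k + (i - Suc v) * Suc k"
          unfolding E_def rv by (rule arith)
        then show ?thesis using False by (simp add: Y_def power_add mult.assoc)
      qed (simp add: Y_def d_def)
    qed
    then obtain c2 where c2: "G = mpoly_eval mpoly_const (F i) (y(i := y i + d)) + ?x ^ (E i + Suc k) * c2"
      by (metis dvdE diff_add_cancel add.commute)
    obtain c3 where c3: "mpoly_eval mpoly_const (F i) (y(i := y i + d)) = ?x ^ N * c1 + s * d + d\<^sup>2 * c3"
      using mpoly_eval_taylor[OF chom, of "F i" y i d] c1 s_def by auto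
    \<comment> \<open>Each splitting leaves at least one spare factor s; \<open>w\<close> below
      collects the quotients by that factor.\<close>
    have "N = E i + e + Suc (N - E i - e - 1)" "E i + E i = E i + e + Suc (E i - e - 1)"
      "E i + Suc k = E i + e + Suc (k - e)"
    proof -
      have "E i + k < N"
        using mult_le_mono1[of "r - i" r "Suc k"] unfolding E_def N_def by simp
      then show "N = E i + e + Suc (N - E i - e - 1)" using e by simp
      show "E i + E i = E i + e + Suc (E i - e - 1)" using e Ei by simp
      show "E i + Suc k = E i + e + Suc (k - e)" using e by simp
    qed
    then obtain n1 n2 n3 where n: "N = E i + e + Suc n1" "E i + E i = E i + e + Suc n2" "E i + Suc k = E i + e + Suc n3"
      by blast
    define w where "w = ?x ^ n1 * c1 + b * mpoly_var (Suc i) + ?x ^ n2 * (mpoly_var (Suc i))\<^sup>2 * c3 + ?x ^ n3 * c2"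
    have "d\<^sup>2 = ?x ^ (E i + E i) * (mpoly_var (Suc i))\<^sup>2"
      by (simp add: d_def power_add power_mult_distrib power2_eq_square)
    then have "G = ?x ^ (E i + e) * (mpoly_const u * mpoly_var (Suc i) + ?x * w)"
      unfolding c2 c3 unfolding n by (simp add: c(2) b d_def w_def power_add algebra_simps)
    moreover have "G \<in> mpoly_ring (Suc (Suc i))"
      unfolding G_def by (rule mpoly_eval_ring[OF F[OF True i]]) (auto intro: Y_ring)
    ultimately show ?thesis using u mpoly_ring_var_power_cancel unfolding G_def by metis
  qed
  then obtain u w e where uw: "\<And>i. i < r \<Longrightarrow> u i \<noteq> 0"
    "\<And>i. i < r \<Longrightarrow> mpoly_const (u i) * mpoly_var (Suc i) + ?x * w i \<in> mpoly_ring (Suc (Suc i))"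
    "\<And>i. i < r \<Longrightarrow> i \<in> \<Lambda> \<Longrightarrow> mpoly_eval mpoly_const (F i) Y = ?x ^ e i * (mpoly_const (u i) * mpoly_var (Suc i) + ?x * w i)"
    by metis
  define g where "g i = mpoly_const (u i) * mpoly_var (Suc i) + ?x * w i" for i
  obtain \<zeta> :: "nat \<Rightarrow> 'k fps" where \<zeta>:
    "\<And>p. p \<in> mpoly_ring (Suc r) \<Longrightarrow> mpoly_eval fps_const p (case_nat fps_X \<zeta>) \<noteq> 0 \<Longrightarrow>
       \<exists>b. (\<forall>i<r. mpoly_eval (\<lambda>c. c) (g i) b = 0) \<and> mpoly_eval (\<lambda>c. c) p b \<noteq> 0"
    using large_field_curve_points[OF large, of r u g w] uw(1,2) unfolding g_def by blast
  let ?z = "case_nat fps_X \<zeta>"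
  define p where "p = (\<Prod>h\<in>H. mpoly_eval mpoly_const h Y)"
  have "p \<in> mpoly_ring (Suc r)"
    unfolding p_def using H(2) by (auto intro!: mpoly_ring_prod mpoly_eval_ring[of _ r] Y_ring)
  moreover have "mpoly_eval fps_const p ?z \<noteq> 0"
  proof -
    \<comment> \<open>Whatever \<open>\<zeta>\<close> is, the corrected point agrees with
      \<open>\<eta>\<close> modulo the power k + 1 of s. Elements of \<open>H\<close> have order at
      most \<open>k\<close> along \<open>\<eta>\<close> and so stay nonzero.\<close>
    have Yz: "fps_X ^ Suc k dvd mpoly_eval fps_const (Y v) ?z - \<eta> v" if "v < r" for v
    proof -
      have "mpoly_eval fps_const (y v) ?z = ?ev1 (y v)"
        by (rule mpoly_eval_cong[OF y_ring]) simp
      then have "mpoly_eval fps_const (Y v) ?z - \<eta> v = (?ev1 (y v) - \<eta> v) + fps_X ^ E v * \<zeta> v"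
        by (simp add: Y_def mpoly_eval_add mpoly_eval_mult fps_const_hom unital_ring_hom_power[OF fhom])
      moreover have "fps_X ^ Suc k dvd ?ev1 (y v) - \<eta> v"
        using ev_y[of v] by (rule dvd_trans[rotated]) (simp add: N_def le_imp_power_dvd del: power_Suc)
      moreover have "(fps_X :: 'k fps) ^ Suc k dvd fps_X ^ E v"
        using E_ge[OF that] by (rule le_imp_power_dvd)
      ultimately show ?thesis by (metis dvd_add dvd_mult2)
    qed
    have "mpoly_eval fps_const (mpoly_eval mpoly_const h Y) ?z \<noteq> 0" if h: "h \<in> H" for h
    proof -
      obtain n where n: "n \<le> k" "fps_nth (mpoly_eval fps_const h \<eta>) n \<noteq> 0" using H(3)[OF h] by blast
      have "fps_X ^ Suc k dvd mpoly_eval fps_const (mpoly_eval mpoly_const h Y) ?z - mpoly_eval fps_const h \<eta>"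
        unfolding comp by (rule mpoly_eval_dvd_diff[OF fps_const_hom _ Yz]) (use h H(2) in auto)
      then have "fps_nth (mpoly_eval fps_const (mpoly_eval mpoly_const h Y) ?z - mpoly_eval fps_const h \<eta>) n = 0"
        using n(1) unfolding fps_X_power_dvd_iff by simp
      then show ?thesis using n(2) by auto
    qed
    then show ?thesis using H(1) by (simp add: p_def unital_ring_hom_prod[OF fhom])
  qed
  ultimately obtain b where b: "\<And>i. i < r \<Longrightarrow> mpoly_eval (\<lambda>c. c) (g i) b = 0" "mpoly_eval (\<lambda>c. c) p b \<noteq> 0"
    using \<zeta> by blast
  note ihom = mpoly_eval_hom[OF unital_ring_hom_id]
  have comp': "mpoly_eval (\<lambda>c. c) (mpoly_eval mpoly_const p Y) b
      = mpoly_eval (\<lambda>c. c) p (\<lambda>v. mpoly_eval (\<lambda>c. c) (Y v) b)" for p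
    by (subst hom_mpoly_eval[OF chom ihom]) (simp add: unital_ring_hom_id)
  show ?thesis
  proof (rule that[of "\<lambda>v. mpoly_eval (\<lambda>c. c) (Y v) b"])
    show "mpoly_eval (\<lambda>c. c) (F i) (\<lambda>v. mpoly_eval (\<lambda>c. c) (Y v) b) = 0" if "i \<in> \<Lambda>" "i < r" for i
      unfolding comp'[symmetric] using uw(3)[OF that(2,1)] b(1)[OF that(2)]
      by (simp add: g_def mpoly_eval_mult unital_ring_hom_id)
    show "mpoly_eval (\<lambda>c. c) h (\<lambda>v. mpoly_eval (\<lambda>c. c) (Y v) b) \<noteq> 0" if "h \<in> H" for h
      unfolding comp'[symmetric] using b(2) H(1) that by (auto simp: p_def unital_ring_hom_prod[OF ihom])
  qed
qed

subsection \<open>Differential ideals and characteristic sets\<close>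

lemma derivation_poly:
  fixes p :: "'a::idom poly"
  assumes d: "derivation d" and "\<And>i. d (coeff p i) = 0"
  shows "d (poly p x) = poly (pderiv p) x * d x"
  using assms(2)
proof (induction p)
  case (pCons a p)
  have "d a = 0" using pCons.prems[of 0] by simp
  moreover have "d (poly p x) = poly (pderiv p) x * d x"
    using pCons.IH pCons.prems[of "Suc i" for i] by simp
  ultimately show ?case by (simp add: derivationD[OF d] pderiv_pCons algebra_simps)
qed (simp add: derivationD[OF d])

text \<open>Course-of-values recursion: stage \<open>n\<close> of the table fixes the value at
  \<open>n\<close> and leaves the lower entries alone.\<close>

lemma nat_recursion_exists:
  fixes \<Phi> :: "(nat \<Rightarrow> 'a::zero) \<Rightarrow> nat \<Rightarrow> 'a"
  assumes "\<And>f g w. (\<And>v. v < w \<Longrightarrow> f v = g v) \<Longrightarrow> \<Phi> f w = \<Phi> g w"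
  obtains a where "\<And>w. a w = \<Phi> a w"
proof -
  define A where "A = rec_nat (\<lambda>_. 0) (\<lambda>n f. f(n := \<Phi> f n))"
  have A: "A (Suc n) = (A n)(n := \<Phi> (A n) n)" for n by (simp add: A_def)
  have stable: "A n v = A (Suc v) v" if "v < n" for n v
    using that by (induction n) (auto simp: A less_Suc_eq)
  have "A (Suc w) w = \<Phi> (\<lambda>v. A (Suc v) v) w" for w
  proof -
    have "A (Suc w) w = \<Phi> (A w) w" by (simp add: A)
    also have "\<dots> = \<Phi> (\<lambda>v. A (Suc v) v) w" by (rule assms) (rule stable)
    finally show ?thesis .
  qed
  then show ?thesis using that[of "\<lambda>v. A (Suc v) v"] by blast
qed

lemma mpoly_eval_self: "mpoly_eval mpoly_const p mpoly_var = p"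
  using mpoly_hom_eq_eval[of "\<lambda>p. p" p] by (simp add: unital_ring_hom_id)

text \<open>The derivations act on the variables \<open>x\<^sub>v\<close>, \<open>v \<in> V\<close>, through the increasing maps \<open>\<sigma> i\<close>; the
  remaining variables are dummies.\<close>

locale diff_ideal =
  fixes m :: nat and \<delta> :: "nat \<Rightarrow> 'k::field_char_0 \<Rightarrow> 'k" and V :: "nat set"
    and \<sigma> :: "nat \<Rightarrow> nat \<Rightarrow> nat" and Q :: "'k mpoly set"
  assumes \<delta>: "i < m \<Longrightarrow> derivation (\<delta> i)"
    and \<sigma>_V: "i < m \<Longrightarrow> v \<in> V \<Longrightarrow> \<sigma> i v \<in> V"
    and \<sigma>_mono: "i < m \<Longrightarrow> v \<in> V \<Longrightarrow> w \<in> V \<Longrightarrow> v < w \<Longrightarrow> \<sigma> i v < \<sigma> i w"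
    and \<sigma>_gt: "i < m \<Longrightarrow> v \<in> V \<Longrightarrow> v < \<sigma> i v"
    and dickson: "U \<subseteq> V \<Longrightarrow> \<exists>M\<subseteq>U. finite M \<and> (\<forall>u\<in>U. \<exists>v\<in>M. \<exists>ws. set ws \<subseteq> {..<m} \<and> u = fold \<sigma> ws v)"
    and Q_0: "0 \<in> Q" and Q_add: "f \<in> Q \<Longrightarrow> g \<in> Q \<Longrightarrow> f + g \<in> Q"
    and Q_mult: "f \<in> Q \<Longrightarrow> g * f \<in> Q"
    and Q_const: "mpoly_const c \<in> Q \<Longrightarrow> c = 0"
    and Q_dummy: "v \<notin> V \<Longrightarrow> mpoly_var v \<in> Q"
    and Q_deriv: "i < m \<Longrightarrow> f \<in> Q \<Longrightarrow>
      mpoly_deriv (\<delta> i) (\<lambda>v. if v \<in> V then mpoly_var (\<sigma> i v) else 0) f \<in> Q"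
begin

abbreviation deriv_map :: "nat \<Rightarrow> 'k mpoly \<Rightarrow> 'k mpoly" where
  "deriv_map i \<equiv> mpoly_deriv (\<delta> i) (\<lambda>v. if v \<in> V then mpoly_var (\<sigma> i v) else 0)"

lemma Q_mult': "f \<in> Q \<Longrightarrow> f * g \<in> Q"
  using Q_mult[of f g] by (simp add: mult.commute)

lemma Q_diff: "f \<in> Q \<Longrightarrow> g \<in> Q \<Longrightarrow> f - g \<in> Q"
  using Q_add[of f "- g"] Q_mult[of g "- 1"] by simp

lemma Q_1: "1 \<notin> Q"
  using Q_const[of 1] unital_ring_homD(1)[OF mpoly_const_hom] by (metis one_neq_zero)

lemma Q_of_nat_mult: "of_nat (Suc n) * f \<in> Q \<Longrightarrow> f \<in> Q"
proof -
  assume *: "of_nat (Suc n) * f \<in> Q"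
  have "mpoly_const (1 / of_nat (Suc n)) * of_nat (Suc n) = (1 :: 'k mpoly)"
  proof -
    have "(of_nat (Suc n) :: 'k mpoly) = mpoly_const (of_nat (Suc n))"
      unfolding mpoly_const_def single_of_nat ..
    then show ?thesis
      by (simp add: unital_ring_homD[OF mpoly_const_hom] del: of_nat_Suc flip: unital_ring_homD(3)[OF mpoly_const_hom])
  qed
  then have "f = mpoly_const (1 / of_nat (Suc n)) * (of_nat (Suc n) * f)" by (simp flip: mult.assoc)
  then show "f \<in> Q" using Q_mult[OF *] by metis
qed

definition polys :: "nat \<Rightarrow> 'k mpoly poly set" where
  "polys w = {p. \<forall>i. coeff p i \<in> mpoly_ring w}"

text \<open>Here \<open>lead_coeff p\<close> is the initial of an equation with leader number
  \<open>w\<close>; its exclusion from \<open>Q\<close> makes the equation a genuine constraint on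
  this variable over the earlier ones.\<close>

definition leader_poly :: "nat \<Rightarrow> 'k mpoly poly \<Rightarrow> bool" where
  "leader_poly w p \<longleftrightarrow> p \<in> polys w \<and> 0 < degree p \<and> lead_coeff p \<notin> Q \<and> poly p (mpoly_var w) \<in> Q"

text \<open>Plays the part of the member of a characteristic set with this leader. Least degree
  makes pseudo-division work and keeps the separant outside \<open>Q\<close>.\<close>

definition minimal_leader_poly :: "nat \<Rightarrow> 'k mpoly poly \<Rightarrow> bool" where
  "minimal_leader_poly w p \<longleftrightarrow> leader_poly w p \<and> (\<forall>p'. leader_poly w p' \<longrightarrow> degree p \<le> degree p')"

lemma minimal_leader_poly_exists: "leader_poly w p \<Longrightarrow> \<exists>p. minimal_leader_poly w p"
  unfolding minimal_leader_poly_def using ex_has_least_nat[of "leader_poly w" p degree] by blast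

lemma poly_polys_ring: "p \<in> polys w \<Longrightarrow> poly p (mpoly_var w) \<in> mpoly_ring (Suc w)"
  unfolding polys_def poly_altdef
  by (auto intro!: mpoly_ring_sum mpoly_ring_mult mpoly_ring_power intro: mpoly_ring_mono)

lemma polys_exists:
  assumes "f \<in> mpoly_ring (Suc w)"
  obtains p where "p \<in> polys w" "poly p (mpoly_var w) = f"
proof
  show "poly_in_var mpoly_const mpoly_var w f \<in> polys w"
    using coeff_poly_in_var[OF mpoly_const_hom, of mpoly_var w f] by (auto simp: polys_def mpoly_eval_self)
  show "poly (poly_in_var mpoly_const mpoly_var w f) (mpoly_var w) = f"
    by (simp add: poly_poly_in_var[OF mpoly_const_hom assms] mpoly_eval_self)
qed

text \<open>Pseudo-division: the top coefficient of a polynomial either lies in \<open>Q\<close> and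
  is dropped, or makes the polynomial itself a leader equation, hence of degree at least that of a
  minimal one, and one reduction step lowers it. The premise \<open>lead\<close> leaves the choice
  of the minimal equation open, so that linear derived equations can serve too.\<close>

lemma eval_kills_step:
  assumes \<Psi>: "unital_ring_hom (\<Psi> :: 'k mpoly \<Rightarrow> 'k)"
    and IH: "\<And>f. f \<in> Q \<Longrightarrow> f \<in> mpoly_ring w \<Longrightarrow> \<Psi> f = 0"
    and lead: "\<And>p. leader_poly w p \<Longrightarrow>
      \<exists>p. minimal_leader_poly w p \<and> \<Psi> (poly p (mpoly_var w)) = 0 \<and> \<Psi> (lead_coeff p) \<noteq> 0"
    and f: "f \<in> Q" "f \<in> mpoly_ring (Suc w)"
  shows "\<Psi> f = 0"
proof -
  note \<Psi>s = unital_ring_homD[OF \<Psi>]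
  let ?x = "mpoly_var w"
  have "\<Psi> (poly p ?x) = 0"
    if "p \<in> polys w" "poly p ?x \<in> Q" "\<And>i. i \<ge> n \<Longrightarrow> coeff p i = 0" for p n
    using that
  proof (induction n arbitrary: p)
    case 0
    then have "p = 0" by (intro poly_eqI) simp
    then show ?case by (simp add: \<Psi>s)
  next
    case (Suc n)
    define c where "c = coeff p n"
    have c: "c \<in> mpoly_ring w" using Suc.prems(1) by (simp add: c_def polys_def)
    show ?case
    proof (cases "c \<in> Q")
      case True
      let ?p = "p - monom c n"
      have "\<Psi> (poly ?p ?x) = 0"
      proof (rule Suc.IH)
        show "?p \<in> polys w" using Suc.prems(1) c by (auto simp: polys_def)
        show "poly ?p ?x \<in> Q" using Suc.prems(2) True by (simp add: poly_monom Q_diff Q_mult')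
        show "coeff ?p i = 0" if "i \<ge> n" for i
          using that Suc.prems(3)[of i] by (cases "i = n") (auto simp: c_def)
      qed
      then show ?thesis using IH[OF True c] by (simp add: poly_monom \<Psi>s)
    next
      case False
      then have "c \<noteq> 0" using Q_0 by auto
      have deg: "degree p = n"
      proof (rule antisym)
        show "degree p \<le> n" by (rule degree_le) (use Suc.prems(3) in auto)
        show "n \<le> degree p" using \<open>c \<noteq> 0\<close> by (auto simp: c_def intro: le_degree)
      qed
      have "n \<noteq> 0"
      proof
        assume "n = 0"
        then have "poly p ?x = c" using deg by (auto simp: c_def elim: degree_eq_zeroE)
        then show False using False Suc.prems(2) by simp
      qed
      then have lp: "leader_poly w p"
        using Suc.prems False deg by (simp add: leader_poly_def c_def)
      then obtain F where F: "minimal_leader_poly w F" "\<Psi> (poly F ?x) = 0" "\<Psi> (lead_coeff F) \<noteq> 0"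
        using lead by blast
      have F': "F \<in> polys w" "poly F ?x \<in> Q" and dF: "degree F \<le> n"
        using F(1) lp deg by (auto simp: minimal_leader_poly_def leader_poly_def)
      \<comment> \<open>Both terms have coefficient \<open>lead_coeff F * c\<close> in degree
        \<open>n\<close>, which cancels. Nothing is lost under \<open>\<Psi>\<close>, where
        \<open>lead_coeff F\<close> has a nonzero value.\<close>
      define p' where "p' = smult (lead_coeff F) p - monom c (n - degree F) * F"
      have "\<Psi> (poly p' ?x) = 0"
      proof (rule Suc.IH)
        show "p' \<in> polys w" using Suc.prems(1) F'(1) c
          by (auto simp: p'_def polys_def coeff_monom_mult)
        show "poly p' ?x \<in> Q" using Suc.prems(2) F'(2)
          by (simp add: p'_def poly_monom Q_diff Q_mult)
        show "coeff p' i = 0" if "i \<ge> n" for i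
        proof (cases "i = n")
          case True
          then show ?thesis using dF by (simp add: p'_def coeff_monom_mult c_def)
        next
          case False
          then have "coeff p i = 0" "coeff F (i - (n - degree F)) = 0"
            using that Suc.prems(3) dF by (auto intro: coeff_eq_0)
          then show ?thesis by (simp add: p'_def coeff_monom_mult)
        qed
      qed
      then show ?thesis using F(2,3) by (simp add: p'_def \<Psi>s)
    qed
  qed
  moreover obtain p where "p \<in> polys w" "poly p ?x = f" using polys_exists[OF f(2)] by blast
  ultimately show ?thesis using f(1) coeff_eq_0[of p] by (metis Suc_le_lessD)
qed

text \<open>The leading coefficient of the derivative is a positive multiple of the initial, hence
  outside \<open>Q\<close>. A separant in \<open>Q\<close> would be a leader equation of smaller
  degree or, in degree 0, that coefficient itself.\<close>

lemma separant:
  assumes "minimal_leader_poly w p"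
  shows "poly (pderiv p) (mpoly_var w) \<notin> Q"
    and "poly (pderiv p) (mpoly_var w) = mpoly_pderiv w (poly p (mpoly_var w))"
proof -
  have p: "p \<in> polys w" "0 < degree p" "lead_coeff p \<notin> Q"
    and min: "\<And>p'. leader_poly w p' \<Longrightarrow> degree p \<le> degree p'"
    using assms by (auto simp: minimal_leader_poly_def leader_poly_def)
  have dp: "degree (pderiv p) = degree p - 1" by (rule degree_pderiv)
  have lc: "lead_coeff (pderiv p) \<notin> Q"
  proof
    assume "lead_coeff (pderiv p) \<in> Q"
    then have "of_nat (Suc (degree p - 1)) * lead_coeff p \<in> Q"
      using p(2) by (simp add: dp coeff_pderiv)
    then show False using Q_of_nat_mult p(3) by blast
  qed
  have pd: "pderiv p \<in> polys w" using p(1)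
    by (auto simp: polys_def coeff_pderiv intro!: mpoly_ring_mult)
      (metis mpoly_ring_const mpoly_const_def of_nat_Suc single_of_nat)
  show "poly (pderiv p) (mpoly_var w) \<notin> Q"
  proof
    assume *: "poly (pderiv p) (mpoly_var w) \<in> Q"
    show False
    proof (cases "degree (pderiv p) = 0")
      case True
      then have "poly (pderiv p) (mpoly_var w) = lead_coeff (pderiv p)"
        by (auto elim: degree_eq_zeroE)
      then show ?thesis using * lc by simp
    next
      case False
      then have "leader_poly w (pderiv p)" using * lc pd by (simp add: leader_poly_def)
      then show ?thesis using min[of "pderiv p"] p(2) dp by simp
    qed
  qed
  show "poly (pderiv p) (mpoly_var w) = mpoly_pderiv w (poly p (mpoly_var w))"
    using derivation_poly[OF mpoly_pderiv_derivation mpoly_pderiv_eq_0[OF _ order_refl], of p w "mpoly_var w"] p(1)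
    by (simp add: mpoly_pderiv_var polys_def)
qed

lemma deriv_map_ring:
  assumes "i < m" "w \<in> V" "f \<in> mpoly_ring w"
  shows "deriv_map i f \<in> mpoly_ring (\<sigma> i w)"
proof -
  have *: "g \<in> mpoly_ring w \<Longrightarrow> g \<in> mpoly_ring (\<sigma> i w)" for g
    by (erule mpoly_ring_mono) (use \<sigma>_gt[OF assms(1,2)] in simp)
  show ?thesis
    unfolding mpoly_deriv_eq[OF assms(3)]
    by (intro mpoly_ring_add mpoly_ring_sum mpoly_ring_mult *[OF mpoly_deriv_map_ring]
        *[OF mpoly_pderiv_ring] assms(3)) (use \<sigma>_mono[OF assms(1) _ assms(2)] in auto)
qed

text \<open>The condition \<open>ws \<noteq> []\<close> matters: only proper derivatives are linear
  in their leader. Monotonicity of the \<open>\<sigma> i\<close> puts the other derived variables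
  below the new leader; from the second derivation on, the derivative of the separant multiplies the
  old leader and is absorbed in \<open>g\<close>.\<close>

lemma derived_leader:
  assumes u: "u \<in> V" and F: "F \<in> Q" "F \<in> mpoly_ring (Suc u)" and ws: "set ws \<subseteq> {..<m}" "ws \<noteq> []"
  shows "\<exists>g. g \<in> mpoly_ring (fold \<sigma> ws u) \<and> mpoly_pderiv u F \<in> mpoly_ring (fold \<sigma> ws u)
    \<and> mpoly_pderiv u F * mpoly_var (fold \<sigma> ws u) + g \<in> Q"
  using ws
proof (induction ws rule: rev_induct)
  case (snoc i ws)
  define w where "w = fold \<sigma> ws u"
  have i: "i < m" using snoc.prems by simp
  have "set ws \<subseteq> {..<m}" using snoc.prems by simp
  then have wV: "w \<in> V" unfolding w_def
    by (induction ws rule: rev_induct) (use u \<sigma>_V in auto)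
  let ?s = "mpoly_pderiv u F"
  show ?case
  proof (cases "ws = []")
    case True
    have w: "fold \<sigma> (ws @ [i]) u = \<sigma> i u" using True by simp
    have gt: "Suc u \<le> \<sigma> i u" using \<sigma>_gt[OF i u] by simp
    define g where "g = Poly_Mapping.map (\<delta> i) F
      + (\<Sum>v<u. mpoly_pderiv v F * (if v \<in> V then mpoly_var (\<sigma> i v) else 0))"
    have "deriv_map i F = ?s * mpoly_var (\<sigma> i u) + g"
      using u by (simp add: mpoly_deriv_eq[OF F(2)] g_def)
    moreover have "g \<in> mpoly_ring (\<sigma> i u)" unfolding g_def
      by (intro mpoly_ring_add mpoly_ring_sum mpoly_ring_mult mpoly_ring_mono[OF mpoly_deriv_map_ring gt]
          mpoly_ring_mono[OF mpoly_pderiv_ring gt] F(2)) (use \<sigma>_mono[OF i _ u] in auto)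
    moreover have "?s \<in> mpoly_ring (\<sigma> i u)"
      using mpoly_ring_mono[OF mpoly_pderiv_ring[OF F(2)] gt] .
    ultimately show ?thesis using Q_deriv[OF i F(1)] unfolding w by auto
  next
    case False
    then obtain g where g: "g \<in> mpoly_ring w" "?s \<in> mpoly_ring w" "?s * mpoly_var w + g \<in> Q"
      using snoc.IH \<open>set ws \<subseteq> {..<m}\<close> unfolding w_def by blast
    have w: "fold \<sigma> (ws @ [i]) u = \<sigma> i w" by (simp add: w_def)
    define g' where "g' = deriv_map i ?s * mpoly_var w + deriv_map i g"
    have "deriv_map i (?s * mpoly_var w + g) = ?s * mpoly_var (\<sigma> i w) + g'"
      using wV by (simp add: derivationD[OF mpoly_deriv_derivation[OF \<delta>[OF i]]]
          mpoly_deriv_var[OF \<delta>[OF i]] g'_def)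
    moreover have "g' \<in> mpoly_ring (\<sigma> i w)" unfolding g'_def
      using \<sigma>_gt[OF i wV] by (auto intro!: mpoly_ring_add mpoly_ring_mult deriv_map_ring i wV g)
    moreover have "?s \<in> mpoly_ring (\<sigma> i w)"
      using \<sigma>_gt[OF i wV] by (intro mpoly_ring_mono[OF g(2)]) simp
    ultimately show ?thesis using Q_deriv[OF i g(3)] unfolding w by auto
  qed
qed simp

theorem finite_characteristic_system:
  obtains r \<Lambda> and F :: "nat \<Rightarrow> 'k mpoly" and H :: "'k mpoly set" where
    "finite H" "H \<subseteq> mpoly_ring r" "H \<inter> Q = {}"
    "\<And>i. i \<in> \<Lambda> \<Longrightarrow> i < r \<Longrightarrow> F i \<in> Q" "\<And>i. i \<in> \<Lambda> \<Longrightarrow> i < r \<Longrightarrow> F i \<in> mpoly_ring (Suc i)"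
    "\<And>i. i \<in> \<Lambda> \<Longrightarrow> i < r \<Longrightarrow> mpoly_pderiv i (F i) \<in> H"
    "\<forall>a0. (\<forall>i\<in>\<Lambda>. i < r \<longrightarrow> mpoly_eval (\<lambda>c. c) (F i) a0 = 0) \<longrightarrow>
       (\<forall>h\<in>H. mpoly_eval (\<lambda>c. c) h a0 \<noteq> 0) \<longrightarrow>
       (\<exists>a. \<forall>f\<in>Q. mpoly_eval (\<lambda>c. c) f a = 0)"
proof -
  define \<Lambda> where "\<Lambda> = {w. \<exists>p. leader_poly w p}"
  define p where "p w = (SOME p. minimal_leader_poly w p)" for w
  have p: "minimal_leader_poly w (p w)" if "w \<in> \<Lambda>" for w
    using that minimal_leader_poly_exists unfolding p_def \<Lambda>_def by (metis (mono_tags) mem_Collect_eq someI_ex)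
  define F where "F w = poly (p w) (mpoly_var w)" for w
  have p_polys: "p w \<in> polys w" and FQ: "F w \<in> Q" and lcQ: "lead_coeff (p w) \<notin> Q" if "w \<in> \<Lambda>" for w
    using p[OF that] by (auto simp: minimal_leader_poly_def leader_poly_def F_def)
  have F_ring: "F w \<in> mpoly_ring (Suc w)" if "w \<in> \<Lambda>" for w
    unfolding F_def by (rule poly_polys_ring[OF p_polys[OF that]])
  have lc_ring: "lead_coeff (p w) \<in> mpoly_ring w" if "w \<in> \<Lambda>" for w
    using p_polys[OF that] by (simp add: polys_def)
  have sepQ: "mpoly_pderiv w (F w) \<notin> Q" if "w \<in> \<Lambda>" for w
    using separant[OF p[OF that]] by (simp add: F_def)
  \<comment> \<open>All leaders in \<open>V\<close> are derivatives of those in \<open>M\<close>, so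
    nonlinear equations are kept only below a bound \<open>r\<close> for \<open>M\<close>.\<close>
  obtain M where M: "M \<subseteq> \<Lambda> \<inter> V" "finite M"
    and M_cover: "\<forall>u\<in>\<Lambda> \<inter> V. \<exists>v\<in>M. \<exists>ws. set ws \<subseteq> {..<m} \<and> u = fold \<sigma> ws v"
    using dickson[OF Int_lower2[of \<Lambda> V]] by (elim exE conjE) (rule that)
  obtain r where "\<forall>v\<in>M. v < r"
    using M(2) unfolding finite_nat_set_iff_bounded by (elim exE) (rule that)
  note r = bspec[OF this]
  define H where "H = (\<lambda>w. lead_coeff (p w)) ` (\<Lambda> \<inter> {..<r}) \<union> (\<lambda>w. mpoly_pderiv w (F w)) ` (\<Lambda> \<inter> {..<r})"
  \<comment> \<open>A leader from \<open>r\<close> on lies beyond \<open>M\<close>, so it is a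
    proper derivative of an element of \<open>M\<close>, and the separant in its linear equation
    belongs to \<open>H\<close>.\<close>
  have lin: "\<exists>g s. s \<in> H \<and> s \<in> mpoly_ring w \<and> s \<notin> Q \<and> g \<in> mpoly_ring w \<and> s * mpoly_var w + g \<in> Q"
    if w: "w \<in> \<Lambda> \<inter> V" "r \<le> w" for w
  proof -
    obtain v ws where v: "v \<in> M" "set ws \<subseteq> {..<m}" "w = fold \<sigma> ws v"
      using bspec[OF M_cover w(1)] by (elim bexE exE conjE) (rule that)
    have "ws \<noteq> []" using v r[OF v(1)] w(2) by auto
    have "v \<in> \<Lambda>" "v \<in> V" using M(1) v(1) by auto
    then have "\<exists>g. g \<in> mpoly_ring w \<and> mpoly_pderiv v (F v) \<in> mpoly_ring w \<and> mpoly_pderiv v (F v) * mpoly_var w + g \<in> Q"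
      unfolding v(3) by (intro derived_leader FQ F_ring v(2) \<open>ws \<noteq> []\<close>)
    moreover have "mpoly_pderiv v (F v) \<in> H" using \<open>v \<in> \<Lambda>\<close> r[OF v(1)] by (auto simp: H_def)
    ultimately show ?thesis using sepQ[OF \<open>v \<in> \<Lambda>\<close>] by blast
  qed
  then obtain g s where gs: "\<And>w. w \<in> \<Lambda> \<inter> V \<Longrightarrow> r \<le> w \<Longrightarrow> s w \<in> H \<and> s w \<in> mpoly_ring w \<and> s w \<notin> Q
      \<and> g w \<in> mpoly_ring w \<and> s w * mpoly_var w + g w \<in> Q"
    by metis
  let ?ev = "mpoly_eval (\<lambda>c::'k. c)"
  have H_ring: "H \<subseteq> mpoly_ring r"
    unfolding H_def by (auto intro: mpoly_ring_mono[OF lc_ring] mpoly_ring_mono[OF mpoly_pderiv_ring[OF F_ring]])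
  show ?thesis
  proof (rule that[of H r \<Lambda> F])
    show "finite H" by (simp add: H_def)
    show "H \<subseteq> mpoly_ring r" by (rule H_ring)
    show "H \<inter> Q = {}" using lcQ sepQ by (auto simp: H_def)
    show "F i \<in> Q" "F i \<in> mpoly_ring (Suc i)" if "i \<in> \<Lambda>" for i using FQ F_ring that by auto
    show "mpoly_pderiv i (F i) \<in> H" if "i \<in> \<Lambda>" "i < r" for i using that by (auto simp: H_def)
  next
    have "\<exists>a. \<forall>f\<in>Q. ?ev f a = 0"
      if a0: "\<forall>i\<in>\<Lambda>. i < r \<longrightarrow> ?ev (F i) a0 = 0" "\<forall>h\<in>H. ?ev h a0 \<noteq> 0" for a0
    proof -
    \<comment> \<open>The point is extended one variable at a time. Leaders in \<open>V\<close> are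
      solved for from their linear equations; the others get 0, a free choice for non-leaders and
      forced for dummies, which lie in \<open>Q\<close>.\<close>
    define \<Phi> where "\<Phi> a w = (if w < r then a0 w else if w \<in> \<Lambda> \<inter> V then - (?ev (g w) a / ?ev (s w) a) else 0)"
      for a w
    have "\<Phi> a w = \<Phi> b w" if "\<And>v. v < w \<Longrightarrow> a v = b v" for a b w
      using mpoly_eval_cong[of "g w" w a b] mpoly_eval_cong[of "s w" w a b] gs[of w] that
      by (auto simp: \<Phi>_def)
    then obtain a where a: "\<And>w. a w = \<Phi> a w" using nat_recursion_exists[of \<Phi>] by blast
    have a_r: "w < r \<Longrightarrow> a w = a0 w" for w using a[of w] by (simp add: \<Phi>_def)
    have ev_H: "?ev h a \<noteq> 0" if "h \<in> H" for h
      using bspec[OF a0(2) that] mpoly_eval_cong[of h r a a0] H_ring that a_r by auto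
    have hom: "unital_ring_hom (\<lambda>f. ?ev f a)" by (rule mpoly_eval_hom[OF unital_ring_hom_id])
    have kills: "?ev f a = 0" if "f \<in> Q" "f \<in> mpoly_ring w" for f w
      using that
    proof (induction w arbitrary: f)
      case 0
      have "\<exists>c. f = mpoly_const c" using 0(2)
        by (induction f rule: mpoly_ring_induct)
          (auto simp flip: unital_ring_homD[OF mpoly_const_hom])
      then show ?case using Q_const 0(1) by (auto simp: unital_ring_hom_id)
    next
      case (Suc w)
      \<comment> \<open>Leader equations have positive degree, so one of degree 1 is automatically
        minimal.\<close>
      have lin_min: "minimal_leader_poly w [:c, b:]"
        if "b \<notin> Q" "b \<in> mpoly_ring w" "c \<in> mpoly_ring w" "b * mpoly_var w + c \<in> Q" for b c
        using that Q_0 unfolding minimal_leader_poly_def leader_poly_def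
        by (auto simp: polys_def coeff_pCons algebra_simps Suc_le_eq split: nat.splits)
      show ?case
      proof (rule eval_kills_step[OF hom Suc.IH _ Suc.prems])
        fix p0 assume "leader_poly w p0"
        then have w: "w \<in> \<Lambda>" by (auto simp: \<Lambda>_def)
        consider "w < r" | "r \<le> w" "w \<in> V" | "r \<le> w" "w \<notin> V" by linarith
        then show "\<exists>p. minimal_leader_poly w p \<and> ?ev (poly p (mpoly_var w)) a = 0 \<and> ?ev (lead_coeff p) a \<noteq> 0"
        proof cases
          case 1
          have "?ev (F w) a = ?ev (F w) a0"
            by (rule mpoly_eval_cong[OF F_ring[OF w]]) (use a_r 1 in simp)
          then have "?ev (F w) a = 0" using a0(1) w 1 by simp
          moreover have "lead_coeff (p w) \<in> H" using w 1 by (auto simp: H_def)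
          ultimately show ?thesis using p[OF w] ev_H by (auto simp: F_def)
        next
          case 2
          note gw = gs[of w, OF _ 2(1)]
          have "a w = - (?ev (g w) a / ?ev (s w) a)" using a[of w] 2 w by (simp add: \<Phi>_def)
          moreover have "?ev (s w) a \<noteq> 0" using ev_H gw w 2 by blast
          ultimately show ?thesis using gw w 2
            by (intro exI[of _ "[:g w, s w:]"] conjI lin_min)
              (auto simp: unital_ring_homD[OF hom] unital_ring_hom_id)
        next
          case 3
          have "a w = 0" using a[of w] 3 by (simp add: \<Phi>_def)
          then show ?thesis
            by (intro exI[of _ "[:0, 1:]"] conjI lin_min)
              (use Q_1 Q_dummy[OF 3(2)] in \<open>auto simp: unital_ring_homD[OF hom] unital_ring_hom_id\<close>)
        qed
      qed
    qed
    show ?thesis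
      using kills by (metis mpoly_ring_exhaust)
    qed
    then show "\<forall>a0. (\<forall>i\<in>\<Lambda>. i < r \<longrightarrow> ?ev (F i) a0 = 0) \<longrightarrow> (\<forall>h\<in>H. ?ev h a0 \<noteq> 0) \<longrightarrow>
      (\<exists>a. \<forall>f\<in>Q. ?ev f a = 0)" by blast
  qed
qed

end

subsection \<open>A generic direction\<close>

definition additive_map :: "('a::comm_ring_1 \<Rightarrow> 'b::comm_ring_1) \<Rightarrow> bool" where
  "additive_map d \<longleftrightarrow> (\<forall>x y. d (x + y) = d x + d y)"

lemma additive_mapD:
  assumes "additive_map d"
  shows "d (x + y) = d x + d y" "d 0 = 0" "d (of_nat n * x) = of_nat n * d x" "d (sum f A) = (\<Sum>a\<in>A. d (f a))"
proof -
  show add: "d (x + y) = d x + d y" for x y using assms by (simp add: additive_map_def)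
  show 0: "d 0 = 0" using add[of 0 0] by simp
  show "d (of_nat n * x) = of_nat n * d x"
    by (induction n) (simp_all add: 0 add distrib_right)
  show "d (sum f A) = (\<Sum>a\<in>A. d (f a))"
    by (induction A rule: infinite_finite_induct) (simp_all add: 0 add)
qed

text \<open>Binomial theorem for two commuting additive operators; the inductive step is Pascal's
  rule after shifting one of the sums.\<close>

lemma funpow_linear_combination:
  assumes E: "additive_map E" and F: "additive_map F" and comm: "\<And>x. E (F x) = F (E x)"
  shows "((\<lambda>x. E x + of_nat c * F x) ^^ k) x
    = (\<Sum>j\<le>k. of_nat (k choose j) * of_nat c ^ j * (E ^^ (k - j)) ((F ^^ j) x))"
proof (induction k)
  case (Suc k)
  let ?t = "\<lambda>i j. (E ^^ i) ((F ^^ j) x)"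
  have FE: "F ((E ^^ i) y) = (E ^^ i) (F y)" for i y
    by (induction i) (simp_all add: comm[symmetric])
  have lin: "G (\<Sum>j\<le>k. of_nat (k choose j) * of_nat c ^ j * f j) = (\<Sum>j\<le>k. of_nat (k choose j) * of_nat c ^ j * G (f j))"
    if "additive_map G" for G :: "'a \<Rightarrow> 'a" and f
    using additive_mapD(3)[OF that, of "(k choose j) * c ^ j" "f j" for j]
    by (simp add: additive_mapD(4)[OF that])
  have "((\<lambda>x. E x + of_nat c * F x) ^^ Suc k) x
      = (\<Sum>j\<le>k. of_nat (k choose j) * of_nat c ^ j * ?t (Suc (k - j)) j)
      + of_nat c * (\<Sum>j\<le>k. of_nat (k choose j) * of_nat c ^ j * ?t (k - j) (Suc j))"
    by (simp add: Suc.IH lin[OF E] lin[OF F] FE)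
  also have "of_nat c * (\<Sum>j\<le>k. of_nat (k choose j) * of_nat c ^ j * ?t (k - j) (Suc j))
      = (\<Sum>j\<le>k. of_nat (k choose j) * of_nat c ^ Suc j * ?t (k - j) (Suc j))"
    by (simp add: sum_distrib_left algebra_simps)
  also have "\<dots> = (\<Sum>j\<in>{1..Suc k}. of_nat (k choose (j - 1)) * of_nat c ^ j * ?t (Suc k - j) j)"
    by (rule sum.reindex_bij_witness[of _ "\<lambda>j. j - 1" Suc]) auto
  also have "\<dots> = (\<Sum>j\<le>Suc k. (if j = 0 then 0 else of_nat (k choose (j - 1))) * of_nat c ^ j * ?t (Suc k - j) j)"
    by (rule sum.mono_neutral_cong_left) (auto simp: not_le)
  also have "(\<Sum>j\<le>k. of_nat (k choose j) * of_nat c ^ j * ?t (Suc (k - j)) j)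
      = (\<Sum>j\<le>Suc k. of_nat (k choose j) * of_nat c ^ j * ?t (Suc k - j) j)"
    by (rule sum.mono_neutral_cong_left) (auto simp: Suc_diff_le le_Suc_eq binomial_eq_0)
  also have "(\<Sum>j\<le>Suc k. of_nat (k choose j) * of_nat c ^ j * ?t (Suc k - j) j)
      + (\<Sum>j\<le>Suc k. (if j = 0 then 0 else of_nat (k choose (j - 1))) * of_nat c ^ j * ?t (Suc k - j) j)
      = (\<Sum>j\<le>Suc k. of_nat (Suc k choose j) * of_nat c ^ j * ?t (Suc k - j) j)"
    unfolding sum.distrib[symmetric]
  proof (rule sum.cong[OF refl])
    fix j
    show "of_nat (k choose j) * of_nat c ^ j * ?t (Suc k - j) j
        + (if j = 0 then 0 else of_nat (k choose (j - 1))) * of_nat c ^ j * ?t (Suc k - j) j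
        = of_nat (Suc k choose j) * of_nat c ^ j * ?t (Suc k - j) j"
      by (cases j) (simp_all add: algebra_simps)
  qed
  finally show ?case .
qed simp

context
  fixes \<phi> :: "'a::comm_ring_1 \<Rightarrow> 'l::field"
  assumes \<phi>: "unital_ring_hom \<phi>" and char_0: "\<And>n. of_nat (Suc n) \<noteq> (0 :: 'l)"
begin

lemma hom_of_nat_neq_0: "n \<noteq> 0 \<Longrightarrow> of_nat n \<noteq> (0 :: 'l)"
  using char_0 by (metis not0_implies_Suc)

lemma inj_of_nat': "inj (of_nat :: nat \<Rightarrow> 'l)"
proof (rule linorder_injI)
  fix a b :: nat assume "a < b"
  then have "of_nat b = of_nat a + (of_nat (b - a) :: 'l)" by (simp flip: of_nat_add)
  then show "of_nat a \<noteq> (of_nat b :: 'l)" using hom_of_nat_neq_0[of "b - a"] \<open>a < b\<close> by auto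
qed

text \<open>The value under \<open>\<phi>\<close> of the k-th power of \<open>E + c F\<close> at
  \<open>h\<close> is a polynomial in \<open>c\<close>, one of whose coefficients is a binomial
  coefficient times a value known to be nonzero. Some natural number avoids the finitely many roots
  for all of \<open>H\<close>.\<close>

lemma generic_direction_two:
  assumes E: "additive_map E" and F: "additive_map F" and comm: "\<And>x. E (F x) = F (E x)"
    and H: "finite H" "\<And>h. h \<in> H \<Longrightarrow> \<exists>a b. \<phi> ((E ^^ a) ((F ^^ b) h)) \<noteq> 0"
  obtains c where "\<And>h. h \<in> H \<Longrightarrow> \<exists>k. \<phi> (((\<lambda>x. E x + of_nat c * F x) ^^ k) h) \<noteq> 0"
proof -
  obtain a b where ab: "\<And>h. h \<in> H \<Longrightarrow> \<phi> ((E ^^ a h) ((F ^^ b h) h)) \<noteq> 0"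
    using H(2) by metis
  \<comment> \<open>The total order of the operator known not to kill \<open>h\<close>, so that this
    operator occurs in the expansion of the power.\<close>
  define k where "k h = a h + b h" for h
  define p where "p h = (\<Sum>j\<le>k h. monom (of_nat (k h choose j) * \<phi> ((E ^^ (k h - j)) ((F ^^ j) h))) j)" for h
  have eval: "poly (p h) (of_nat c) = \<phi> (((\<lambda>x. E x + of_nat c * F x) ^^ k h) h)" for c h
    unfolding funpow_linear_combination[OF E F comm]
    by (simp add: p_def poly_sum poly_monom unital_ring_hom_sum[OF \<phi>] unital_ring_homD[OF \<phi>]
        unital_ring_hom_power[OF \<phi>] unital_ring_hom_of_nat[OF \<phi>] mult_ac)
  have "p h \<noteq> 0" if "h \<in> H" for h
  proof -
    have "coeff (p h) (b h) = of_nat (k h choose b h) * \<phi> ((E ^^ a h) ((F ^^ b h) h))"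
      by (simp add: p_def coeff_sum k_def)
    then show ?thesis using ab[OF that] hom_of_nat_neq_0[of "k h choose b h"] by (auto simp: k_def)
  qed
  then have "(\<Prod>h\<in>H. p h) \<noteq> 0" using H(1) by simp
  then have "finite {x. poly (\<Prod>h\<in>H. p h) x = 0}" by (rule poly_roots_finite)
  moreover have "infinite (range (of_nat :: nat \<Rightarrow> 'l))"
    using inj_of_nat' by (simp add: finite_image_iff)
  ultimately obtain c where "poly (\<Prod>h\<in>H. p h) (of_nat c) \<noteq> 0"
    by (metis (mono_tags, lifting) finite_subset image_subset_iff mem_Collect_eq)
  then have "poly (p h) (of_nat c) \<noteq> 0" if "h \<in> H" for h
    using H(1) that by (auto simp: poly_prod)
  then show ?thesis unfolding eval using that by blast
qed

text \<open>Induction on the number of derivations: commutation lets the uses of \<open>D m\<close>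
  act first, the induction hypothesis treats the images \<open>(D m ^^ b h) h\<close>, and the
  direction so found is combined with \<open>D m\<close> by the case of two operators.\<close>

lemma generic_direction:
  fixes D :: "nat \<Rightarrow> 'a \<Rightarrow> 'a"
  assumes "\<And>i. i < m \<Longrightarrow> additive_map (D i)" and "\<And>i j x. i < m \<Longrightarrow> j < m \<Longrightarrow> D i (D j x) = D j (D i x)"
    and "finite H" and "\<And>h. h \<in> H \<Longrightarrow> \<exists>ws. set ws \<subseteq> {..<m} \<and> \<phi> (fold D ws h) \<noteq> 0"
  shows "\<exists>c :: nat \<Rightarrow> nat. \<forall>h\<in>H. \<exists>k. \<phi> (((\<lambda>x. \<Sum>i<m. of_nat (c i) * D i x) ^^ k) h) \<noteq> 0"
  using assms
proof (induction m arbitrary: H)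
  case 0
  then have "\<phi> h \<noteq> 0" if "h \<in> H" for h using that by fastforce
  then show ?case by (intro exI ballI exI[of _ 0]) simp
next
  case (Suc m)
  have fold_filter: "fold D ws h = fold D (filter (\<lambda>i. i \<noteq> m) ws) ((D m ^^ count_list ws m) h)"
    if "set ws \<subseteq> {..<Suc m}" for ws h
    using that
  proof (induction ws arbitrary: h)
    case (Cons i ws)
    have "(D m ^^ n) (D i h) = D i ((D m ^^ n) h)" for n
      using Suc.prems(2)[of m i] Cons.prems by (induction n) auto
    then show ?case using Cons by (simp add: funpow_swap1)
  qed simp
  have "\<exists>b ws. set ws \<subseteq> {..<m} \<and> \<phi> (fold D ws ((D m ^^ b) h)) \<noteq> 0" if "h \<in> H" for h
  proof -
    obtain ws where ws: "set ws \<subseteq> {..<Suc m}" "\<phi> (fold D ws h) \<noteq> 0" using Suc.prems(4)[OF \<open>h \<in> H\<close>] by blast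
    then show ?thesis unfolding fold_filter[OF ws(1)]
      by (intro exI[of _ "count_list ws m"] exI[of _ "filter (\<lambda>i. i \<noteq> m) ws"]) auto
  qed
  then obtain b where b: "\<And>h. h \<in> H \<Longrightarrow> \<exists>ws. set ws \<subseteq> {..<m} \<and> \<phi> (fold D ws ((D m ^^ b h) h)) \<noteq> 0"
    by metis
  obtain c :: "nat \<Rightarrow> nat" where c: "\<forall>h\<in>(\<lambda>h. (D m ^^ b h) h) ` H. \<exists>k. \<phi> (((\<lambda>x. \<Sum>i<m. of_nat (c i) * D i x) ^^ k) h) \<noteq> 0"
    using Suc.IH[of "(\<lambda>h. (D m ^^ b h) h) ` H"] Suc.prems b by fastforce
  let ?E = "\<lambda>x. \<Sum>i<m. of_nat (c i) * D i x"
  have add: "additive_map (D i)" if "i < Suc m" for i using Suc.prems(1) that .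
  obtain c' where c': "\<And>h. h \<in> H \<Longrightarrow> \<exists>k. \<phi> (((\<lambda>x. ?E x + of_nat c' * D m x) ^^ k) h) \<noteq> 0"
  proof (rule generic_direction_two[of ?E "D m" H])
    show "additive_map ?E"
      using additive_mapD(1)[OF add] by (simp add: additive_map_def sum.distrib distrib_left)
    show "additive_map (D m)" by (rule add) simp
    show "?E (D m x) = D m (?E x)" for x
      using Suc.prems(2)[of m] by (simp add: additive_mapD[OF add[of m]])
    show "\<exists>a b. \<phi> ((?E ^^ a) ((D m ^^ b) h)) \<noteq> 0" if "h \<in> H" for h
      using c that by blast
  qed (use Suc.prems(3) in auto)
  have "(\<lambda>x. \<Sum>i<Suc m. of_nat ((c(m := c')) i) * D i x) = (\<lambda>x. ?E x + of_nat c' * D m x)"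
    by (simp add: fun_eq_iff)
  then show ?case using c' by metis
qed

end

subsection \<open>Rational points of differential ideals\<close>

lemma mpoly_of_nat: "(of_nat n :: 'k::comm_ring_1 mpoly) = mpoly_const (of_nat n)"
  unfolding mpoly_const_def single_of_nat ..

lemma derivation_sum_of_nat_mult:
  assumes "\<And>i. i < m \<Longrightarrow> derivation (d i)"
  shows "derivation (\<lambda>x. \<Sum>i<m. of_nat (c i) * d i x)"
  unfolding derivation_def
proof (intro conjI allI)
  fix x y
  show "(\<Sum>i<m. of_nat (c i) * d i (x + y)) = (\<Sum>i<m. of_nat (c i) * d i x) + (\<Sum>i<m. of_nat (c i) * d i y)"
    by (simp add: derivationD(1)[OF assms] distrib_left sum.distrib)
  show "(\<Sum>i<m. of_nat (c i) * d i (x * y))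
      = (\<Sum>i<m. of_nat (c i) * d i x) * y + x * (\<Sum>i<m. of_nat (c i) * d i y)"
    unfolding sum_distrib_left sum_distrib_right sum.distrib[symmetric]
    by (rule sum.cong[OF refl]) (simp only: lessThan_iff derivationD(2)[OF assms] distrib_left mult_ac)
qed

text \<open>The condition on \<open>f\<close> describes the largest differential ideal of
  polynomials vanishing at \<open>\<xi>\<close>, by words in the derivations. The point found over K
  is a zero of all of it.\<close>

theorem diff_ideal_rational_point:
  fixes \<delta> :: "nat \<Rightarrow> 'k::field_char_0 \<Rightarrow> 'k" and \<iota> :: "'k \<Rightarrow> 'l::field" and \<xi> :: "nat \<Rightarrow> 'l"
  assumes large: "large_field TYPE('k)"
    and \<delta>: "differential_ring m \<delta>"
    and \<iota>: "unital_ring_hom \<iota>" and ec: "existentially_closed \<iota>"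
    and \<sigma>_V: "\<And>i v. i < m \<Longrightarrow> v \<in> V \<Longrightarrow> \<sigma> i v \<in> V"
    and \<sigma>_mono: "\<And>i v w. i < m \<Longrightarrow> v \<in> V \<Longrightarrow> w \<in> V \<Longrightarrow> v < w \<Longrightarrow> \<sigma> i v < \<sigma> i w"
    and \<sigma>_gt: "\<And>i v. i < m \<Longrightarrow> v \<in> V \<Longrightarrow> v < \<sigma> i v"
    and \<sigma>_comm: "\<And>i j v. i < m \<Longrightarrow> j < m \<Longrightarrow> v \<in> V \<Longrightarrow> \<sigma> i (\<sigma> j v) = \<sigma> j (\<sigma> i v)"
    and dickson: "\<And>U. U \<subseteq> V \<Longrightarrow>
      \<exists>M\<subseteq>U. finite M \<and> (\<forall>u\<in>U. \<exists>v\<in>M. \<exists>ws. set ws \<subseteq> {..<m} \<and> u = fold \<sigma> ws v)"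
    and \<xi>: "\<And>v. v \<notin> V \<Longrightarrow> \<xi> v = 0"
  defines "D \<equiv> \<lambda>i. mpoly_deriv (\<delta> i) (\<lambda>v. if v \<in> V then mpoly_var (\<sigma> i v) else 0)"
  shows "\<exists>a. \<forall>f. (\<forall>ws. set ws \<subseteq> {..<m} \<longrightarrow> mpoly_eval \<iota> (fold D ws f) \<xi> = 0) \<longrightarrow> mpoly_eval (\<lambda>c. c) f a = 0"
proof -
  define \<phi> where "\<phi> f = mpoly_eval \<iota> f \<xi>" for f
  have \<phi>: "unital_ring_hom \<phi>" unfolding \<phi>_def by (rule mpoly_eval_hom[OF \<iota>])
  note \<phi>s = unital_ring_homD[OF \<phi>]
  define Q where "Q = {f. \<forall>ws. set ws \<subseteq> {..<m} \<longrightarrow> \<phi> (fold D ws f) = 0}"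
  have d\<delta>: "derivation (\<delta> i)" if "i < m" for i using \<delta> that by (simp add: differential_ring_def)
  have dD: "derivation (D i)" if "i < m" for i unfolding D_def by (rule mpoly_deriv_derivation[OF d\<delta>[OF that]])
  have D_const: "D i (mpoly_const c) = mpoly_const (\<delta> i c)" if "i < m" for i c
    unfolding D_def by (rule mpoly_deriv_const[OF d\<delta>[OF that]])
  have D_var: "D i (mpoly_var v) = (if v \<in> V then mpoly_var (\<sigma> i v) else 0)" if "i < m" for i v
    unfolding D_def by (rule mpoly_deriv_var[OF d\<delta>[OF that]])
  have D_comm: "D i (D j f) = D j (D i f)" if "i < m" "j < m" for i j f
  proof (induction f rule: mpoly_induct)
    case (const c)
    then show ?case using that \<delta> by (simp add: D_const differential_ring_def)
  next
    case (var v)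
    then show ?case using that
      by (simp add: D_var \<sigma>_V \<sigma>_comm derivationD[OF dD])
  qed (simp_all add: that derivationD[OF dD] algebra_simps)
  have fold_add: "fold D ws (f + g) = fold D ws f + fold D ws g" if "set ws \<subseteq> {..<m}" for ws f g
    using that by (induction ws arbitrary: f g) (simp_all add: derivationD[OF dD])
  have QD: "D i f \<in> Q" if "f \<in> Q" "i < m" for f i
    unfolding Q_def
  proof (intro CollectI allI impI)
    fix ws assume "set ws \<subseteq> {..<m}"
    then have "\<phi> (fold D (i # ws) f) = 0" using that by (auto simp: Q_def simp del: fold.simps)
    then show "\<phi> (fold D ws (D i f)) = 0" by simp
  qed
  have Q_add: "f + g \<in> Q" if "f \<in> Q" "g \<in> Q" for f g
    using that by (auto simp: Q_def fold_add \<phi>s)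
  have Q_mult: "g * f \<in> Q" if "f \<in> Q" for f g
  proof -
    have "\<phi> (fold D ws (g * f)) = 0" if "set ws \<subseteq> {..<m}" "f \<in> Q" for ws
      using that
    proof (induction ws arbitrary: f g)
      case Nil
      then show ?case by (auto simp: Q_def \<phi>s dest: spec[of _ "[]"])
    next
      case (Cons i ws)
      then show ?case by (simp add: derivationD[OF dD] fold_add \<phi>s QD)
    qed
    then show ?thesis using that by (simp add: Q_def)
  qed
  have fold_0: "fold D ws 0 = 0" if "set ws \<subseteq> {..<m}" for ws
    using that by (induction ws) (simp_all add: derivationD[OF dD])
  have Q_0: "0 \<in> Q" by (simp add: Q_def fold_0 \<phi>s)
  interpret diff_ideal m \<delta> V \<sigma> Q
  proof
    fix i v w assume *: "i < m" "v \<in> V"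
    show "\<sigma> i v \<in> V" "v < \<sigma> i v" using * \<sigma>_V \<sigma>_gt by auto
    assume "w \<in> V" "v < w"
    then show "\<sigma> i v < \<sigma> i w" using * \<sigma>_mono by auto
  next
    fix i assume "i < m"
    then show "derivation (\<delta> i)" by (rule d\<delta>)
  next
    fix c assume "mpoly_const c \<in> Q"
    then have "\<phi> (mpoly_const c) = 0" by (auto simp: Q_def dest: spec[of _ "[]"])
    then show "c = 0" using inj_field_hom[OF \<iota>, of c] by (simp add: \<phi>_def \<iota>)
  next
    fix v assume v: "v \<notin> V"
    have "\<phi> (fold D ws (mpoly_var v)) = 0" if "set ws \<subseteq> {..<m}" for ws
      using that v by (cases ws) (simp_all add: \<phi>_def \<iota> \<xi> D_var fold_0)
    then show "mpoly_var v \<in> Q" by (simp add: Q_def)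
  next
    fix i f assume "i < m" "f \<in> Q"
    then show "mpoly_deriv (\<delta> i) (\<lambda>v. if v \<in> V then mpoly_var (\<sigma> i v) else 0) f \<in> Q"
      using QD unfolding D_def by blast
  qed (use dickson Q_0 Q_add Q_mult in auto)
  obtain r \<Lambda> F H where H: "finite H" "H \<subseteq> mpoly_ring r" "H \<inter> Q = {}"
    and F: "\<And>i. i \<in> \<Lambda> \<Longrightarrow> i < r \<Longrightarrow> F i \<in> Q" "\<And>i. i \<in> \<Lambda> \<Longrightarrow> i < r \<Longrightarrow> F i \<in> mpoly_ring (Suc i)"
      "\<And>i. i \<in> \<Lambda> \<Longrightarrow> i < r \<Longrightarrow> mpoly_pderiv i (F i) \<in> H"
    and concl: "\<forall>a0. (\<forall>i\<in>\<Lambda>. i < r \<longrightarrow> mpoly_eval (\<lambda>c. c) (F i) a0 = 0) \<longrightarrow>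
       (\<forall>h\<in>H. mpoly_eval (\<lambda>c. c) h a0 \<noteq> 0) \<longrightarrow>
       (\<exists>a. \<forall>f\<in>Q. mpoly_eval (\<lambda>c. c) f a = 0)"
    by (rule finite_characteristic_system) (rule that)
  \<comment> \<open>The type of L carries no assumption on its characteristic; it is inherited from
    K through \<open>\<iota>\<close>.\<close>
  have char_0: "of_nat (Suc n) \<noteq> (0 :: 'l)" for n
  proof -
    have "\<iota> (of_nat (Suc n)) \<noteq> 0" unfolding inj_field_hom[OF \<iota>] by (rule of_nat_neq_0)
    then show ?thesis by (simp only: unital_ring_hom_of_nat[OF \<iota>] not_False_eq_True)
  qed
  have "\<exists>c :: nat \<Rightarrow> nat. \<forall>h\<in>H. \<exists>k. \<phi> (((\<lambda>x. \<Sum>i<m. of_nat (c i) * D i x) ^^ k) h) \<noteq> 0"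
  proof (rule generic_direction[OF \<phi> char_0])
    show "additive_map (D i)" if "i < m" for i using derivationD[OF dD[OF that]] by (simp add: additive_map_def)
    show "\<exists>ws. set ws \<subseteq> {..<m} \<and> \<phi> (fold D ws h) \<noteq> 0" if "h \<in> H" for h
      using H(3) that by (auto simp: Q_def)
  qed (use D_comm H in auto)
  then obtain c :: "nat \<Rightarrow> nat"
    where "\<forall>h\<in>H. \<exists>k. \<phi> (((\<lambda>x. \<Sum>i<m. of_nat (c i) * D i x) ^^ k) h) \<noteq> 0" ..
  then obtain kf where kf: "\<forall>h\<in>H. \<phi> (((\<lambda>x. \<Sum>i<m. of_nat (c i) * D i x) ^^ kf h) h) \<noteq> 0"
    using bchoice[of H "\<lambda>h k. \<phi> (((\<lambda>x. \<Sum>i<m. of_nat (c i) * D i x) ^^ k) h) \<noteq> 0"] by blast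
  define \<theta> where "\<theta> = (\<lambda>x. \<Sum>i<m. of_nat (c i) * D i x)"
  define \<delta>c where "\<delta>c = (\<lambda>x. \<Sum>i<m. of_nat (c i) * \<delta> i x)"
  have \<theta>_const: "\<theta> (mpoly_const x) = mpoly_const (\<delta>c x)" for x
    unfolding \<theta>_def \<delta>c_def unital_ring_hom_sum[OF mpoly_const_hom]
    by (rule sum.cong[OF refl])
      (simp only: lessThan_iff D_const mpoly_of_nat unital_ring_homD(3)[OF mpoly_const_hom])
  have Q_\<theta>: "(\<theta> ^^ j) f \<in> Q" if "f \<in> Q" for f j
  proof (induction j)
    case (Suc j)
    have "(\<Sum>i\<in>A. of_nat (c i) * D i ((\<theta> ^^ j) f)) \<in> Q" if "A \<subseteq> {..<m}" for A
      using that by (induction A rule: infinite_finite_induct) (auto simp: Q_0 intro!: Q_add Q_mult QD Suc)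
    from this[of "{..<m}"] show ?case by (simp add: \<theta>_def)
  qed (use that in simp)
  define k where "k = Max (insert 0 (kf ` H))"
  have k: "kf h \<le> k" if "h \<in> H" for h unfolding k_def using that H(1) by auto
  \<comment> \<open>The precision that the Newton step demands; it dictates how many derivatives of
    each equation are imposed.\<close>
  let ?N = "Suc r * Suc k"
  define Eqs where "Eqs = (\<lambda>(i, j). (\<theta> ^^ j) (F i)) ` ((\<Lambda> \<inter> {..<r}) \<times> {..<?N})"
  define h0 where "h0 = (\<Prod>h\<in>H. (\<theta> ^^ kf h) h)"
  have "finite (insert h0 Eqs)" by (simp add: Eqs_def)
  then obtain w where w: "insert h0 Eqs \<subseteq> mpoly_ring w" by (rule finite_mpoly_ring_bound)
  \<comment> \<open>Rabinowitsch's trick: the fresh variable \<open>w\<close> takes the inverse of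
    the value of \<open>h0\<close>, so that nonvanishing becomes one of the equations transferred to
    K.\<close>
  define \<xi>' where "\<xi>' = \<xi>(w := 1 / \<phi> h0)"
  have \<xi>': "mpoly_eval \<iota> f \<xi>' = \<phi> f" if "f \<in> insert h0 Eqs" for f
    unfolding \<phi>_def by (rule mpoly_eval_cong[of _ w]) (use that w in \<open>auto simp: \<xi>'_def\<close>)
  have "\<phi> h0 \<noteq> 0" using H(1) kf by (simp add: h0_def unital_ring_hom_prod[OF \<phi>] \<theta>_def)
  then have "mpoly_eval \<iota> (h0 * mpoly_var w - 1) \<xi>' = 0"
    by (simp add: unital_ring_homD[OF mpoly_eval_hom[OF \<iota>]] \<iota> \<xi>') (simp add: \<xi>'_def)
  moreover have "mpoly_eval \<iota> f \<xi>' = 0" if f: "f \<in> Eqs" for f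
  proof -
    have "f \<in> Q" using f F(1) Q_\<theta> by (auto simp: Eqs_def)
    then show ?thesis using f by (auto simp: \<xi>' Q_def dest: spec[of _ "[]"])
  qed
  ultimately
  have "\<exists>x. \<forall>f\<in>insert (h0 * mpoly_var w - 1) Eqs. mpoly_eval \<iota> f x = 0"
    by (intro exI[of _ \<xi>']) auto
  moreover have "finite (insert (h0 * mpoly_var w - 1) Eqs)" by (simp add: Eqs_def)
  ultimately have "\<exists>x. \<forall>f\<in>insert (h0 * mpoly_var w - 1) Eqs. mpoly_eval (\<lambda>c. c) f x = 0"
    using ec unfolding existentially_closed_def by blast
  then obtain x where "\<forall>f\<in>insert (h0 * mpoly_var w - 1) Eqs. mpoly_eval (\<lambda>c. c) f x = 0" ..
  note x = bspec[OF this]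
  define \<psi> where "\<psi> f = mpoly_eval (\<lambda>c. c) f x" for f
  have \<psi>: "unital_ring_hom \<psi>" unfolding \<psi>_def by (rule mpoly_eval_hom[OF unital_ring_hom_id])
  have \<psi>_const: "\<psi> (mpoly_const c) = c" for c by (simp add: \<psi>_def unital_ring_hom_id)
  interpret T: fps_taylor \<delta>c \<theta> \<psi>
    by unfold_locales (auto simp: \<delta>c_def \<theta>_def intro!: derivation_sum_of_nat_mult d\<delta> dD \<psi>)
  have T_hom: "unital_ring_hom T.T"
    by (rule T.T_hom[of mpoly_const]) (simp_all add: \<theta>_const \<psi>_const unital_ring_homD[OF mpoly_const_hom])
  have T_eval: "mpoly_eval fps_const f (\<lambda>v. T.T (mpoly_var v)) = T.T f" for f
    using mpoly_hom_eq_eval[OF T_hom, of f] by (simp add: T.T_const[of mpoly_const] \<theta>_const \<psi>_const)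
  have T_H: "\<exists>n\<le>k. fps_nth (T.T h) n \<noteq> 0" if h: "h \<in> H" for h
  proof -
    have "\<psi> h0 * x w = 1"
      using x[of "h0 * mpoly_var w - 1"]
      by (simp add: \<psi>_def unital_ring_homD[OF mpoly_eval_hom[OF unital_ring_hom_id]] unital_ring_hom_id)
    then have "\<psi> h0 \<noteq> 0" by auto
    then have "\<psi> ((\<theta> ^^ kf h) h) \<noteq> 0"
      using H(1) h by (auto simp: h0_def unital_ring_hom_prod[OF \<psi>])
    then obtain n where "n \<le> kf h" "fps_nth (T.T h) n \<noteq> 0" by (rule T.T_nth_neq_0)
    then show ?thesis using k[OF h] by (meson le_trans)
  qed
  obtain a0 where "\<And>i. i \<in> \<Lambda> \<Longrightarrow> i < r \<Longrightarrow> mpoly_eval (\<lambda>c. c) (F i) a0 = 0"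
    "\<And>h. h \<in> H \<Longrightarrow> mpoly_eval (\<lambda>c. c) h a0 \<noteq> 0"
  proof (rule approximate_solution_imp_rational_point[OF large, of \<Lambda> r F k "\<lambda>v. T.T (mpoly_var v)" H])
    show "fps_X ^ ?N dvd mpoly_eval fps_const (F i) (\<lambda>v. T.T (mpoly_var v))" if i: "i \<in> \<Lambda>" "i < r" for i
      unfolding fps_X_power_dvd_iff T_eval
    proof (intro allI impI)
      fix n assume n: "n < ?N"
      show "fps_nth (T.T (F i)) n = 0"
      proof (rule T.T_nth_eq_0[OF _ n])
        fix j assume "j < ?N"
        then have "(\<theta> ^^ j) (F i) \<in> Eqs" using i unfolding Eqs_def by (intro image_eqI[of _ _ "(i, j)"]) auto
        then show "\<psi> ((\<theta> ^^ j) (F i)) = 0" unfolding \<psi>_def by (intro x) auto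
      qed
    qed
  qed (use F H T_H in \<open>auto simp: T_eval\<close>)
  then have "\<exists>a. \<forall>f\<in>Q. mpoly_eval (\<lambda>c. c) f a = 0" using concl by blast
  then show ?thesis unfolding Q_def \<phi>_def by blast
qed

subsection \<open>Dickson's lemma and an orderly enumeration of the derivatives\<close>

text \<open>Some subsequence is monotone; if it decreases, it reaches its minimum and is constant
  from there on.\<close>

lemma nat_seq_incseq_subseq:
  fixes s :: "nat \<Rightarrow> nat"
  obtains f where "strict_mono f" "incseq (s \<circ> f)"
proof -
  obtain f where f: "strict_mono f" "monoseq (\<lambda>n. s (f n))" using seq_monosub by blast
  show ?thesis
  proof (cases "incseq (\<lambda>n. s (f n))")
    case True
    then show ?thesis using f(1) that by (simp add: comp_def)
  next
    case False
    then have dec: "decseq (\<lambda>n. s (f n))" using f(2) by (simp add: monoseq_iff)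
    obtain N where N: "\<And>n. s (f N) \<le> s (f n)"
      using ex_has_least_nat[of "\<lambda>_. True" 0 "\<lambda>n. s (f n)"] by auto
    have "s (f (n + N)) = s (f N)" for n
      using N[of "n + N"] decseqD[OF dec, of N "n + N"] by simp
    then have "incseq (s \<circ> (\<lambda>n. f (n + N)))" by (simp add: comp_def)
    moreover have "strict_mono (\<lambda>n. f (n + N))" using f(1) by (simp add: strict_mono_def)
    ultimately show ?thesis using that by blast
  qed
qed

lemma dickson_subseq:
  fixes e :: "nat \<Rightarrow> nat \<Rightarrow> nat"
  shows "\<exists>r. strict_mono r \<and> (\<forall>i<m. incseq (\<lambda>k. e (r k) i))"
proof (induction m)
  case 0
  then show ?case by (intro exI[of _ "\<lambda>k. k"]) (simp add: strict_mono_def)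
next
  case (Suc m)
  then obtain r where r: "strict_mono r" "\<And>i. i < m \<Longrightarrow> incseq (\<lambda>k. e (r k) i)" by blast
  obtain f where f: "strict_mono f" "incseq ((\<lambda>k. e (r k) m) \<circ> f)" by (rule nat_seq_incseq_subseq)
  have "incseq (\<lambda>k. e ((r \<circ> f) k) i)" if "i < Suc m" for i
  proof (cases "i = m")
    case False
    then have "incseq (\<lambda>k. e (r k) i)" using r(2) that by simp
    then show ?thesis using strict_mono_less_eq[OF f(1)] by (simp add: incseq_def)
  qed (use f(2) in \<open>simp add: comp_def\<close>)
  then show ?case using strict_mono_o[OF r(1) f(1)] by blast
qed

lemma finite_bounded_exponents:
  assumes "finite S"
  shows "finite {f :: nat \<Rightarrow>\<^sub>0 nat. Poly_Mapping.keys f \<subseteq> S \<and> (\<forall>i\<in>S. Poly_Mapping.lookup f i \<le> B)}" (is "finite ?F")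
proof -
  have "Poly_Mapping.lookup ` ?F \<subseteq> {g. \<forall>i. (i \<in> S \<longrightarrow> g i \<in> {..B}) \<and> (i \<notin> S \<longrightarrow> g i = 0)}"
    by (auto simp: in_keys_iff subset_iff)
  then have "finite (Poly_Mapping.lookup ` ?F)"
    by (rule finite_subset) (rule finite_set_of_finite_funs, use assms in auto)
  then show ?thesis by (rule finite_imageD) (simp add: inj_on_def poly_mapping.lookup_inject)
qed

definition unit_exp :: "nat \<Rightarrow> nat \<Rightarrow>\<^sub>0 nat" where
  "unit_exp i = Poly_Mapping.single i 1"

lemma lookup_unit_exp: "Poly_Mapping.lookup (unit_exp i) j = (if i = j then 1 else 0)"
  by (simp add: unit_exp_def lookup_single when_def)

lemma lookup_add_unit: "Poly_Mapping.lookup (e + unit_exp i) j = Poly_Mapping.lookup e j + (if i = j then 1 else 0)"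
  by (simp add: lookup_add lookup_unit_exp)

lemma keys_add_unit: "Poly_Mapping.keys (e + unit_exp i) = insert i (Poly_Mapping.keys e)"
  by (auto simp: in_keys_iff lookup_add_unit split: if_splits)

lemma exponent_minus_unit:
  "Poly_Mapping.lookup e i \<noteq> 0 \<Longrightarrow> e = (e - unit_exp i) + unit_exp i"
  by (rule poly_mapping_eqI) (auto simp: lookup_add lookup_minus lookup_unit_exp)

text \<open>The exponent vector \<open>e\<close> stands for the derivative \<open>\<delta>\<^sub>0\<close>, ..., \<open>\<delta>\<^sub>m\<^sub>-\<^sub>1\<close> applied \<open>e 0\<close>, ...,
  \<open>e (m - 1)\<close> times to the generator number \<open>e m < n\<close>. Comparing total orders first makes the
  initial segments finite, so that a derivative can be coded by its position.\<close>

locale derivative_coding =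
  fixes m n :: nat
begin

definition order_of :: "(nat \<Rightarrow>\<^sub>0 nat) \<Rightarrow> nat" where
  "order_of e = (\<Sum>i<m. Poly_Mapping.lookup e i)"

definition A :: "(nat \<Rightarrow>\<^sub>0 nat) set" where
  "A = {e. Poly_Mapping.keys e \<subseteq> {..m} \<and> Poly_Mapping.lookup e m < n}"

text \<open>Ties are broken by the lexicographic order \<open><\<close> on exponent vectors, which
  is total and invariant under addition; the latter makes each \<open>\<sigma> i\<close>
  increasing.\<close>

definition before :: "(nat \<Rightarrow>\<^sub>0 nat) \<Rightarrow> (nat \<Rightarrow>\<^sub>0 nat) \<Rightarrow> bool" where
  "before e f \<longleftrightarrow> order_of e < order_of f \<or> order_of e = order_of f \<and> e < f"

definition code :: "(nat \<Rightarrow>\<^sub>0 nat) \<Rightarrow> nat" where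
  "code e = card {f \<in> A. before f e}"

definition V :: "nat set" where "V = code ` A"

definition decode :: "nat \<Rightarrow> nat \<Rightarrow>\<^sub>0 nat" where "decode = inv_into A code"

definition \<sigma> :: "nat \<Rightarrow> nat \<Rightarrow> nat" where "\<sigma> i v = code (decode v + unit_exp i)"

lemma before_trans: "before e f \<Longrightarrow> before f g \<Longrightarrow> before e g"
  by (auto simp: before_def)

lemma before_irrefl: "\<not> before e e"
  by (simp add: before_def)

lemma before_total: "e \<noteq> f \<Longrightarrow> before e f \<or> before f e"
  by (auto simp: before_def)

lemma order_of_add_unit: "i < m \<Longrightarrow> order_of (e + unit_exp i) = Suc (order_of e)"
  by (simp add: order_of_def lookup_add_unit sum.distrib)

lemma before_add_unit: "i < m \<Longrightarrow> before e f \<Longrightarrow> before (e + unit_exp i) (f + unit_exp i)"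
  by (auto simp: before_def order_of_add_unit)

lemma finite_before: "finite {f \<in> A. before f e}"
proof (rule finite_subset)
  let ?B = "order_of e + n"
  have "Poly_Mapping.lookup f i \<le> ?B" if "f \<in> A" "before f e" "i \<le> m" for f i
  proof (cases "i = m")
    case False
    then have "Poly_Mapping.lookup f i \<le> order_of f" unfolding order_of_def
      using that(3) by (intro member_le_sum) auto
    then show ?thesis using that(2) by (auto simp: before_def)
  qed (use that in \<open>simp add: A_def\<close>)
  then show "{f \<in> A. before f e}
      \<subseteq> {f. Poly_Mapping.keys f \<subseteq> {..m} \<and> (\<forall>i\<in>{..m}. Poly_Mapping.lookup f i \<le> ?B)}"
    by (auto simp: A_def)
  show "finite {f. Poly_Mapping.keys f \<subseteq> {..m} \<and> (\<forall>i\<in>{..m}. Poly_Mapping.lookup f i \<le> ?B)}"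
    by (rule finite_bounded_exponents) simp
qed

lemma code_less: "e \<in> A \<Longrightarrow> before e f \<Longrightarrow> code e < code f"
  unfolding code_def
  by (rule psubset_card_mono[OF finite_before]) (use before_trans before_irrefl in blast)

lemma code_less_iff: "e \<in> A \<Longrightarrow> f \<in> A \<Longrightarrow> code e < code f \<longleftrightarrow> before e f"
  using code_less before_total by (metis less_asym less_irrefl)

lemma inj_code: "inj_on code A"
  using code_less before_total by (metis inj_onI less_irrefl)

lemma decode_code [simp]: "e \<in> A \<Longrightarrow> decode (code e) = e"
  by (simp add: decode_def inj_code)

lemma code_decode [simp]: "v \<in> V \<Longrightarrow> code (decode v) = v"
  by (simp add: V_def decode_def f_inv_into_f)

lemma decode_A: "v \<in> V \<Longrightarrow> decode v \<in> A"
  by (auto simp: V_def)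

lemma A_add_unit: "i < m \<Longrightarrow> e \<in> A \<Longrightarrow> e + unit_exp i \<in> A"
  by (simp add: A_def keys_add_unit lookup_add_unit)

lemma \<sigma>_code: "e \<in> A \<Longrightarrow> \<sigma> i (code e) = code (e + unit_exp i)"
  by (simp add: \<sigma>_def)

lemma decode_\<sigma>: "i < m \<Longrightarrow> v \<in> V \<Longrightarrow> decode (\<sigma> i v) = decode v + unit_exp i"
  by (simp add: \<sigma>_def A_add_unit decode_A)

lemma \<sigma>_V: "i < m \<Longrightarrow> v \<in> V \<Longrightarrow> \<sigma> i v \<in> V"
  by (auto simp: V_def \<sigma>_code A_add_unit)

lemma \<sigma>_mono: "i < m \<Longrightarrow> v \<in> V \<Longrightarrow> w \<in> V \<Longrightarrow> v < w \<Longrightarrow> \<sigma> i v < \<sigma> i w"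
  using code_less_iff[of "decode v" "decode w"]
  by (simp add: \<sigma>_def code_less A_add_unit decode_A before_add_unit)

lemma \<sigma>_gt: "i < m \<Longrightarrow> v \<in> V \<Longrightarrow> v < \<sigma> i v"
  using code_less[OF decode_A, of v "decode v + unit_exp i"]
  by (simp add: \<sigma>_def before_def order_of_add_unit)

lemma \<sigma>_comm: "i < m \<Longrightarrow> j < m \<Longrightarrow> v \<in> V \<Longrightarrow> \<sigma> i (\<sigma> j v) = \<sigma> j (\<sigma> i v)"
  by (simp add: \<sigma>_def A_add_unit decode_A, simp only: add_ac)

text \<open>Each missing unit is supplied by one \<open>\<sigma> i\<close>. The generator index in
  coordinate \<open>m\<close> must agree because no derivation changes it.\<close>

lemma derivative_word:
  assumes "e \<in> A" "f \<in> A" "\<And>i. i < m \<Longrightarrow> Poly_Mapping.lookup e i \<le> Poly_Mapping.lookup f i"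
    "Poly_Mapping.lookup e m = Poly_Mapping.lookup f m"
  shows "\<exists>ws. set ws \<subseteq> {..<m} \<and> code f = fold \<sigma> ws (code e)"
  using assms
proof (induction "order_of f - order_of e" arbitrary: e rule: less_induct)
  case (less e)
  show ?case
  proof (cases "\<exists>i<m. Poly_Mapping.lookup e i < Poly_Mapping.lookup f i")
    case False
    have "e = f"
    proof (rule poly_mapping_eqI)
      fix i
      consider "i < m" | "i = m" | "m < i" by linarith
      then show "Poly_Mapping.lookup e i = Poly_Mapping.lookup f i"
      proof cases
        case 1
        then show ?thesis using False less.prems(3)[of i] by auto
      next
        case 3
        then have "i \<notin> Poly_Mapping.keys e" "i \<notin> Poly_Mapping.keys f" using less.prems(1,2) by (auto simp: A_def)
        then show ?thesis by (simp add: in_keys_iff)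
      qed (use less.prems in simp)
    qed
    then show ?thesis by (intro exI[of _ "[]"]) simp
  next
    case True
    then obtain i where i: "i < m" "Poly_Mapping.lookup e i < Poly_Mapping.lookup f i" by blast
    let ?e = "e + unit_exp i"
    have "order_of e < order_of f" unfolding order_of_def
      by (rule sum_strict_mono_ex1) (use less.prems i in auto)
    then have "order_of f - order_of ?e < order_of f - order_of e" by (simp add: order_of_add_unit i(1))
    moreover have "Poly_Mapping.lookup ?e j \<le> Poly_Mapping.lookup f j" if "j < m" for j
      using less.prems(3)[OF that] i by (auto simp: lookup_add_unit)
    ultimately obtain ws where "set ws \<subseteq> {..<m}" "code f = fold \<sigma> ws (code ?e)"
      using less.hyps[of ?e] less.prems i by (auto simp: A_add_unit lookup_add_unit)
    then show ?thesis using i(1) by (intro exI[of _ "i # ws"]) (simp add: \<sigma>_code less.prems)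
  qed
qed

lemma dickson:
  assumes U: "U \<subseteq> V"
  shows "\<exists>M\<subseteq>U. finite M \<and> (\<forall>u\<in>U. \<exists>v\<in>M. \<exists>ws. set ws \<subseteq> {..<m} \<and> u = fold \<sigma> ws v)"
proof -
  define le where "le v u \<longleftrightarrow> (\<exists>ws. set ws \<subseteq> {..<m} \<and> u = fold \<sigma> ws v)" for v u
  have le_refl: "le u u" for u unfolding le_def by (intro exI[of _ "[]"]) simp
  have le_trans: "le v w \<Longrightarrow> le w u \<Longrightarrow> le v u" for v w u
  proof -
    assume "le v w" "le w u"
    then obtain ws ws' where "set ws \<subseteq> {..<m}" "w = fold \<sigma> ws v" "set ws' \<subseteq> {..<m}" "u = fold \<sigma> ws' w"
      unfolding le_def by (elim exE conjE) (rule that)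
    then show "le v u" unfolding le_def by (intro exI[of _ "ws @ ws'"]) simp
  qed
  have le_less: "v < u" if "le v u" "v \<in> V" "v \<noteq> u" for v u
  proof -
    have "v \<le> fold \<sigma> ws v \<and> fold \<sigma> ws v \<in> V" if "set ws \<subseteq> {..<m}" for ws
      using that \<open>v \<in> V\<close>
    proof (induction ws arbitrary: v)
      case (Cons i ws)
      then have i: "i < m" "set ws \<subseteq> {..<m}" by auto
      have "\<sigma> i v \<le> fold \<sigma> ws (\<sigma> i v) \<and> fold \<sigma> ws (\<sigma> i v) \<in> V"
        by (rule Cons.IH) (use i Cons.prems \<sigma>_V in auto)
      then show ?case using \<sigma>_gt[OF i(1) Cons.prems(2)] by simp
    qed simp
    then show ?thesis using that unfolding le_def by (metis nat_less_le)
  qed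
  \<comment> \<open>Minimal elements for reachability by derivations. A proper derivative has a
    larger code, so every element of \<open>U\<close> lies above a minimal one.\<close>
  define M where "M = {u \<in> U. \<forall>v\<in>U. le v u \<longrightarrow> v = u}"
  have "\<exists>v\<in>M. le v u" if "u \<in> U" for u
    using that
  proof (induction u rule: less_induct)
    case (less u)
    show ?case
    proof (cases "u \<in> M")
      case False
      then obtain v where "v \<in> U" "le v u" "v \<noteq> u" using less.prems by (auto simp: M_def)
      then show ?thesis using less.IH[of v] le_less[of v u] le_trans U by blast
    qed (use le_refl in blast)
  qed
  moreover have "finite M"
  proof (rule ccontr)
    assume "infinite M"
    then obtain s :: "nat \<Rightarrow> nat" where s: "inj s" "range s \<subseteq> M"
      using infinite_countable_subset by blast
    \<comment> \<open>The extra coordinate \<open>m + 1\<close> holds \<open>n\<close> minus the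
      generator index. When it and the index itself are both nondecreasing along a subsequence, the
      index is constant there.\<close>
    define e where "e k i = (if i \<le> m then Poly_Mapping.lookup (decode (s k)) i
        else n - Poly_Mapping.lookup (decode (s k)) m)" for k i
    obtain r where r: "strict_mono r" "\<And>i. i < m + 2 \<Longrightarrow> incseq (\<lambda>k. e (r k) i)"
      using dickson_subseq[of "m + 2" e] by blast
    let ?a = "s (r 0)" and ?b = "s (r 1)"
    have ab: "?a \<in> M" "?b \<in> M" using s by auto
    then have V: "?a \<in> V" "?b \<in> V" using U by (auto simp: M_def)
    have le: "e (r 0) i \<le> e (r 1) i" if "i < m + 2" for i using incseqD[OF r(2)[OF that], of 0 1] by simp
    have "le ?a ?b"
    proof -
      have "\<exists>ws. set ws \<subseteq> {..<m} \<and> code (decode ?b) = fold \<sigma> ws (code (decode ?a))"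
      proof (rule derivative_word)
        show "decode ?a \<in> A" "decode ?b \<in> A" using V decode_A by auto
        then have "Poly_Mapping.lookup (decode ?a) m < n" "Poly_Mapping.lookup (decode ?b) m < n"
          by (auto simp: A_def)
        then show "Poly_Mapping.lookup (decode ?a) m = Poly_Mapping.lookup (decode ?b) m"
          using le[of m] le[of "Suc m"] by (simp add: e_def)
        show "Poly_Mapping.lookup (decode ?a) i \<le> Poly_Mapping.lookup (decode ?b) i" if "i < m" for i
          using le[of i] that by (simp add: e_def)
      qed
      then show ?thesis using V by (simp add: le_def)
    qed
    then have "?a = ?b" using ab by (auto simp: M_def)
    then have "r 0 = r 1" using s(1) by (simp add: inj_eq)
    then show False using strict_monoD[OF r(1), of 0 1] by simp
  qed
  ultimately show ?thesis unfolding le_def M_def by (intro exI[of _ M]) (auto simp: M_def le_def)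
qed

end

subsection \<open>Iterating commuting maps\<close>

text \<open>Serves two kinds of commuting maps: the derivations of S, giving the derivatives of
  generators, and the defect operators on maps from S to K, giving Taylor coefficients.\<close>

definition multi_iterate :: "(nat \<Rightarrow> 'z \<Rightarrow> 'z) \<Rightarrow> nat \<Rightarrow> (nat \<Rightarrow>\<^sub>0 nat) \<Rightarrow> 'z \<Rightarrow> 'z" where
  "multi_iterate E k e = fold (\<lambda>i. E i ^^ Poly_Mapping.lookup e i) [0..<k]"

lemma multi_iterate_0 [simp]: "multi_iterate E k 0 z = z"
  by (induction k) (simp_all add: multi_iterate_def)

lemma multi_iterate_id: "(\<And>i. i < k \<Longrightarrow> Poly_Mapping.lookup e i = 0) \<Longrightarrow> multi_iterate E k e z = z"
  by (induction k) (simp_all add: multi_iterate_def)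

lemma multi_iterate_add_unit:
  assumes "\<And>i j z. i < m \<Longrightarrow> j < m \<Longrightarrow> E i (E j z) = E j (E i z)" and "i < m" "k \<le> m"
  shows "multi_iterate E k (e + unit_exp i) z = (if i < k then E i (multi_iterate E k e z) else multi_iterate E k e z)"
  using assms(3)
proof (induction k)
  case 0
  then show ?case by (simp add: multi_iterate_def)
next
  case (Suc k)
  have step: "multi_iterate E (Suc k) f z = (E k ^^ Poly_Mapping.lookup f k) (multi_iterate E k f z)" for f
    by (simp add: multi_iterate_def)
  have comm: "(E k ^^ l) (E i z) = E i ((E k ^^ l) z)" for l z
    using assms(1)[of k i] assms(2) Suc.prems by (induction l) auto
  show ?case
    using Suc by (auto simp: step lookup_add_unit comm less_Suc_eq)
qed

subsection \<open>The twisted Taylor morphism\<close>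

lemma mps_plus_nth: "mps_nth (f + g) e = mps_nth f e + mps_nth g e"
  and mps_minus_nth: "mps_nth (f - g) e = mps_nth f e - mps_nth g e"
  and mps_times_nth: "mps_nth (f * g) e = (\<Sum>(a, b)\<in>{(a, b). a + b = e}. mps_nth f a * mps_nth g b)"
  and mps_map_nth: "mps_nth (mps_map d f) e = d (mps_nth f e)"
  and mps_pderiv_nth: "mps_nth (mps_pderiv i f) e
    = of_nat (Poly_Mapping.lookup e i + 1) * mps_nth f (e + unit_exp i)"
  and mps_const_nth: "mps_nth (mps_const c) e = (if e = 0 then c else 0)"
  by (simp_all add: plus_mps_def minus_mps_def times_mps_def mps_map_def mps_pderiv_def mps_const_def unit_exp_def)

lemma mps_map_derivation: "derivation d \<Longrightarrow> derivation (mps_map d)"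
  unfolding derivation_def[of "mps_map d"]
  by (auto intro!: mps_eqI simp: mps_plus_nth mps_times_nth mps_map_nth derivationD derivation_sum
      sum.distrib case_prod_unfold)

text \<open>For a splitting of \<open>e\<close> plus a unit into a and b, the factor from
  differentiation is the sum of the exponents of variable \<open>i\<close> in a and in b. Its two
  parts yield the two terms of the Leibniz rule.\<close>

lemma mps_pderiv_derivation: "derivation (mps_pderiv i :: 'a::comm_ring_1 mps \<Rightarrow> 'a mps)"
  unfolding derivation_def
proof (intro conjI allI)
  fix f g :: "'a mps"
  show "mps_pderiv i (f + g) = mps_pderiv i f + mps_pderiv i g"
    by (rule mps_eqI) (simp add: mps_plus_nth mps_pderiv_nth distrib_left)
  show "mps_pderiv i (f * g) = mps_pderiv i f * g + f * mps_pderiv i g"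
  proof (rule mps_eqI)
    fix e
    let ?S = "\<lambda>e. {(a, b). a + b = (e :: nat \<Rightarrow>\<^sub>0 nat)}" and ?l = "\<lambda>a. Poly_Mapping.lookup a i"
    let ?u = "unit_exp i"
    have fin: "finite (?S e)" for e by (rule finite_exponent_splittings)
    \<comment> \<open>Splittings whose first part lacks variable \<open>i\<close> have weight 0; the
      others come from splittings of \<open>e\<close> by adding the unit to the first part.\<close>
    have half: "(\<Sum>(a, b)\<in>?S (e + ?u). of_nat (?l a) * (F a * G b))
        = (\<Sum>(a, b)\<in>?S e. of_nat (?l a + 1) * F (a + ?u) * G b)" for F G :: "(nat \<Rightarrow>\<^sub>0 nat) \<Rightarrow> 'a"
    proof -
      have "(\<Sum>(a, b)\<in>?S (e + ?u). of_nat (?l a) * (F a * G b))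
          = (\<Sum>(a, b)\<in>{(a, b). a + b = e + ?u \<and> ?l a \<noteq> 0}. of_nat (?l a) * (F a * G b))"
        by (rule sum.mono_neutral_right) (auto simp: fin intro!: Nat.gr0I)
      also have "\<dots> = (\<Sum>(a, b)\<in>?S e. of_nat (?l a + 1) * F (a + ?u) * G b)"
      proof (rule sum.reindex_bij_witness[where i = "\<lambda>(a, b). (a + ?u, b)" and j = "\<lambda>(a, b). (a - ?u, b)"])
        fix p :: "(nat \<Rightarrow>\<^sub>0 nat) \<times> (nat \<Rightarrow>\<^sub>0 nat)"
        assume p: "p \<in> {(a, b). a + b = e + ?u \<and> ?l a \<noteq> 0}"
        obtain a b where ab: "p = (a, b)" by (cases p)
        have a: "a = (a - ?u) + ?u" using p ab by (intro exponent_minus_unit) simp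
        have "(a - ?u) + b + ?u = e + ?u" using p ab a by (simp add: add.assoc add.commute[of ?u]) (metis a add.assoc add.commute)
        then have "(a - ?u) + b = e" by simp
        then show "(case p of (a, b) \<Rightarrow> (a - ?u, b)) \<in> ?S e" by (simp add: ab)
        show "(case case p of (a, b) \<Rightarrow> (a - ?u, b) of (a, b) \<Rightarrow> (a + ?u, b)) = p"
          using a by (simp add: ab)
        have "?l a = ?l (a - ?u) + 1" by (subst a) (simp add: lookup_add_unit)
        then show "(case case p of (a, b) \<Rightarrow> (a - ?u, b) of (a, b) \<Rightarrow> of_nat (?l a + 1) * F (a + ?u) * G b)
            = (case p of (a, b) \<Rightarrow> of_nat (?l a) * (F a * G b))"
          using a by (simp add: ab mult.assoc)
      qed (auto simp: lookup_add_unit add_ac)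
      finally show ?thesis .
    qed
    have swap: "(\<Sum>(a, b)\<in>?S e. h a b) = (\<Sum>(b, a)\<in>?S e. h a b)" for e and h :: "_ \<Rightarrow> _ \<Rightarrow> 'a"
      by (rule sum.reindex_bij_witness[where i = prod.swap and j = prod.swap]) (auto simp: add.commute)
    have "mps_nth (mps_pderiv i (f * g)) e
        = (\<Sum>(a, b)\<in>?S (e + ?u). of_nat (?l e + 1) * (mps_nth f a * mps_nth g b))"
      by (simp only: mps_pderiv_nth mps_times_nth sum_distrib_left case_prod_unfold)
    also have "\<dots> = (\<Sum>(a, b)\<in>?S (e + ?u). of_nat (?l a) * (mps_nth f a * mps_nth g b)
        + of_nat (?l b) * (mps_nth g b * mps_nth f a))"
    proof (rule sum.cong[OF refl], clarify)
      fix a b assume "a + b = e + ?u"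
      then have "?l (a + b) = ?l (e + ?u)" by simp
      then have "?l e + 1 = ?l a + ?l b" by (simp only: lookup_add lookup_unit_exp simp_thms if_True)
      then show "of_nat (?l e + 1) * (mps_nth f a * mps_nth g b)
          = of_nat (?l a) * (mps_nth f a * mps_nth g b) + of_nat (?l b) * (mps_nth g b * mps_nth f a)"
        by (simp only: of_nat_add distrib_right mult.commute[of "mps_nth g b"])
    qed
    also have "\<dots> = (\<Sum>(a, b)\<in>?S (e + ?u). of_nat (?l a) * (mps_nth f a * mps_nth g b))
        + (\<Sum>(b, a)\<in>?S (e + ?u). of_nat (?l b) * (mps_nth g b * mps_nth f a))"
      by (subst (2) swap) (simp add: case_prod_unfold sum.distrib)
    also have "\<dots> = mps_nth (mps_pderiv i f * g) e + (\<Sum>(b, a)\<in>?S e. of_nat (?l b + 1) * mps_nth g (b + ?u) * mps_nth f a)"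
      unfolding half by (simp add: mps_times_nth mps_pderiv_nth)
    also have "(\<Sum>(b, a)\<in>?S e. of_nat (?l b + 1) * mps_nth g (b + ?u) * mps_nth f a) = mps_nth (f * mps_pderiv i g) e"
      unfolding mps_times_nth mps_pderiv_nth by (subst swap) (simp add: mult_ac)
    finally show "mps_nth (mps_pderiv i (f * g)) e = mps_nth (mps_pderiv i f * g + f * mps_pderiv i g) e"
      by (simp add: mps_plus_nth)
  qed
qed

lemma exponent_induct [consumes 1, case_names zero add]:
  assumes "Poly_Mapping.keys e \<subseteq> {..<m}"
    and "P 0" and "\<And>e i. Poly_Mapping.keys e \<subseteq> {..<m} \<Longrightarrow> i < m \<Longrightarrow> P e \<Longrightarrow> P (e + unit_exp i)"
  shows "P e"
  using assms(1)
proof (induction "\<Sum>i<m. Poly_Mapping.lookup e i" arbitrary: e rule: less_induct)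
  case (less e)
  show ?case
  proof (cases "e = 0")
    case False
    then obtain i where i: "i \<in> Poly_Mapping.keys e" by (metis all_not_in_conv keys_eq_empty)
    define f where "f = e - unit_exp i"
    have e: "e = f + unit_exp i" unfolding f_def using i by (intro exponent_minus_unit) (simp add: in_keys_iff)
    have im: "i < m" and f: "Poly_Mapping.keys f \<subseteq> {..<m}" using i less.prems unfolding e keys_add_unit by auto
    have "(\<Sum>i<m. Poly_Mapping.lookup f i) < (\<Sum>i<m. Poly_Mapping.lookup e i)"
      unfolding e using im by (simp add: lookup_add_unit sum.distrib)
    then show ?thesis unfolding e by (intro assms(3) f im less.hyps) (simp_all add: e)
  qed (use assms(2) in simp)
qed

text \<open>The Taylor construction for all derivations at once. Commutation on both S and K makes
  the defect operators commute, so that iterating them by exponent vectors yields the mixed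
  coefficients.\<close>

locale mps_taylor =
  fixes m :: nat and \<delta> :: "nat \<Rightarrow> 'k::field_char_0 \<Rightarrow> 'k" and D :: "nat \<Rightarrow> 's::comm_ring_1 \<Rightarrow> 's" and \<Psi> :: "'s \<Rightarrow> 'k"
  assumes \<delta>: "differential_ring m \<delta>" and D: "differential_ring m D" and \<Psi>: "unital_ring_hom \<Psi>"
begin

lemma d\<delta>: "i < m \<Longrightarrow> derivation (\<delta> i)" and dD: "i < m \<Longrightarrow> derivation (D i)"
  using \<delta> D by (auto simp: differential_ring_def)

definition E :: "nat \<Rightarrow> ('s \<Rightarrow> 'k) \<Rightarrow> 's \<Rightarrow> 'k" where
  "E i \<chi> s = \<chi> (D i s) - \<delta> i (\<chi> s)"

definition T :: "'s \<Rightarrow> 'k mps" where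
  "T s = Abs_mps (\<lambda>e. if Poly_Mapping.keys e \<subseteq> {..<m}
     then multi_iterate E m e \<Psi> s / of_nat (\<Prod>i<m. fact (Poly_Mapping.lookup e i)) else 0)"

lemma E_comm: "i < m \<Longrightarrow> j < m \<Longrightarrow> E i (E j \<chi>) = E j (E i \<chi>)"
  using \<delta> D by (auto simp: E_def fun_eq_iff derivationD(6)[OF d\<delta>] differential_ring_def)

lemma T_mps_ring: "T s \<in> mps_ring m"
  by (simp add: T_def mps_ring_def)

lemma T_0: "mps_nth (T s) 0 = \<Psi> s"
  by (simp add: T_def)

text \<open>Coefficient form of compatibility with the twisted derivation; for exponents involving
  variables beyond the first \<open>m\<close> both sides are 0.\<close>

lemma T_add_unit:
  assumes i: "i < m"
  shows "of_nat (Poly_Mapping.lookup e i + 1) * mps_nth (T s) (e + unit_exp i)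
    = mps_nth (T (D i s)) e - \<delta> i (mps_nth (T s) e)"
proof (cases "Poly_Mapping.keys e \<subseteq> {..<m}")
  case False
  then show ?thesis by (simp add: T_def keys_add_unit derivationD[OF d\<delta>[OF i]])
next
  case True
  let ?c = "\<lambda>e. (\<Prod>j<m. fact (Poly_Mapping.lookup e j)) :: nat"
  have split: "?c f = fact (Poly_Mapping.lookup f i) * (\<Prod>j\<in>{..<m} - {i}. fact (Poly_Mapping.lookup f j))" for f
    using i by (intro prod.remove) auto
  have "(\<Prod>j\<in>{..<m} - {i}. fact (Poly_Mapping.lookup (e + unit_exp i) j)) = (\<Prod>j\<in>{..<m} - {i}. fact (Poly_Mapping.lookup e j) :: nat)"
    by (rule prod.cong) (auto simp: lookup_add_unit)
  then have c: "?c (e + unit_exp i) = (Poly_Mapping.lookup e i + 1) * ?c e"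
    unfolding split[of e] split[of "e + unit_exp i"] by (simp add: lookup_add_unit algebra_simps)
  have c0: "?c e \<noteq> 0" by simp
  have d: "\<delta> i (x / of_nat (?c e)) = \<delta> i x / of_nat (?c e)" for x
  proof -
    have "\<delta> i (of_nat (?c e) * (x / of_nat (?c e))) = of_nat (?c e) * \<delta> i (x / of_nat (?c e))"
      by (simp only: derivationD(2)[OF d\<delta>[OF i]] derivation_of_nat[OF d\<delta>[OF i]]) simp
    moreover have "of_nat (?c e) * (x / of_nat (?c e)) = x" using c0 by (simp del: of_nat_prod)
    ultimately show ?thesis using c0 by (simp add: field_simps del: of_nat_prod)
  qed
  have it: "multi_iterate E m (e + unit_exp i) \<Psi> s = multi_iterate E m e \<Psi> (D i s) - \<delta> i (multi_iterate E m e \<Psi> s)"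
    using multi_iterate_add_unit[of m E i m e \<Psi>] E_comm i by (simp add: E_def)
  have T_nth: "mps_nth (T a) f = multi_iterate E m f \<Psi> a / of_nat (?c f)" if "Poly_Mapping.keys f \<subseteq> {..<m}" for a f
    by (simp only: T_def mps_nth_Abs that if_True)
  have cancel: "k * (y / (k * z)) = y / z" if "k \<noteq> 0" for k y z :: 'k
    using that by simp
  have k: "(of_nat (Poly_Mapping.lookup e i + 1) :: 'k) \<noteq> 0" unfolding of_nat_eq_0_iff by simp
  have "Poly_Mapping.keys (e + unit_exp i) \<subseteq> {..<m}" using True i by (simp add: keys_add_unit)
  then show ?thesis
    by (simp only: T_nth True c it of_nat_mult cancel[OF k]) (simp only: d diff_divide_distrib)
qed

lemma T_add_unitI:
  assumes "i < m" "of_nat (Poly_Mapping.lookup e i + 1) * x = mps_nth (T (D i s)) e - \<delta> i (mps_nth (T s) e)"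
  shows "mps_nth (T s) (e + unit_exp i) = x"
proof -
  have "of_nat (Poly_Mapping.lookup e i + 1) * mps_nth (T s) (e + unit_exp i) = of_nat (Poly_Mapping.lookup e i + 1) * x"
    using T_add_unit[OF assms(1)] assms(2) by simp
  moreover have "(of_nat (Poly_Mapping.lookup e i + 1) :: 'k) \<noteq> 0" unfolding of_nat_eq_0_iff by simp
  ultimately show ?thesis by (simp only: mult_cancel_left) simp
qed

lemma T_deriv: "i < m \<Longrightarrow> T (D i s) = mps_twisted_deriv \<delta> i (T s)"
  by (rule mps_eqI)
    (simp only: mps_twisted_deriv_def mps_plus_nth mps_map_nth mps_pderiv_nth T_add_unit, simp)

lemma T_eqI:
  assumes "f \<in> mps_ring m" "\<And>e. Poly_Mapping.keys e \<subseteq> {..<m} \<Longrightarrow> mps_nth (T s) e = mps_nth f e"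
  shows "T s = f"
proof (rule mps_eqI)
  fix e
  show "mps_nth (T s) e = mps_nth f e"
    using assms T_mps_ring[of s] unfolding mps_ring_def by (cases "Poly_Mapping.keys e \<subseteq> {..<m}") (simp_all, metis)
qed

lemma T_add: "T (a + b) = T a + T b"
proof (rule T_eqI)
  show "T a + T b \<in> mps_ring m" by (auto simp: mps_ring_def mps_plus_nth T_def)
  show "mps_nth (T (a + b)) e = mps_nth (T a + T b) e" if "Poly_Mapping.keys e \<subseteq> {..<m}" for e
    using that
  proof (induction e arbitrary: a b rule: exponent_induct)
    case zero
    then show ?case by (simp add: mps_plus_nth T_0 unital_ring_homD[OF \<Psi>])
  next
    case (add e i)
    show ?case
      by (rule T_add_unitI[OF add(2)], unfold mps_plus_nth distrib_left T_add_unit[OF add(2)])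
        (simp add: mps_plus_nth add(3) derivationD[OF dD[OF add(2)]] derivationD[OF d\<delta>[OF add(2)]])
  qed
qed

lemma T_mult: "T (a * b) = T a * T b"
proof (rule T_eqI)
  show "T a * T b \<in> mps_ring m"
    unfolding mps_ring_def
  proof (intro CollectI allI impI)
    fix e assume "mps_nth (T a * T b) e \<noteq> 0"
    then obtain p where "p \<in> {(x, y). x + y = e}" "(case p of (x, y) \<Rightarrow> mps_nth (T a) x * mps_nth (T b) y) \<noteq> 0"
      unfolding mps_times_nth by (rule sum.not_neutral_contains_not_neutral)
    then obtain x y where "x + y = e" "mps_nth (T a) x * mps_nth (T b) y \<noteq> 0" by (cases p) auto
    then have "Poly_Mapping.keys x \<subseteq> {..<m}" "Poly_Mapping.keys y \<subseteq> {..<m}" "x + y = e"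
      using T_mps_ring[of a] T_mps_ring[of b] by (auto simp: mps_ring_def)
    then show "Poly_Mapping.keys e \<subseteq> {..<m}" using keys_add[of x y] by auto
  qed
  show "mps_nth (T (a * b)) e = mps_nth (T a * T b) e" if "Poly_Mapping.keys e \<subseteq> {..<m}" for e
    using that
  proof (induction e arbitrary: a b rule: exponent_induct)
    case zero
    have "{(x, y). x + y = (0 :: nat \<Rightarrow>\<^sub>0 nat)} = {(0, 0)}"
    proof -
      have "x = 0" if "x + y = 0" for x y :: "nat \<Rightarrow>\<^sub>0 nat"
        using that by (metis add_is_0 lookup_add lookup_zero poly_mapping_eqI)
      then show ?thesis by fastforce
    qed
    then show ?case by (simp add: mps_times_nth T_0 unital_ring_homD[OF \<Psi>])
  next
    case (add e i)
    note d = d\<delta>[OF add(2)]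
    have "of_nat (Poly_Mapping.lookup e i + 1) * mps_nth (T a * T b) (e + unit_exp i)
        = mps_nth (mps_pderiv i (T a * T b)) e" by (simp only: mps_pderiv_nth)
    also have "mps_pderiv i (T a * T b) = T (D i a) * T b + T a * T (D i b) - mps_map (\<delta> i) (T a * T b)"
      by (simp add: derivationD(2)[OF mps_pderiv_derivation] derivationD(2)[OF mps_map_derivation[OF d]]
          T_deriv[OF add(2)] mps_twisted_deriv_def algebra_simps)
    also have "mps_nth \<dots> e = mps_nth (T (D i (a * b))) e - \<delta> i (mps_nth (T (a * b)) e)"
      by (simp add: mps_minus_nth mps_plus_nth mps_map_nth add(3) derivationD(2)[OF dD[OF add(2)]] T_add)
    finally show ?case by (rule T_add_unitI[OF add(2)])
  qed
qed

lemma T_const: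
  assumes \<kappa>: "\<And>i c. i < m \<Longrightarrow> D i (\<kappa> c) = \<kappa> (\<delta> i c)" "\<And>c. \<Psi> (\<kappa> c) = c"
  shows "T (\<kappa> c) = mps_const c"
proof (rule T_eqI)
  show "mps_const c \<in> mps_ring m" by (simp add: mps_ring_def mps_const_nth)
  show "mps_nth (T (\<kappa> c)) e = mps_nth (mps_const c) e" if "Poly_Mapping.keys e \<subseteq> {..<m}" for e
    using that
  proof (induction e arbitrary: c rule: exponent_induct)
    case zero
    then show ?case by (simp add: T_0 mps_const_nth \<kappa>)
  next
    case (add e i)
    have "e + unit_exp i \<noteq> 0" using keys_add_unit[of e i] by auto
    then show ?case
      by (intro T_add_unitI[OF add(2)])
        (simp add: mps_const_nth add(3) \<kappa>(1)[OF add(2)] derivationD[OF d\<delta>[OF add(2)]])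
  qed
qed

end

theorem corollary3p5:
  fixes m :: nat
    and \<delta> :: "nat \<Rightarrow> 'k::field_char_0 \<Rightarrow> 'k"
    and \<alpha> :: "'k \<Rightarrow> 's::comm_ring_1"
    and D :: "nat \<Rightarrow> 's \<Rightarrow> 's"
  assumes "differential_ring m \<delta>"
    and "large_field TYPE('k)"
    and "differential_algebra m \<delta> \<alpha> D"
    and "differentially_finitely_generated m \<alpha> D"
    and "\<exists>(\<iota> :: 'k \<Rightarrow> 'l::field) (\<phi> :: 's \<Rightarrow> 'l).
           unital_ring_hom \<iota> \<and> existentially_closed \<iota> \<and> algebra_hom \<alpha> \<iota> \<phi>"
  shows "\<exists>\<psi> :: 's \<Rightarrow> 'k mps.
           range \<psi> \<subseteq> mps_ring m \<and>
           differential_algebra_hom m \<alpha> D mps_const (mps_twisted_deriv \<delta>) \<psi>"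
proof -
  obtain \<iota> :: "'k \<Rightarrow> 'l" and \<phi> :: "'s \<Rightarrow> 'l" where \<iota>: "unital_ring_hom \<iota>" "existentially_closed \<iota>"
    and \<phi>: "unital_ring_hom \<phi>" "\<And>c. \<phi> (\<alpha> c) = \<iota> c"
    using assms(5) by (auto simp: algebra_hom_def)
  have D: "differential_ring m D" and \<alpha>: "unital_ring_hom \<alpha>" and D\<alpha>: "\<And>i c. i < m \<Longrightarrow> D i (\<alpha> c) = \<alpha> (\<delta> i c)"
    using assms(3) by (auto simp: differential_algebra_def)
  have dD: "i < m \<Longrightarrow> derivation (D i)" and D_comm: "i < m \<Longrightarrow> j < m \<Longrightarrow> D i (D j s) = D j (D i s)" for i j s
    using D by (auto simp: differential_ring_def)
  have d\<delta>: "i < m \<Longrightarrow> derivation (\<delta> i)" for i using assms(1) by (simp add: differential_ring_def)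
  obtain G where G: "finite G" "diff_generated m \<alpha> D G = UNIV"
    using assms(4) by (auto simp: differentially_finitely_generated_def)
  obtain gen :: "nat \<Rightarrow> 's" and n where gen: "G = gen ` {..<n}"
    using G(1) by (metis finite_imp_nat_seg_image_inj_on lessThan_def)
  interpret derivative_coding m n .
  \<comment> \<open>Codes are sent to the derivatives of generators they represent and dummies to 0,
    so that \<open>\<pi>\<close> commutes with the derivations.\<close>
  define x where "x v = (if v \<in> V then multi_iterate D m (decode v) (gen (Poly_Mapping.lookup (decode v) m)) else 0)"
    for v
  define \<pi> where "\<pi> p = mpoly_eval \<alpha> p x" for p
  have \<pi>: "unital_ring_hom \<pi>" unfolding \<pi>_def by (rule mpoly_eval_hom[OF \<alpha>])
  define DD where "DD i = mpoly_deriv (\<delta> i) (\<lambda>v. if v \<in> V then mpoly_var (\<sigma> i v) else 0)" for i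
  have \<pi>_DD: "\<pi> (DD i p) = D i (\<pi> p)" if i: "i < m" for i p
  proof (induction p rule: mpoly_induct)
    case (const c)
    then show ?case by (simp add: DD_def mpoly_deriv_const[OF d\<delta>[OF i]] \<pi>_def \<alpha> D\<alpha> i)
  next
    case (var v)
    have "x (\<sigma> i v) = D i (x v)" if "v \<in> V"
      using that i by (simp add: x_def \<sigma>_V decode_\<sigma> lookup_add_unit multi_iterate_add_unit[of m D i m] D_comm)
    moreover have "D i (x v) = 0" if "v \<notin> V" using that by (simp add: x_def derivationD[OF dD[OF i]])
    ultimately show ?case
      by (simp add: DD_def mpoly_deriv_var[OF d\<delta>[OF i]] \<pi>_def \<alpha>)
  qed (simp_all add: DD_def derivationD[OF mpoly_deriv_derivation[OF d\<delta>[OF i]]] derivationD[OF dD[OF i]]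
      unital_ring_homD[OF \<pi>])
  have \<pi>_fold: "\<pi> (fold DD ws p) = fold D ws (\<pi> p)" if "set ws \<subseteq> {..<m}" for ws p
    using that by (induction ws arbitrary: p) (simp_all add: \<pi>_DD)
  have surj: "\<exists>p. \<pi> p = s" for s
  proof -
    have "s \<in> diff_generated m \<alpha> D G" using G(2) by simp
    then show ?thesis
    proof (induction rule: diff_generated.induct)
      case (scalar c)
      then show ?case by (intro exI[of _ "mpoly_const c"]) (simp add: \<pi>_def \<alpha>)
    next
      case (gen g)
      then obtain j where j: "j < n" "g = gen j" using \<open>G = gen ` {..<n}\<close> by auto
      let ?e = "Poly_Mapping.single m j :: nat \<Rightarrow>\<^sub>0 nat"
      have e: "?e \<in> A" using j by (auto simp: A_def)
      then have "x (code ?e) = g"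
        using j(2) multi_iterate_id[of m ?e D] by (auto simp: x_def V_def lookup_single)
      then show ?case by (intro exI[of _ "mpoly_var (code ?e)"]) (simp add: \<pi>_def \<alpha>)
    next
      case (add a b)
      then show ?case by (metis unital_ring_homD(2)[OF \<pi>])
    next
      case (mult a b)
      then show ?case by (metis unital_ring_homD(3)[OF \<pi>])
    next
      case (deriv a i)
      then show ?case using \<pi>_DD by metis
    qed
  qed
  have \<phi>\<pi>: "\<phi> (\<pi> p) = mpoly_eval \<iota> p (\<lambda>v. \<phi> (x v))" for p
    unfolding \<pi>_def by (subst hom_mpoly_eval[OF \<alpha> \<phi>(1)]) (simp add: \<phi>(2))
  have "\<exists>a. \<forall>f. (\<forall>ws. set ws \<subseteq> {..<m} \<longrightarrow> mpoly_eval \<iota> (fold DD ws f) (\<lambda>v. \<phi> (x v)) = 0)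
      \<longrightarrow> mpoly_eval (\<lambda>c. c) f a = 0"
    unfolding DD_def
    by (rule diff_ideal_rational_point[OF assms(2,1) \<iota> \<sigma>_V \<sigma>_mono \<sigma>_gt \<sigma>_comm dickson])
      (simp_all add: x_def unital_ring_homD[OF \<phi>(1)])
  then obtain a where a: "\<And>f. (\<And>ws. set ws \<subseteq> {..<m} \<Longrightarrow> \<phi> (\<pi> (fold DD ws f)) = 0) \<Longrightarrow> mpoly_eval (\<lambda>c. c) f a = 0"
    unfolding \<phi>\<pi> by blast
  let ?ev = "\<lambda>f. mpoly_eval (\<lambda>c. c) f a"
  have ev: "unital_ring_hom ?ev" by (rule mpoly_eval_hom[OF unital_ring_hom_id])
  have fold_0: "fold D ws 0 = 0" if "set ws \<subseteq> {..<m}" for ws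
    using that by (induction ws) (simp_all add: derivationD[OF dD])
  \<comment> \<open>The difference of two representatives has all its derivatives in the kernel of
    \<open>\<pi>\<close>, and \<open>a\<close> is a zero of such polynomials; evaluation at
    \<open>a\<close> therefore descends to S.\<close>
  have kernel: "?ev f = ?ev g" if "\<pi> f = \<pi> g" for f g
  proof -
    have "?ev (f - g) = 0"
      by (rule a) (simp add: \<pi>_fold unital_ring_homD[OF \<pi>] that fold_0 unital_ring_homD[OF \<phi>(1)])
    then show ?thesis by (simp add: unital_ring_homD[OF ev])
  qed
  define \<Psi> where "\<Psi> s = ?ev (SOME p. \<pi> p = s)" for s
  have \<Psi>_\<pi>: "\<Psi> (\<pi> p) = ?ev p" for p
    unfolding \<Psi>_def by (rule kernel) (rule someI[of _ p], rule refl)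
  have \<Psi>: "unital_ring_hom \<Psi>"
    unfolding unital_ring_hom_def
  proof (intro conjI allI)
    show "\<Psi> 1 = 1" using \<Psi>_\<pi>[of 1] by (simp add: unital_ring_homD[OF \<pi>] unital_ring_hom_id)
    fix s t
    obtain p q where "s = \<pi> p" "t = \<pi> q" using surj by metis
    then show "\<Psi> (s + t) = \<Psi> s + \<Psi> t" "\<Psi> (s * t) = \<Psi> s * \<Psi> t"
      using \<Psi>_\<pi>[of "p + q"] \<Psi>_\<pi>[of "p * q"]
      by (simp_all add: unital_ring_homD[OF \<pi>] unital_ring_homD[OF ev] \<Psi>_\<pi>)
  qed
  have \<Psi>_\<alpha>: "\<Psi> (\<alpha> c) = c" for c
    using \<Psi>_\<pi>[of "mpoly_const c"] by (simp add: \<pi>_def \<alpha> unital_ring_hom_id)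
  \<comment> \<open>\<open>\<Psi>\<close> is a K-algebra map to K that need not respect the
    derivations; its expansion in the variables t does.\<close>
  interpret T: mps_taylor m \<delta> D \<Psi> by unfold_locales (rule assms(1) D \<Psi>)+
  have T_\<alpha>: "T.T (\<alpha> c) = mps_const c" for c by (rule T.T_const[OF D\<alpha> \<Psi>_\<alpha>])
  have "T.T 1 = 1"
    using T_\<alpha>[of 1] by (simp add: unital_ring_homD[OF \<alpha>] mps_const_def one_mps_def)
  then have "differential_algebra_hom m \<alpha> D mps_const (mps_twisted_deriv \<delta>) T.T"
    by (simp add: differential_algebra_hom_def algebra_hom_def unital_ring_hom_def T.T_add T.T_mult T_\<alpha> T.T_deriv)
  then show ?thesis using T.T_mps_ring by blast
qed

end
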